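(* Suppose that $f$ satisfies the $(2r^*,4r^* )$-RSC of modulus $\alpha$ and the $(2r^*,4r^* )$-RSS of modulus $\beta$, with $\beta/\alpha\le 1.38$. Fix any $\lambda>0$ and any $(U^*,V^* )\in\mathcal{E}^*$, and write $W^*=(U^*;V^* )$. Then there exists a constant $\widehat{\gamma}>0$, depending only on $\alpha$ and $\beta$, such that for any critical point $(U,V)$ of $\Phi_\lambda$ with $\mathrm{rank}(UV^{\mathbb{T}})\le r^*$ and $\nabla^2\Phi_\lambda(U,V)$ positive semidefinite, with $W=(U;V)$, $$2\|UV^{\mathbb{T}}-M^*\|_F^2\le\|WW^{\mathbb{T}}-W^*{W^*}^{\mathbb{T}}\|_F^2\le\widehat{\gamma}\,r^*\|\Xi(M^* )\|^2\le 2\widehat{\gamma}\,r^*\big[\lambda^2+\|\nabla f(M^* )\|^2\big].$$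
   Context: Let $n\le m$ and let $M^*\in\mathbb{R}^{n\times m}$ be a matrix of rank $r^*\ge 1$ with $4r^*\le\min(m,n)$. Let $r$ be an integer with $r^*\le r<\min(n,m)$. $\|\cdot\|_F$ is the Frobenius norm, $\|\cdot\|$ the spectral norm of a matrix. $\mathbb{O}^{k}$ is the set of $k\times k$ orthogonal matrices. The function $f:\mathbb{R}^{n\times m}\to\mathbb{R}_+$ is twice continuously differentiable. It satisfies the $(2r^*,4r^* )$-RSC (restricted strong convexity) of modulus $\alpha$ and the $(2r^*,4r^* )$-RSS (restricted smoothness) of modulus $\beta$ if $0<\alpha\le\beta$ and for all $X,H\in\mathbb{R}^{n\times m}$ with $\mathrm{rank}(X)\le 2r^*$ and $\mathrm{rank}(H)\le 4r^*$, $\alpha\|H\|_F^2\le\nabla^2 f(X)(H,H)\le\beta\|H\|_F^2$. For $\lambda>0$, $\Phi_\lambda(U,V):=f(UV^{\mathbb{T}})+\frac{\lambda}{2}(\|U\|_F^2+\|V\|_F^2)$ for $(U,V)\in\mathbb{R}^{n\times r}\times\mathbb{R}^{m\times r}$; a critical point is a point where $\nabla\Phi_\lambda=0$. Define $$\Xi(X):=\begin{pmatrix}\lambda I&\nabla f(X)\\ \nabla f(X)^{\mathbb{T}}&\lambda I\end{pmatrix}\in\mathbb{R}^{(n+m)\times(n+m)}.$$ For matrices $U,V$ with the same number of columns, $(U;V)$ denotes the matrix obtained by stacking $U$ on top of $V$. $\mathcal{E}^*:=\{(P_1^*{\Sigma^*}^{1/2}R,\;Q_1^*{\Sigma^*}^{1/2}R)\mid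 (P^*,Q^* )\in\mathbb{O}^{n,m}(M^* ),\,R\in\mathbb{O}^{r^*}\}$, where $\mathbb{O}^{n,m}(M^* )$ is the set of $(P,Q)\in\mathbb{O}^n\times\mathbb{O}^m$ with $M^*=P\,\mathrm{Diag}(\sigma(M^* ))Q^{\mathbb{T}}$ ($\sigma(M^* )$ the vector of singular values in nonincreasing order, $\mathrm{Diag}$ the $n\times m$ rectangular diagonal matrix), $\Sigma^*=\mathrm{Diag}(\sigma_1(M^* ),\dots,\sigma_{r^*}(M^* ))\in\mathbb{R}^{r^*\times r^*}$, and $P_1^*,Q_1^*$ consist of the first $r^*$ columns of $P^*,Q^*$. *)

theory Defs
  imports
    Complex_Main
    "Jordan_Normal_Form.Matrix"
    "Jordan_Normal_Form.Char_Poly"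
    "Jordan_Normal_Form.DL_Rank"
begin

text \<open>
  All dimensions are natural numbers, not types, so that a constant can be chosen before
  the dimensions are quantified.  The space of real \<open>n \<times> m\<close> matrices is \<open>carrier_mat n m\<close>; a
  function on it is a function on \<^typ>\<open>real mat\<close> of which only the restriction to that carrier
  matters.
\<close>

section \<open>Norms, rank, orthogonal matrices\<close>

definition mat_inner :: "real mat \<Rightarrow> real mat \<Rightarrow> real" where
  "mat_inner A B = (\<Sum>i<dim_row A. \<Sum>j<dim_col A. A $$ (i, j) * B $$ (i, j))"

definition frob_norm :: "real mat \<Rightarrow> real" where
  "frob_norm A = sqrt (mat_inner A A)"

definition euclid_norm :: "real vec \<Rightarrow> real" where
  "euclid_norm x = sqrt (x \<bullet> x)"

definition spectral_norm :: "real mat \<Rightarrow> real" where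
  "spectral_norm A =
     (SUP x\<in>{x \<in> carrier_vec (dim_col A). euclid_norm x \<le> 1}. euclid_norm (A *\<^sub>v x))"

definition mat_rank :: "real mat \<Rightarrow> nat" where
  "mat_rank A = vec_space.rank (dim_row A) A"

definition orthogonal_matrices :: "nat \<Rightarrow> real mat set" where
  "orthogonal_matrices k = {R \<in> carrier_mat k k. R\<^sup>T * R = 1\<^sub>m k}"

section \<open>Singular values\<close>

text \<open>
  The list of the square roots of the eigenvalues, with multiplicity, of the smaller one of the
  two Gram matrices; hence \<open>min n m\<close> entries for an \<open>n \<times> m\<close> matrix, in nonincreasing order.
\<close>
definition singular_values :: "real mat \<Rightarrow> real list" where
  "singular_values A =
     rev (sorted_list_of_multiset (image_mset sqrt (proots (char_poly
       (if dim_row A \<le> dim_col A then A * A\<^sup>T else A\<^sup>T * A)))))"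

definition rect_diag :: "nat \<Rightarrow> nat \<Rightarrow> real list \<Rightarrow> real mat" where
  "rect_diag n m s = mat n m (\<lambda>(i, j). if i = j then s ! i else 0)"

definition svd_pairs :: "real mat \<Rightarrow> (real mat \<times> real mat) set" where
  "svd_pairs M =
     {(P, Q). P \<in> orthogonal_matrices (dim_row M) \<and> Q \<in> orthogonal_matrices (dim_col M) \<and>
        M = P * rect_diag (dim_row M) (dim_col M) (singular_values M) * Q\<^sup>T}"

definition first_cols :: "nat \<Rightarrow> real mat \<Rightarrow> real mat" where
  "first_cols k A = mat (dim_row A) k (\<lambda>(i, j). A $$ (i, j))"

definition opt_factors :: "real mat \<Rightarrow> (real mat \<times> real mat) set" where
  "opt_factors M =
     (let k = mat_rank M; S = mat_diag k (\<lambda>i. sqrt (singular_values M ! i)) in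
      {(first_cols k P * S * R, first_cols k Q * S * R) | P Q R.
         (P, Q) \<in> svd_pairs M \<and> R \<in> orthogonal_matrices k})"

section \<open>Differentiability of functions on a matrix space\<close>

text \<open>
  The neighbourhood filter of \<open>X\<close> in the space of matrices of the same format, with respect to
  the Frobenius norm.
\<close>
definition mat_nhds :: "real mat \<Rightarrow> real mat filter" where
  "mat_nhds X = inf (filtercomap (\<lambda>Y. frob_norm (Y - X)) (nhds 0))
                    (principal (carrier_mat (dim_row X) (dim_col X)))"

text \<open>
  Frechet differentiability, with the derivative represented by a matrix via the Frobenius
  inner product.  At \<open>Y = X\<close> the quotient is \<open>0 / 0 = 0\<close>.
\<close>
definition has_gradient :: "(real mat \<Rightarrow> real) \<Rightarrow> real mat \<Rightarrow> real mat \<Rightarrow> bool" where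
  "has_gradient g X G \<longleftrightarrow>
     G \<in> carrier_mat (dim_row X) (dim_col X) \<and>
     ((\<lambda>Y. (g Y - g X - mat_inner G (Y - X)) / frob_norm (Y - X)) \<longlongrightarrow> 0) (mat_nhds X)"

definition grad :: "(real mat \<Rightarrow> real) \<Rightarrow> real mat \<Rightarrow> real mat" where
  "grad g X = (THE G. has_gradient g X G)"

definition grad_entry :: "(real mat \<Rightarrow> real) \<Rightarrow> nat \<Rightarrow> nat \<Rightarrow> real mat \<Rightarrow> real" where
  "grad_entry g i j X = grad g X $$ (i, j)"

text \<open>
  \<open>hess g X H K\<close> is the second derivative as a bilinear form: the derivative of the gradient at
  \<open>X\<close> in direction \<open>H\<close>, taken entrywise, paired with \<open>K\<close>.
\<close>
definition hess :: "(real mat \<Rightarrow> real) \<Rightarrow> real mat \<Rightarrow> real mat \<Rightarrow> real mat \<Rightarrow> real" where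
  "hess g X H K =
     mat_inner (mat (dim_row X) (dim_col X) (\<lambda>(i, j). mat_inner (grad (grad_entry g i j) X) H)) K"

definition twice_cont_diff :: "nat \<Rightarrow> nat \<Rightarrow> (real mat \<Rightarrow> real) \<Rightarrow> bool" where
  "twice_cont_diff n m g \<longleftrightarrow>
     (\<forall>X \<in> carrier_mat n m.
        (\<exists>G. has_gradient g X G) \<and>
        (\<forall>i<n. \<forall>j<m. (\<exists>G. has_gradient (grad_entry g i j) X G) \<and>
           (\<forall>k<n. \<forall>l<m. (grad_entry (grad_entry g i j) k l \<longlongrightarrow>
                            grad_entry (grad_entry g i j) k l X) (mat_nhds X))))"

section \<open>The regularized factorized problem\<close>

definition RSC_RSS :: "nat \<Rightarrow> nat \<Rightarrow> nat \<Rightarrow> real \<Rightarrow> real \<Rightarrow> (real mat \<Rightarrow> real) \<Rightarrow> bool" where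
  "RSC_RSS n m k \<alpha> \<beta> f \<longleftrightarrow> 0 < \<alpha> \<and> \<alpha> \<le> \<beta> \<and>
     (\<forall>X \<in> carrier_mat n m. \<forall>H \<in> carrier_mat n m.
        mat_rank X \<le> 2 * k \<longrightarrow> mat_rank H \<le> 4 * k \<longrightarrow>
        \<alpha> * (frob_norm H)\<^sup>2 \<le> hess f X H H \<and> hess f X H H \<le> \<beta> * (frob_norm H)\<^sup>2)"

definition Phi :: "(real mat \<Rightarrow> real) \<Rightarrow> real \<Rightarrow> real mat \<Rightarrow> real mat \<Rightarrow> real" where
  "Phi f lam U V = f (U * V\<^sup>T) + lam / 2 * ((frob_norm U)\<^sup>2 + (frob_norm V)\<^sup>2)"

definition upper_rows :: "nat \<Rightarrow> real mat \<Rightarrow> real mat" where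
  "upper_rows n W = mat n (dim_col W) (\<lambda>(i, j). W $$ (i, j))"

definition lower_rows :: "nat \<Rightarrow> real mat \<Rightarrow> real mat" where
  "lower_rows n W = mat (dim_row W - n) (dim_col W) (\<lambda>(i, j). W $$ (n + i, j))"

text \<open>
  \<open>Phi\<close> under the isometric identification of a pair \<open>(U, V)\<close>, where \<open>U\<close> has \<open>n\<close> rows, with the
  stacked matrix \<open>U @\<^sub>r V\<close>; its gradient and second derivative are those of \<open>Phi\<close> on the product
  space.
\<close>
definition Phi_stacked :: "nat \<Rightarrow> (real mat \<Rightarrow> real) \<Rightarrow> real \<Rightarrow> real mat \<Rightarrow> real" where
  "Phi_stacked n f lam W = Phi f lam (upper_rows n W) (lower_rows n W)"

definition critical_point ::
  "(real mat \<Rightarrow> real) \<Rightarrow> real \<Rightarrow> real mat \<Rightarrow> real mat \<Rightarrow> bool" where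
  "critical_point f lam U V \<longleftrightarrow>
     grad (Phi_stacked (dim_row U) f lam) (U @\<^sub>r V) = 0\<^sub>m (dim_row U + dim_row V) (dim_col U)"

definition hess_Phi_psd ::
  "(real mat \<Rightarrow> real) \<Rightarrow> real \<Rightarrow> real mat \<Rightarrow> real mat \<Rightarrow> bool" where
  "hess_Phi_psd f lam U V \<longleftrightarrow>
     (\<forall>H \<in> carrier_mat (dim_row U + dim_row V) (dim_col U).
        0 \<le> hess (Phi_stacked (dim_row U) f lam) (U @\<^sub>r V) H H)"

definition Xi :: "(real mat \<Rightarrow> real) \<Rightarrow> real \<Rightarrow> real mat \<Rightarrow> real mat" where
  "Xi f lam X =
     four_block_mat (lam \<cdot>\<^sub>m 1\<^sub>m (dim_row X)) (grad f X) ((grad f X)\<^sup>T) (lam \<cdot>\<^sub>m 1\<^sub>m (dim_col X))"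

end

theory Submission
  imports Defs "HOL-Analysis.Analysis"
begin

text \<open>
  Write \<open>X = U V\<^sup>T\<close>, \<open>E = W W\<^sup>T - W\<^sup>* W\<^sup>*\<^sup>T\<close>, and let \<open>p\<close> be the orthogonal projection onto the
  column space of \<open>W\<close>.  A critical point is balanced, \<open>U\<^sup>T U = V\<^sup>T V\<close>, and satisfies
  \<open>\<Xi>(X) W = 0\<close>; balance gives \<open>2 |X - M|\<^sup>2 \<le> |E|\<^sup>2 \<le> 4 |X - M|\<^sup>2\<close>.

  After rotating \<open>W\<^sup>*\<close> so that \<open>W\<^sup>T W\<^sup>*\<close> is symmetric positive semidefinite (polar decomposition), the
  Hessian in the direction \<open>D = W - W\<^sup>*\<close>, together with restricted smoothness at \<open>X\<close> and restricted
  strong convexity on the segment from \<open>M\<close> to \<open>X\<close>, yields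
  \<open>2 \<alpha> |X - M|\<^sup>2 \<le> \<beta> |W D\<^sup>T|\<^sup>2 - \<langle>\<Xi>(M), E\<rangle>\<close>, where \<open>|W D\<^sup>T|\<^sup>2 \<le> |E|\<^sup>2 / 8 + 7 |E p|\<^sup>2 / 2\<close>.
  Pairing \<open>\<Xi>(X) p = 0\<close> with \<open>E\<close> and using the near-isometry of the restricted Hessian bounds
  \<open>|E p|\<close> by \<open>2 \<surd>2 (\<beta> - \<alpha>) / (\<alpha> + \<beta>) |X - M|\<close> up to a multiple of \<open>\<surd>r\<^sup>* |\<Xi>(M)|\<close>.  For \<open>\<beta> / \<alpha> \<le> 1.38\<close> the
  terms in \<open>|X - M|\<^sup>2\<close> on the right can be absorbed on the left.
\<close>

text \<open>Alignment controls the difference of the two factors only inside the column space of W.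
  The component b of the true factor orthogonal to that space satisfies W^T b = 0, so the polar
  factor cannot see it. Its contribution |W b^T|^2 is why both |E p| and |E| enter. The weight of
  |E|^2 must be small, since |E|^2 can reach 4 |X - M|^2: the weight 1/8 costs \<beta> |X - M|^2 / 2
  out of the available 2 \<alpha> |X - M|^2. Restricted convexity and smoothness speak only of low
  rank, which dictates the test directions. Balance gives W the rank bound k of X although W has r
  columns. The off-diagonal part of E p and X - M then both have rank at most 2 k, so their
  combinations stay within 4 k, and the line through M and X stays within 2 k. In the factor 2 sqrt
  2, sqrt 2 is the norm of passing from E p to its off-diagonal part, and 2 arises because that
  part, paired with X - M, still sees half of |E p|^2. No spectral theorem is used: projections come
  from orthogonalization, the polar factor from maximizing a trace, and ranks are compared through
  Frobenius norms of projections.\<close>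

hide_const (open) Finite_Cartesian_Product.mat Finite_Cartesian_Product.vec
hide_type (open) Finite_Cartesian_Product.vec

section \<open>Finitely supported matrices\<close>

text \<open>
  All matrix formats live in one type, a real inner product space and a non-unital normed algebra,
  so that the library's Frechet derivatives and ring normalization apply although the dimensions
  are natural numbers; the format of an element is recorded by \<open>supp\<close> below.
\<close>

typedef fmat = "{f :: nat \<Rightarrow> nat \<Rightarrow> real. \<exists>N. \<forall>i j. f i j \<noteq> 0 \<longrightarrow> i < N \<and> j < N}"
  morphisms entry Abs_fmat
  by (rule exI[of _ "\<lambda>_ _. 0"]) simp

setup_lifting type_definition_fmat

definition supp :: "nat \<Rightarrow> nat \<Rightarrow> fmat \<Rightarrow> bool" where
  "supp n m x \<longleftrightarrow> (\<forall>i j. entry x i j \<noteq> 0 \<longrightarrow> i < n \<and> j < m)"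

text \<open>A canonical square format makes inner product, product and transpose total functions;
  their values turn out to be the same sums over any format that contains the support.\<close>

definition fsize :: "fmat \<Rightarrow> nat" where
  "fsize x = (LEAST N. supp N N x)"

lemma fmat_eqI: "(\<And>i j. entry x i j = entry y i j) \<Longrightarrow> x = y"
  by (metis entry_inject ext)

lemma supp_fsize: "supp (fsize x) (fsize x) x"
proof -
  have "\<exists>N. supp N N x" using entry[of x] by (auto simp: supp_def)
  then show ?thesis unfolding fsize_def by (rule LeastI_ex)
qed

lemma supp_mono: "supp n m x \<Longrightarrow> n \<le> n' \<Longrightarrow> m \<le> m' \<Longrightarrow> supp n' m' x"
  by (fastforce simp: supp_def)

lemma suppD: "supp n m x \<Longrightarrow> \<not> (i < n \<and> j < m) \<Longrightarrow> entry x i j = 0"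
  by (auto simp: supp_def)

lemma supp_common3: "\<exists>N. supp N N x \<and> supp N N y \<and> supp N N z"
  by (rule exI[of _ "max (fsize x) (max (fsize y) (fsize z))"]) (auto intro!: supp_mono[OF supp_fsize])

definition fmat_of :: "nat \<Rightarrow> nat \<Rightarrow> (nat \<Rightarrow> nat \<Rightarrow> real) \<Rightarrow> fmat" where
  "fmat_of n m f = Abs_fmat (\<lambda>i j. if i < n \<and> j < m then f i j else 0)"

lemma entry_fmat_of: "entry (fmat_of n m f) i j = (if i < n \<and> j < m then f i j else 0)"
  unfolding fmat_of_def
  by (subst Abs_fmat_inverse) (auto intro!: exI[of _ "max n m"])

lemma supp_fmat_of: "supp n m (fmat_of n m f)"
  by (auto simp: supp_def entry_fmat_of split: if_splits)

instantiation fmat :: real_vector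
begin

lift_definition zero_fmat :: fmat is "\<lambda>_ _. 0" by simp
lift_definition plus_fmat :: "fmat \<Rightarrow> fmat \<Rightarrow> fmat" is "\<lambda>f g i j. f i j + g i j"
proof -
  fix f g :: "nat \<Rightarrow> nat \<Rightarrow> real"
  assume "\<exists>N. \<forall>i j. f i j \<noteq> 0 \<longrightarrow> i < N \<and> j < N" "\<exists>N. \<forall>i j. g i j \<noteq> 0 \<longrightarrow> i < N \<and> j < N"
  then obtain M N where "\<forall>i j. f i j \<noteq> 0 \<longrightarrow> i < M \<and> j < M" "\<forall>i j. g i j \<noteq> 0 \<longrightarrow> i < N \<and> j < N"
    by auto
  then show "\<exists>N. \<forall>i j. f i j + g i j \<noteq> 0 \<longrightarrow> i < N \<and> j < N"
    by (intro exI[of _ "max M N"]) (metis add.right_neutral less_max_iff_disj)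
qed
lift_definition uminus_fmat :: "fmat \<Rightarrow> fmat" is "\<lambda>f i j. - f i j" by simp
lift_definition minus_fmat :: "fmat \<Rightarrow> fmat \<Rightarrow> fmat" is "\<lambda>f g i j. f i j - g i j"
proof -
  fix f g :: "nat \<Rightarrow> nat \<Rightarrow> real"
  assume "\<exists>N. \<forall>i j. f i j \<noteq> 0 \<longrightarrow> i < N \<and> j < N" "\<exists>N. \<forall>i j. g i j \<noteq> 0 \<longrightarrow> i < N \<and> j < N"
  then obtain M N where "\<forall>i j. f i j \<noteq> 0 \<longrightarrow> i < M \<and> j < M" "\<forall>i j. g i j \<noteq> 0 \<longrightarrow> i < N \<and> j < N"
    by auto
  then show "\<exists>N. \<forall>i j. f i j - g i j \<noteq> 0 \<longrightarrow> i < N \<and> j < N"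
    by (intro exI[of _ "max M N"]) (metis diff_zero less_max_iff_disj)
qed
lift_definition scaleR_fmat :: "real \<Rightarrow> fmat \<Rightarrow> fmat" is "\<lambda>c f i j. c * f i j" by auto

instance
  by standard (transfer; auto simp: algebra_simps fun_eq_iff)+

end

lemma entry_simps [simp]:
  "entry 0 i j = 0"
  "entry (x + y) i j = entry x i j + entry y i j"
  "entry (x - y) i j = entry x i j - entry y i j"
  "entry (- x) i j = - entry x i j"
  "entry (c *\<^sub>R x) i j = c * entry x i j"
  by (transfer; simp)+

lemma entry_sum [simp]: "entry (\<Sum>a\<in>A. x a) i j = (\<Sum>a\<in>A. entry (x a) i j)"
  by (induction A rule: infinite_finite_induct) auto

lemma supp_iff: "supp n m x \<longleftrightarrow> (\<forall>i j. n \<le> i \<or> m \<le> j \<longrightarrow> entry x i j = 0)"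
  by (auto simp: supp_def not_less) (meson not_le)+

lemma supp_zero [simp]: "supp n m 0"
  by (simp add: supp_iff)

lemma supp_add: "supp n m x \<Longrightarrow> supp n m y \<Longrightarrow> supp n m (x + y)"
  by (simp add: supp_iff)

lemma supp_diff: "supp n m x \<Longrightarrow> supp n m y \<Longrightarrow> supp n m (x - y)"
  by (simp add: supp_iff)

lemma supp_uminus: "supp n m x \<Longrightarrow> supp n m (- x)"
  by (simp add: supp_iff)

lemma supp_scaleR: "supp n m x \<Longrightarrow> supp n m (c *\<^sub>R x)"
  by (simp add: supp_iff)

instantiation fmat :: real_inner
begin

definition "inner_fmat x y = (\<Sum>i<fsize x. \<Sum>j<fsize x. entry x i j * entry y i j)"
definition "norm_fmat (x :: fmat) = sqrt (inner x x)"
definition "dist_fmat (x :: fmat) y = norm (x - y)"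
definition "sgn_fmat (x :: fmat) = x /\<^sub>R norm x"
definition "(uniformity :: (fmat \<times> fmat) filter) = (INF e\<in>{0 <..}. principal {(x, y). dist x y < e})"
definition "open_fmat (U :: fmat set) \<longleftrightarrow>
  (\<forall>x\<in>U. eventually (\<lambda>(x', y). x' = x \<longrightarrow> y \<in> U) uniformity)"

text \<open>Every format of \<open>x\<close> gives the sum over the nonzero entries of
  \<open>x\<close>; nothing is asked of \<open>y\<close>.\<close>

lemma inner_fmat_supp:
  assumes "supp n m x"
  shows "inner x y = (\<Sum>i<n. \<Sum>j<m. entry x i j * entry y i j)"
proof -
  let ?f = "\<lambda>i j. entry x i j * entry y i j"
  have *: "(\<Sum>i<n'. \<Sum>j<m'. ?f i j) = (\<Sum>p | entry x (fst p) (snd p) \<noteq> 0. ?f (fst p) (snd p))"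
    if "supp n' m' x" for n' m'
  proof -
    have "(\<Sum>i<n'. \<Sum>j<m'. ?f i j) = (\<Sum>p\<in>{..<n'} \<times> {..<m'}. ?f (fst p) (snd p))"
      by (simp add: sum.cartesian_product case_prod_beta)
    also have "\<dots> = (\<Sum>p | entry x (fst p) (snd p) \<noteq> 0. ?f (fst p) (snd p))"
      using that by (intro sum.mono_neutral_right) (auto simp: supp_def)
    finally show ?thesis .
  qed
  show ?thesis unfolding inner_fmat_def *[OF assms] *[OF supp_fsize] ..
qed

instance
proof
  fix x y z :: fmat and r :: real
  show "dist x y = norm (x - y)" by (rule dist_fmat_def)
  show "sgn x = x /\<^sub>R norm x" by (rule sgn_fmat_def)
  show "(uniformity :: (fmat \<times> fmat) filter) = (INF e\<in>{0 <..}. principal {(x, y). dist x y < e})"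
    by (rule uniformity_fmat_def)
  show "open U \<longleftrightarrow> (\<forall>x\<in>U. eventually (\<lambda>(x', y). x' = x \<longrightarrow> y \<in> U) uniformity)" for U :: "fmat set"
    by (rule open_fmat_def)
  show "norm x = sqrt (inner x x)" by (rule norm_fmat_def)
  obtain N where N: "supp N N x" "supp N N y" "supp N N z" using supp_common3 by blast
  have Na: "supp N N (x + y)" "supp N N (r *\<^sub>R x)"
    using N by (simp_all add: supp_add supp_scaleR)
  show "inner x y = inner y x"
    by (simp add: inner_fmat_supp[OF N(1)] inner_fmat_supp[OF N(2)] mult.commute)
  show "inner (x + y) z = inner x z + inner y z"
    by (simp add: inner_fmat_supp[OF Na(1)] inner_fmat_supp[OF N(1)] inner_fmat_supp[OF N(2)]
        sum.distrib algebra_simps)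
  show "inner (r *\<^sub>R x) y = r * inner x y"
    by (simp add: inner_fmat_supp[OF Na(2)] inner_fmat_supp[OF N(1)] sum_distrib_left algebra_simps)
  have sq: "inner x x = (\<Sum>p\<in>{..<N} \<times> {..<N}. (entry x (fst p) (snd p))\<^sup>2)"
    by (simp add: inner_fmat_supp[OF N(1)] sum.cartesian_product case_prod_beta power2_eq_square)
  show "0 \<le> inner x x" unfolding sq by (intro sum_nonneg) auto
  show "inner x x = 0 \<longleftrightarrow> x = 0"
  proof
    assume "inner x x = 0"
    then have *: "\<forall>p\<in>{..<N} \<times> {..<N}. (entry x (fst p) (snd p))\<^sup>2 = 0"
      unfolding sq by (subst (asm) sum_nonneg_eq_0_iff) auto
    have "entry x i j = 0" for i j
    proof (cases "i < N \<and> j < N")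
      case True
      then show ?thesis using *[rule_format, of "(i, j)"] by auto
    next
      case False
      then show ?thesis using N(1) suppD by blast
    qed
    then show "x = 0" by (intro fmat_eqI) simp
  qed (simp add: inner_fmat_def)
qed

end

instantiation fmat :: real_normed_algebra
begin

definition "times_fmat x y =
  fmat_of (fsize x) (fsize y) (\<lambda>i j. \<Sum>k<fsize x. entry x i k * entry y k j)"

text \<open>Contraction indices beyond the columns of \<open>x\<close> contribute zero, so the
  format of one factor is enough to expand a product.\<close>

lemma entry_mult_right:
  assumes "supp a n x"
  shows "entry (x * y) i j = (\<Sum>k<n. entry x i k * entry y k j)"
proof -
  have *: "(\<Sum>k<n. entry x i k * entry y k j) = (\<Sum>k | entry x i k \<noteq> 0. entry x i k * entry y k j)"
    if "supp m n x" for m n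
    using that by (intro sum.mono_neutral_right) (auto simp: supp_def)
  have "entry (x * y) i j = (\<Sum>k<fsize x. entry x i k * entry y k j)"
    using suppD[OF supp_fsize[of x]] suppD[OF supp_fsize[of y]]
    by (auto simp: times_fmat_def entry_fmat_of intro!: sum.neutral[symmetric])
  also have "\<dots> = (\<Sum>k<n. entry x i k * entry y k j)"
    unfolding *[OF assms] *[OF supp_fsize] ..
  finally show ?thesis .
qed

lemma entry_mult_left:
  assumes "supp n b y"
  shows "entry (x * y) i j = (\<Sum>k<n. entry x i k * entry y k j)"
proof -
  define N where "N = max (fsize x) n"
  have "entry (x * y) i j = (\<Sum>k<N. entry x i k * entry y k j)"
    unfolding N_def by (rule entry_mult_right[of "fsize x"], rule supp_mono[OF supp_fsize]) auto
  also have "\<dots> = (\<Sum>k<n. entry x i k * entry y k j)"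
    using assms by (intro sum.mono_neutral_right) (auto simp: N_def supp_iff)
  finally show ?thesis .
qed

instance
proof
  fix x y z :: fmat and r :: real
  obtain N where N: "supp N N x" "supp N N y" "supp N N z" using supp_common3 by blast
  have Na: "supp N N (x + y)" "supp N N (r *\<^sub>R x)" "supp N N (y + z)"
    using N by (simp_all add: supp_add supp_scaleR)
  have Nm: "supp N N (x * y)"
    using N by (auto simp: supp_iff entry_mult_right[OF N(1)])
  show "x * y * z = x * (y * z)"
  proof (rule fmat_eqI)
    fix i j
    have "entry (x * y * z) i j = (\<Sum>l<N. \<Sum>k<N. entry x i k * entry y k l * entry z l j)"
      by (simp add: entry_mult_right[OF N(1)] entry_mult_right[OF Nm] sum_distrib_right)
    also have "\<dots> = (\<Sum>k<N. \<Sum>l<N. entry x i k * entry y k l * entry z l j)"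
      by (rule sum.swap)
    also have "\<dots> = entry (x * (y * z)) i j"
      by (simp add: entry_mult_right[OF N(1)] entry_mult_right[OF N(2)] sum_distrib_left mult.assoc)
    finally show "entry (x * y * z) i j = entry (x * (y * z)) i j" .
  qed
  show "(x + y) * z = x * z + y * z"
    by (intro fmat_eqI) (simp add: entry_mult_left[OF N(3)] sum.distrib algebra_simps)
  show "x * (y + z) = x * y + x * z"
    by (intro fmat_eqI) (simp add: entry_mult_right[OF N(1)] sum.distrib algebra_simps)
  show "r *\<^sub>R x * y = r *\<^sub>R (x * y)"
    by (intro fmat_eqI) (simp add: entry_mult_left[OF N(2)] sum_distrib_left algebra_simps)
  show "x * r *\<^sub>R y = r *\<^sub>R (x * y)"
    by (intro fmat_eqI) (simp add: entry_mult_right[OF N(1)] sum_distrib_left algebra_simps)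
  show "norm (x * y) \<le> norm x * norm y"
  proof -
    have "inner (x * y) (x * y) = (\<Sum>i<N. \<Sum>j<N. (\<Sum>k<N. entry x i k * entry y k j)\<^sup>2)"
      by (simp add: inner_fmat_supp[OF Nm] power2_eq_square entry_mult_right[OF N(1)])
    also have "\<dots> \<le> (\<Sum>i<N. \<Sum>j<N. (\<Sum>k<N. (entry x i k)\<^sup>2) * (\<Sum>k<N. (entry y k j)\<^sup>2))"
      by (intro sum_mono Cauchy_Schwarz_ineq_sum)
    also have "\<dots> = (\<Sum>i<N. (\<Sum>k<N. (entry x i k)\<^sup>2) * (\<Sum>j<N. \<Sum>k<N. (entry y k j)\<^sup>2))"
      by (simp add: sum_distrib_left)
    also have "(\<Sum>j<N. \<Sum>k<N. (entry y k j)\<^sup>2) = inner y y"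
      by (subst sum.swap) (simp add: inner_fmat_supp[OF N(2)] power2_eq_square)
    also have "(\<Sum>i<N. (\<Sum>k<N. (entry x i k)\<^sup>2) * inner y y) = inner x x * inner y y"
      by (simp add: inner_fmat_supp[OF N(1)] power2_eq_square sum_distrib_right)
    finally show ?thesis
      by (simp add: norm_fmat_def flip: real_sqrt_mult)
  qed
qed

end

lemma supp_mult: "supp n k x \<Longrightarrow> supp l m y \<Longrightarrow> supp n m (x * y)"
  by (auto simp: entry_mult_right supp_iff)

definition ftrans :: "fmat \<Rightarrow> fmat" where
  "ftrans x = fmat_of (fsize x) (fsize x) (\<lambda>i j. entry x j i)"

lemma entry_ftrans [simp]: "entry (ftrans x) i j = entry x j i"
  using suppD[OF supp_fsize[of x]] by (auto simp: ftrans_def entry_fmat_of)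

lemma supp_ftrans: "supp n m x \<Longrightarrow> supp m n (ftrans x)"
  by (auto simp: supp_def)

lemma ftrans_simps [simp]:
  "ftrans (ftrans x) = x"
  "ftrans 0 = 0"
  "ftrans (x + y) = ftrans x + ftrans y"
  "ftrans (x - y) = ftrans x - ftrans y"
  "ftrans (- x) = - ftrans x"
  "ftrans (c *\<^sub>R x) = c *\<^sub>R ftrans x"
  by (auto intro!: fmat_eqI)

lemma ftrans_mult [simp]: "ftrans (x * y) = ftrans y * ftrans x"
proof (rule fmat_eqI)
  fix i j
  show "entry (ftrans (x * y)) i j = entry (ftrans y * ftrans x) i j"
    by (simp add: entry_mult_right[OF supp_fsize[of x]] mult.commute
        entry_mult_left[OF supp_ftrans[OF supp_fsize[of x]]])
qed

lemma inner_ftrans: "inner (ftrans x) (ftrans y) = inner x y"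
  by (subst inner_fmat_supp[OF supp_ftrans[OF supp_fsize]], subst sum.swap) (simp add: inner_fmat_def)

lemma inner_ftrans_left: "inner (ftrans x) y = inner x (ftrans y)"
  using inner_ftrans[of x "ftrans y"] by simp

lemma norm_ftrans [simp]: "norm (ftrans x) = norm x"
  by (simp add: norm_fmat_def inner_ftrans)

lemma inner_mult_left: "inner (x * y) z = inner y (ftrans x * z)"
proof -
  obtain N where N: "supp N N x" "supp N N y" "supp N N z" using supp_common3 by blast
  have "inner (x * y) z = (\<Sum>i<N. \<Sum>j<N. \<Sum>k<N. entry x i k * entry y k j * entry z i j)"
    by (simp add: inner_fmat_supp[OF supp_mult[OF N(1,2)]] entry_mult_right[OF N(1)] sum_distrib_right)
  also have "\<dots> = (\<Sum>i<N. \<Sum>k<N. \<Sum>j<N. entry x i k * entry y k j * entry z i j)"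
    by (rule sum.cong[OF refl], rule sum.swap)
  also have "\<dots> = (\<Sum>k<N. \<Sum>i<N. \<Sum>j<N. entry x i k * entry y k j * entry z i j)"
    by (rule sum.swap)
  also have "\<dots> = (\<Sum>k<N. \<Sum>j<N. \<Sum>i<N. entry x i k * entry y k j * entry z i j)"
    by (rule sum.cong[OF refl], rule sum.swap)
  also have "\<dots> = inner y (ftrans x * z)"
    by (simp add: inner_fmat_supp[OF N(2)] entry_mult_left[OF N(3)] sum_distrib_left algebra_simps)
  finally show ?thesis .
qed

lemma inner_mult_right: "inner (x * y) z = inner x (z * ftrans y)"
proof -
  have "inner (x * y) z = inner (ftrans y * ftrans x) (ftrans z)"
    using inner_ftrans[of "x * y" z] by simp
  also have "\<dots> = inner (ftrans x) (y * ftrans z)" by (simp add: inner_mult_left)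
  also have "\<dots> = inner x (z * ftrans y)" by (simp add: inner_ftrans_left)
  finally show ?thesis .
qed

text \<open>An infinite identity has no finite support. These idempotents act as identities on
  elements of bounded format and truncate all others.\<close>

definition fid :: "nat \<Rightarrow> fmat" where
  "fid n = fmat_of n n (\<lambda>i j. if i = j then 1 else 0)"

lemma entry_fid: "entry (fid n) i j = (if i = j \<and> i < n then 1 else 0)"
  by (auto simp: fid_def entry_fmat_of)

lemma supp_fid [simp]: "supp n n (fid n)"
  by (simp add: fid_def supp_fmat_of)

lemma ftrans_fid [simp]: "ftrans (fid n) = fid n"
  by (auto intro!: fmat_eqI simp: entry_fid)

lemma entry_fid_mult: "entry (fid n * x) i j = (if i < n then entry x i j else 0)"
proof -
  have "entry (fid n * x) i j = (\<Sum>k<n. if k = i then entry x i j else 0)"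
    unfolding entry_mult_right[OF supp_fid] by (intro sum.cong) (auto simp: entry_fid)
  then show ?thesis by simp
qed

lemma entry_mult_fid: "entry (x * fid n) i j = (if j < n then entry x i j else 0)"
proof -
  have "entry (x * fid n) i j = (\<Sum>k<n. if k = j then entry x i j else 0)"
    unfolding entry_mult_left[OF supp_fid] by (intro sum.cong) (auto simp: entry_fid)
  then show ?thesis by simp
qed

lemma fid_mult: "supp n m x \<Longrightarrow> fid n * x = x"
  by (intro fmat_eqI) (auto simp: entry_fid_mult dest: suppD)

lemma mult_fid: "supp n m x \<Longrightarrow> x * fid m = x"
  by (intro fmat_eqI) (auto simp: entry_mult_fid dest: suppD)

lemma fid_fid [simp]: "fid n * fid n = fid n"
  by (rule fid_mult[OF supp_fid])

lemma mult_ftrans_eq_0: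
  assumes "x * ftrans x = 0"
  shows "x = 0"
proof -
  have "inner x x = inner (fid (fsize x) * x) x"
    by (simp add: fid_mult[OF supp_fsize])
  also have "\<dots> = 0"
    by (simp add: inner_mult_right assms)
  finally show ?thesis by simp
qed

text \<open>Turns a format into an equation, which can be used for rewriting.\<close>

lemma fid_eq_supp: "fid n * x * fid m = x \<longleftrightarrow> supp n m x"
proof
  assume *: "fid n * x * fid m = x"
  show "supp n m x"
    by (subst *[symmetric], rule supp_mult[OF supp_mult[OF supp_fid supp_fsize] supp_fid])
qed (simp add: fid_mult mult_fid)

text \<open>Left multiplication by \<open>fshift k n\<close> moves the first \<open>n\<close> rows down by \<open>k\<close>.\<close>
definition fshift :: "nat \<Rightarrow> nat \<Rightarrow> fmat" where
  "fshift k n = fmat_of (k + n) n (\<lambda>i j. if i = k + j then 1 else 0)"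

lemma entry_fshift: "entry (fshift k n) i j = (if i = k + j \<and> j < n then 1 else 0)"
  by (auto simp: fshift_def entry_fmat_of)

lemma supp_fshift: "supp (k + n) n (fshift k n)"
  by (simp add: fshift_def supp_fmat_of)

lemma entry_fshift_mult:
  "entry (fshift k n * x) i j = (if k \<le> i \<and> i < k + n then entry x (i - k) j else 0)"
proof -
  have "entry (fshift k n * x) i j = (\<Sum>l<n. if l = i - k then (if k \<le> i then entry x l j else 0) else 0)"
    unfolding entry_mult_right[OF supp_fshift] by (intro sum.cong) (auto simp: entry_fshift)
  then show ?thesis by auto
qed

lemma entry_ftrans_fshift_mult:
  "entry (ftrans (fshift k n) * x) i j = (if i < n then entry x (k + i) j else 0)"
proof -
  have "entry (ftrans (fshift k n) * x) i j =
      (\<Sum>l<k + n. if l = k + i then (if i < n then entry x l j else 0) else 0)"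
    unfolding entry_mult_right[OF supp_ftrans[OF supp_fshift]] by (intro sum.cong) (auto simp: entry_fshift)
  then show ?thesis by auto
qed

text \<open>The relations between the embeddings of two complementary coordinate blocks: each is
  isometric, their ranges are orthogonal, and the two range projections add up to the
  identity.\<close>

lemma fshift_orth:
  "ftrans (fshift k n) * fshift k n = fid n"
  "fid k * fshift k n = 0"
  "ftrans (fshift k n) * fid k = 0"
  "fid k + fshift k n * ftrans (fshift k n) = fid (k + n)"
proof -
  show "ftrans (fshift k n) * fshift k n = fid n"
    by (rule fmat_eqI) (simp add: entry_ftrans_fshift_mult entry_fshift entry_fid)
  show "fid k * fshift k n = 0"
    by (rule fmat_eqI) (simp add: entry_fid_mult entry_fshift)
  show "ftrans (fshift k n) * fid k = 0"
    by (rule fmat_eqI) (simp add: entry_ftrans_fshift_mult entry_fid)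
  show "fid k + fshift k n * ftrans (fshift k n) = fid (k + n)"
    by (rule fmat_eqI) (auto simp add: entry_fshift_mult entry_fshift entry_fid)
qed

section \<open>Projections and rank\<close>

text \<open>The hypotheses leave only column \<open>k\<close> nonzero, and
  \<open>fid (Suc k) - fid k\<close> is the matrix unit at position \<open>(k, k)\<close>.\<close>

lemma ftrans_mult_self_single_column:
  assumes u: "supp n (Suc k) u" "u * fid k = 0"
  shows "ftrans u * u = inner u u *\<^sub>R (fid (Suc k) - fid k)"
proof (rule fmat_eqI)
  fix i j
  have z: "entry u l c = 0" if "c \<noteq> k" for l c
    using u(1) arg_cong[OF u(2), of "\<lambda>x. entry x l c"] that
    by (cases "c < k") (auto simp: entry_mult_fid supp_iff)
  have "inner u u = (\<Sum>l<n. (entry u l k)\<^sup>2)"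
    by (simp add: inner_fmat_supp[OF u(1)] z power2_eq_square)
  then show "entry (ftrans u * u) i j = entry (inner u u *\<^sub>R (fid (Suc k) - fid k)) i j"
    by (cases "i = k"; cases "j = k")
      (auto simp: entry_mult_left[OF u(1)] entry_fid z power2_eq_square)
qed

text \<open>Gram-Schmidt, one column at a time: the residual \<open>u\<close> of the new column
  either vanishes or adds the rank-one projection \<open>u * ftrans u\<close> divided by
  \<open>inner u u\<close>, which raises the squared norm by exactly 1. The witness \<open>y\<close>
  records that the range of \<open>p\<close> lies in that of \<open>a\<close>.\<close>

lemma projection_exists:
  assumes "supp n k a"
  shows "\<exists>p y. ftrans p = p \<and> p * p = p \<and> p * a = a \<and> p = a * y \<and> (norm p)\<^sup>2 \<le> real k"
  using assms
proof (induction k arbitrary: a)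
  case 0
  then have "a = 0" by (intro fmat_eqI) (simp add: supp_iff)
  then show ?case by (intro exI[of _ 0]) simp
next
  case (Suc k)
  define e where "e = fid (Suc k) - fid k"
  define b where "b = a * fid k"
  define c where "c = a * e"
  have aS: "a * fid (Suc k) = a" using Suc.prems by (rule mult_fid)
  have a: "a = b + c" using aS by (simp add: b_def c_def e_def algebra_simps)
  have ek: "e * fid k = 0"
    by (intro fmat_eqI) (auto simp: e_def entry_mult_fid entry_fid)
  have ee: "e * e = e"
    by (intro fmat_eqI) (auto simp: e_def entry_mult_fid entry_fid algebra_simps)
  have "supp n k b" unfolding b_def by (rule supp_mult[OF Suc.prems supp_fid])
  from Suc.IH[OF this] obtain p y where p: "ftrans p = p" "p * p = p" "p * b = b" "p = b * y"
    "(norm p)\<^sup>2 \<le> real k" by blast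
  define u where "u = c - p * c"
  have pu: "p * u = 0" using p(2) by (simp add: u_def algebra_simps flip: mult.assoc)
  have up: "ftrans u * p = 0" using arg_cong[OF pu, of ftrans] p(1) by simp
  have ub: "ftrans u * b = 0" using up p(3) by (metis mult.assoc mult_zero_left)
  have py: "p = a * (fid k * y)" using p(4) by (simp add: b_def mult.assoc)
  show ?case
  proof (cases "u = 0")
    case True
    then have "p * a = a" using p(3) by (simp add: a u_def algebra_simps)
    then show ?thesis using p py by (intro exI[of _ p] exI[of _ "fid k * y"]) simp
  next
    case False
    define t where "t = inner u u"
    have t: "t > 0" using False by (simp add: t_def)
    have "supp (Suc k) (Suc k) e"
      unfolding e_def by (intro supp_diff[OF supp_fid supp_mono[OF supp_fid[of k]]]) auto
    then have suppc: "supp n (Suc k) c" unfolding c_def by (rule supp_mult[OF Suc.prems])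
    have "supp n (Suc k) u"
    proof -
      have "supp n (Suc k) (p * c)"
        unfolding p(4) mult.assoc
        by (rule supp_mult[OF \<open>supp n k b\<close> supp_mult[OF supp_fsize suppc]])
      then show ?thesis unfolding u_def by (rule supp_diff[OF suppc])
    qed
    moreover have "c * fid k = 0" by (simp add: c_def mult.assoc ek)
    ultimately have uu: "ftrans u * u = t *\<^sub>R e"
      unfolding t_def e_def by (intro ftrans_mult_self_single_column) (auto simp: u_def algebra_simps)
    have ue: "u * e = u" by (simp add: u_def c_def algebra_simps ee)
    have uuu: "u * ftrans u * u = t *\<^sub>R u" by (simp add: mult.assoc uu ue)
    have uc: "ftrans u * c = ftrans u * u"
      using up by (simp add: u_def algebra_simps flip: mult.assoc)
    define p' where "p' = p + (1 / t) *\<^sub>R (u * ftrans u)"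
    have "ftrans p' = p'" using p(1) by (simp add: p'_def)
    moreover have "p' * p' = p'"
    proof -
      have "p' * p' = p * p + (1 / t) *\<^sub>R (p * u * ftrans u) + (1 / t) *\<^sub>R (u * (ftrans u * p))
        + (1 / t * (1 / t)) *\<^sub>R (u * ftrans u * u * ftrans u)"
        unfolding p'_def by (simp add: algebra_simps)
      then show ?thesis using t p(2) unfolding pu up uuu by (simp add: p'_def)
    qed
    moreover have "p' * a = a"
    proof -
      have "p' * a = p * b + p * c + (1 / t) *\<^sub>R (u * (ftrans u * b)) + (1 / t) *\<^sub>R (u * (ftrans u * c))"
        unfolding p'_def a by (simp add: algebra_simps)
      also have "\<dots> = b + p * c + (1 / t) *\<^sub>R (u * ftrans u * u)"
        unfolding ub uc p(3) by (simp add: mult.assoc)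
      also have "\<dots> = a" using t unfolding uuu by (simp add: u_def a)
      finally show ?thesis .
    qed
    \<comment> \<open>The residual is itself \<open>a\<close> times something, since
      \<open>c = a * e\<close> and \<open>p\<close> factors through \<open>a\<close>.\<close>
    moreover have "p' = a * (fid k * y + (1 / t) *\<^sub>R ((e - fid k * y * c) * ftrans u))"
    proof -
      have "u = a * (e - fid k * y * c)"
        unfolding u_def by (subst py) (simp add: c_def algebra_simps)
      then have "u * ftrans u = a * ((e - fid k * y * c) * ftrans u)"
        by (metis mult.assoc)
      then show ?thesis unfolding p'_def
        by (subst py) (simp only: distrib_left mult_scaleR_right)
    qed
    moreover have "(norm p')\<^sup>2 \<le> real (Suc k)"
    proof -
      have "inner (u * ftrans u) p = 0"
        by (simp add: inner_mult_right pu)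
      moreover have "inner (u * ftrans u) (u * ftrans u) = t * t"
        by (subst inner_mult_right) (simp add: uuu t_def)
      ultimately have "(norm p')\<^sup>2 = (norm p)\<^sup>2 + 1"
        using t by (simp add: p'_def power2_norm_eq_inner inner_add_left inner_add_right inner_commute)
      then show ?thesis using p(5) by simp
    qed
    ultimately show ?thesis by blast
  qed
qed

text \<open>Rank at most \<open>k\<close> as a factorization through \<open>k\<close> columns:
  stability under products, transposes and sums is then algebra, without dimensions of
  subspaces.\<close>

definition rk :: "nat \<Rightarrow> fmat \<Rightarrow> bool" where
  "rk k x \<longleftrightarrow> (\<exists>a b n. supp n k a \<and> x = a * b)"

lemma rkI: "supp n k a \<Longrightarrow> rk k (a * b)"
  unfolding rk_def by (intro exI conjI) (assumption, rule refl)

lemma rk_supp: "supp n k x \<Longrightarrow> rk k x"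
  using rkI[of n k x "fid k"] by (simp add: mult_fid)

lemma rk_mult_right:
  assumes "rk k x"
  shows "rk k (x * y)"
proof -
  from assms obtain a b n where "supp n k a" "x = a * b" by (auto simp: rk_def)
  then show ?thesis using rkI[of n k a "b * y"] by (simp add: mult.assoc)
qed

lemma rk_mult_left:
  assumes "rk k x"
  shows "rk k (y * x)"
proof -
  from assms obtain a b n where "supp n k a" "x = a * b" by (auto simp: rk_def)
  then show ?thesis
    using rkI[OF supp_mult[OF supp_fsize[of y]], of n k a b] by (simp add: mult.assoc)
qed

lemma rk_ftrans:
  assumes "rk k x"
  shows "rk k (ftrans x)"
proof -
  from assms obtain a b n where "supp n k a" "x = a * b" by (auto simp: rk_def)
  then have "ftrans x = ftrans (fid k * b) * ftrans a"
    by (simp flip: ftrans_mult add: mult_fid mult.assoc flip: mult.assoc)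
  moreover have "supp (fsize b) k (ftrans (fid k * b))"
    by (rule supp_ftrans[OF supp_mult[OF supp_fid supp_fsize]])
  ultimately show ?thesis using rkI by simp
qed

lemma rk_scaleR:
  assumes "rk k x"
  shows "rk k (c *\<^sub>R x)"
proof -
  from assms obtain a b n where "supp n k a" "x = a * b" by (auto simp: rk_def)
  then show ?thesis using rkI[of n k a "c *\<^sub>R b"] by simp
qed

lemma rk_uminus: "rk k x \<Longrightarrow> rk k (- x)"
  using rk_scaleR[of k x "-1"] by simp

text \<open>The left factors are put side by side and the right factors on top of each other;
  \<open>fshift k l\<close> makes the room.\<close>

lemma rk_add:
  assumes "rk k x" "rk l y"
  shows "rk (k + l) (x + y)"
proof -
  from assms obtain a b n c d m where a: "supp n k a" "x = a * b" and c: "supp m l c" "y = c * d"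
    by (auto simp: rk_def)
  define J where "J = fshift k l"
  have J: "ftrans J * J = fid l" "fid k * J = 0" "ftrans J * fid k = 0"
    unfolding J_def by (rule fshift_orth)+
  have ak: "a * fid k = a" and cl: "c * fid l = c"
    using a c mult_fid by blast+
  have aJ: "a * J = 0" using J(2) ak by (metis mult.assoc mult_zero_right)
  have "(a + c * ftrans J) * (fid k * b + J * d) =
      a * fid k * b + (a * J) * d + c * (ftrans J * fid k) * b + c * (ftrans J * J) * d"
    by (simp add: algebra_simps)
  then have "x + y = (a + c * ftrans J) * (fid k * b + J * d)"
    unfolding aJ J ak cl a(2) c(2) by simp
  moreover have "supp (max n m) (k + l) (a + c * ftrans J)"
  proof (rule supp_add)
    show "supp (max n m) (k + l) a" by (rule supp_mono[OF a(1)]) auto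
    have "supp m (k + l) (c * ftrans J)"
      unfolding J_def by (rule supp_mult[OF c(1) supp_ftrans[OF supp_fshift]])
    then show "supp (max n m) (k + l) (c * ftrans J)" by (rule supp_mono) auto
  qed
  ultimately show ?thesis using rkI by simp
qed

lemma rk_diff: "rk k x \<Longrightarrow> rk l y \<Longrightarrow> rk (k + l) (x - y)"
  using rk_add[of k x l "- y"] rk_uminus by simp

lemma rk_mono:
  assumes "rk k x" "k \<le> l"
  shows "rk l x"
proof -
  from assms obtain a b n where a: "supp n k a" "x = a * b" by (auto simp: rk_def)
  have "supp n l a" using supp_mono[OF a(1)] assms(2) by blast
  then show ?thesis unfolding a(2) by (rule rkI)
qed

lemma rk_projection:
  assumes "rk k x"
  shows "\<exists>p. ftrans p = p \<and> p * p = p \<and> p * x = x \<and> rk k p \<and> (norm p)\<^sup>2 \<le> real k"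
proof -
  from assms obtain a b n where a: "supp n k a" "x = a * b" by (auto simp: rk_def)
  from projection_exists[OF a(1)] obtain p y where
    "ftrans p = p" "p * p = p" "p * a = a" "p = a * y" "(norm p)\<^sup>2 \<le> real k" by blast
  then show ?thesis using rkI[OF a(1), of y] a(2) by (intro exI[of _ p]) (simp flip: mult.assoc)
qed

text \<open>Rank-restricted trace duality; the projection replaces the nuclear norm.\<close>
lemma inner_rk_bound:
  assumes x: "rk k x" and \<xi>: "ftrans \<xi> = \<xi>" "\<And>y. norm (\<xi> * y) \<le> s * norm y"
  shows "\<bar>inner \<xi> x\<bar> \<le> s * sqrt (real k) * norm x"
proof -
  from rk_projection[OF x] obtain p where
    p: "ftrans p = p" "p * p = p" "p * x = x" "rk k p" "(norm p)\<^sup>2 \<le> real k"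
    by (elim exE conjE)
  have *: "inner \<xi> x = inner (p * \<xi>) x"
    using p(1,3) by (simp add: inner_mult_left)
  show ?thesis
  proof (cases "x = 0")
    case False
    have "0 \<le> s * norm x" by (rule order_trans[OF norm_ge_zero \<xi>(2)])
    then have s: "0 \<le> s" using False by (simp add: zero_le_mult_iff)
    have "norm (p * \<xi>) = norm (\<xi> * p)"
      using norm_ftrans[of "p * \<xi>"] p(1) \<xi>(1) by simp
    also have "\<dots> \<le> s * norm p" by (rule \<xi>(2))
    also have "\<dots> \<le> s * sqrt (real k)"
      by (intro mult_left_mono s real_le_rsqrt p(5))
    finally have "norm (p * \<xi>) * norm x \<le> s * sqrt (real k) * norm x"
      by (rule mult_right_mono) simp
    then show ?thesis
      unfolding * using Cauchy_Schwarz_ineq2[of "p * \<xi>" x] by linarith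
  qed simp
qed

section \<open>Alignment of factors\<close>

text \<open>Cyclicity of the trace: inner products of outer products become inner products of Gram
  matrices.\<close>

lemma inner_gram: "inner (x * ftrans y) (z * ftrans u) = inner (ftrans z * x) (ftrans u * y)"
  by (metis ftrans_mult ftrans_simps(1) inner_mult_left inner_mult_right inner_ftrans mult.assoc)

lemma norm_gram: "norm (x * ftrans x) = norm (ftrans x * x)"
  using inner_gram[of x x x x] by (simp add: norm_eq_sqrt_inner)

lemma norm_mult_ftrans_sq: "(norm (x * ftrans y))\<^sup>2 = inner (ftrans x * x) (ftrans y * y)"
  by (simp add: power2_norm_eq_inner inner_gram)

text \<open>Since \<open>w * ftrans w\<close> and \<open>ftrans w * w\<close> have the same norm,
  only the cross terms differ. By symmetry of \<open>ftrans w * a\<close> the cross term on the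
  right is the inner product of \<open>w * ftrans a\<close> with its transpose, at most the squared
  norm of \<open>w * ftrans a\<close>, which is the cross term on the left.\<close>

lemma gram_diff_le:
  assumes "ftrans w * a = ftrans a * w"
  shows "norm (ftrans w * w - ftrans a * a) \<le> norm (w * ftrans w - a * ftrans a)"
proof -
  have wa: "inner (ftrans w * w) (ftrans a * a) = (norm (w * ftrans a))\<^sup>2"
    by (simp add: norm_mult_ftrans_sq)
  have "inner (w * ftrans w) (a * ftrans a) = inner (ftrans a * w) (ftrans w * a)"
    by (subst inner_gram) (simp add: assms)
  also have "\<dots> = inner (w * ftrans a) (a * ftrans w)"
    by (metis assms inner_gram inner_mult_left inner_mult_right mult.assoc ftrans_simps(1))
  also have "\<dots> \<le> norm (w * ftrans a) * norm (a * ftrans w)"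
    by (rule norm_cauchy_schwarz)
  also have "norm (a * ftrans w) = norm (w * ftrans a)"
    using norm_ftrans[of "a * ftrans w"] by simp
  finally have "inner (w * ftrans w) (a * ftrans a) \<le> (norm (w * ftrans a))\<^sup>2"
    by (simp add: power2_eq_square)
  moreover have "(norm (w * ftrans w - a * ftrans a))\<^sup>2 =
      (norm (w * ftrans w))\<^sup>2 + (norm (a * ftrans a))\<^sup>2 - 2 * inner (w * ftrans w) (a * ftrans a)"
    "(norm (ftrans w * w - ftrans a * a))\<^sup>2 =
      (norm (ftrans w * w))\<^sup>2 + (norm (ftrans a * a))\<^sup>2 - 2 * inner (ftrans w * w) (ftrans a * a)"
    by (simp_all add: power2_norm_eq_inner inner_diff_left inner_diff_right inner_commute)
  ultimately have "(norm (ftrans w * w - ftrans a * a))\<^sup>2 \<le> (norm (w * ftrans w - a * ftrans a))\<^sup>2"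
    using wa norm_gram[of w] norm_gram[of a] by simp
  then show ?thesis by (rule power2_le_imp_le) simp
qed

text \<open>Everything is expressed through \<open>K\<close>, \<open>S\<close> and \<open>Y\<close>.
  The right side minus the left side is 2 <K, Y> plus a quadratic form in \<open>S\<close> and
  \<open>Y\<close>; the first is nonnegative because \<open>K\<close> is positive semidefinite and
  \<open>Y\<close> is a Gram matrix, the second by completing a square.\<close>

lemma aligned_diff_bound:
  assumes sym: "ftrans w * a = ftrans a * w"
    and psd: "\<And>z. 0 \<le> inner z (ftrans w * a * z)"
  shows "(norm (w * ftrans (w - a)))\<^sup>2 \<le> 3 / 2 * (norm (w * ftrans w - a * ftrans a))\<^sup>2"
proof -
  define d where "d = w - a"
  define S where "S = ftrans w * d"
  define Y where "Y = ftrans d * d"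
  define K where "K = ftrans w * a"
  have S_sym: "ftrans d * w = S" using sym by (simp add: S_def d_def algebra_simps)
  have wK: "ftrans w * w = K + S" by (simp add: K_def S_def d_def algebra_simps)
  have F: "w * ftrans w - a * ftrans a = w * ftrans d + d * ftrans w - d * ftrans d"
    by (simp add: d_def algebra_simps)
  have k: "0 \<le> inner K Y"
  proof -
    have "inner K Y = inner (K * ftrans d) (ftrans d)"
      unfolding Y_def by (simp add: inner_mult_right)
    also have "\<dots> = inner (ftrans d) (K * ftrans d)" by (rule inner_commute)
    finally show ?thesis using psd unfolding K_def by simp
  qed
  have e1: "inner (w * ftrans d) (w * ftrans d) = inner K Y + inner S Y"
    by (subst inner_gram) (simp add: wK Y_def inner_add_left)
  have e2: "inner (w * ftrans d) (d * ftrans w) = inner S S"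
    by (subst inner_gram) (simp add: S_sym S_def)
  have e3: "inner (w * ftrans d) (d * ftrans d) = inner S Y"
    by (subst inner_gram) (simp add: S_sym Y_def)
  have e4: "inner (d * ftrans w) (d * ftrans w) = inner K Y + inner S Y"
    using e1 inner_ftrans[of "w * ftrans d" "w * ftrans d"] by simp
  have e5: "inner (d * ftrans w) (d * ftrans d) = inner S Y"
    using e3 inner_ftrans[of "w * ftrans d" "d * ftrans d"] by simp
  have e6: "inner (d * ftrans d) (d * ftrans d) = inner Y Y"
    by (subst inner_gram) (simp add: Y_def)
  have "(norm (w * ftrans w - a * ftrans a))\<^sup>2 =
      2 * inner K Y - 2 * inner S Y + 2 * inner S S + inner Y Y"
    unfolding F power2_norm_eq_inner
    by (simp add: inner_add_left inner_add_right inner_diff_left inner_diff_right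
        e1 e2 e3 e4 e5 e6 inner_commute[of "d * ftrans w" "w * ftrans d"]
        inner_commute[of "d * ftrans d" "w * ftrans d"] inner_commute[of "d * ftrans d" "d * ftrans w"])
  moreover have "(norm (w * ftrans (w - a)))\<^sup>2 = inner K Y + inner S Y"
    unfolding power2_norm_eq_inner using e1 by (simp add: d_def)
  moreover have "4 * inner S Y \<le> 3 * inner S S + 3 / 2 * inner Y Y"
  proof -
    have "0 \<le> inner (3 *\<^sub>R S - 2 *\<^sub>R Y) (3 *\<^sub>R S - 2 *\<^sub>R Y)" by simp
    then have "12 * inner S Y \<le> 9 * inner S S + 4 * inner Y Y"
      by (simp add: inner_diff_left inner_diff_right inner_commute)
    moreover have "0 \<le> inner Y Y" by simp
    ultimately show ?thesis by linarith
  qed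
  ultimately show ?thesis using k by (simp add: algebra_simps)
qed

text \<open>Split \<open>c = a + b\<close> along \<open>p\<close>. Since
  \<open>ftrans w * b = 0\<close>, alignment passes to \<open>a\<close>, and the left side splits
  orthogonally into an aligned part, at most 3/2 |F|^2, and |w b^T|^2, at most 2 |F|^2 + |E|^2 / 8 +
  |b a^T|^2. The terms |F|^2 and |b a^T|^2 together form |E p|^2, whence 7/2 = 3/2 + 2.\<close>

lemma aligned_product_bound:
  assumes sym: "ftrans w * c = ftrans c * w"
    and psd: "\<And>z. 0 \<le> inner z (ftrans w * c * z)"
    and p: "ftrans p = p" "p * p = p" "p * w = w"
  defines "E \<equiv> w * ftrans w - c * ftrans c"
  shows "(norm (w * ftrans (w - c)))\<^sup>2 \<le> 1 / 8 * (norm E)\<^sup>2 + 7 / 2 * (norm (E * p))\<^sup>2"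
proof -
  define a where "a = p * c"
  define b where "b = c - a"
  define F where "F = w * ftrans w - a * ftrans a"
  have c: "c = a + b" by (simp add: b_def)
  have wp: "ftrans w * p = ftrans w" using arg_cong[OF p(3), of ftrans] p(1) by simp
  have wa: "ftrans w * a = ftrans w * c" using wp by (simp add: a_def flip: mult.assoc)
  have aw: "ftrans a * w = ftrans c * w" using p(1,3) by (simp add: a_def mult.assoc)
  have cp: "ftrans c * p = ftrans a" using p(1) by (simp add: a_def)
  have wb: "ftrans w * b = 0" using wa by (simp add: b_def algebra_simps)
  have bw: "ftrans b * w = 0" using arg_cong[OF wb, of ftrans] by simp
  have ab: "ftrans a * b = 0"
  proof -
    have "ftrans a * b = ftrans c * (p * c - p * p * c)"
      using p(1) by (simp add: a_def b_def algebra_simps)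
    then show ?thesis using p(2) by simp
  qed
  have ba: "ftrans b * a = 0" using arg_cong[OF ab, of ftrans] by simp
  have sym': "ftrans w * a = ftrans a * w" using sym wa aw by simp
  have psd': "0 \<le> inner z (ftrans w * a * z)" for z using psd wa by simp
  note A = aligned_diff_bound[OF sym' psd', folded F_def]
  have Ep: "E * p = F - b * ftrans a"
  proof -
    have "E * p = w * (ftrans w * p) - c * (ftrans c * p)" by (simp add: E_def algebra_simps)
    then show ?thesis unfolding wp cp by (simp add: F_def c algebra_simps)
  qed
  have bF: "ftrans b * F = 0"
    by (simp add: F_def algebra_simps bw ba flip: mult.assoc)
  have "inner (b * ftrans a) F = 0"
    by (simp add: inner_mult_left bF)
  then have B: "(norm (E * p))\<^sup>2 = (norm F)\<^sup>2 + (norm (b * ftrans a))\<^sup>2"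
    unfolding Ep power2_norm_eq_inner by (simp add: inner_diff_left inner_diff_right inner_commute)
  have "inner (w * ftrans b) (w * ftrans (w - a)) = 0"
    by (subst inner_gram) (simp add: algebra_simps wb ab)
  then have C: "(norm (w * ftrans (w - c)))\<^sup>2 = (norm (w * ftrans (w - a)))\<^sup>2 + (norm (w * ftrans b))\<^sup>2"
  proof -
    have "w * ftrans (w - c) = w * ftrans (w - a) - w * ftrans b" by (simp add: c algebra_simps)
    then show ?thesis using \<open>inner (w * ftrans b) (w * ftrans (w - a)) = 0\<close>
      unfolding power2_norm_eq_inner by (simp add: inner_diff_left inner_diff_right inner_commute)
  qed
  \<comment> \<open>On the complement of the range of \<open>p\<close> the error \<open>E\<close> is
    just the negative of \<open>b * ftrans b\<close>; pairing with it and Cauchy-Schwarz give the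
    bound.\<close>
  have D: "norm (ftrans b * b) \<le> norm E"
  proof -
    have bc: "ftrans b * c = ftrans b * b" by (simp add: c algebra_simps ba)
    have "inner (b * ftrans b) E = inner (ftrans b) (ftrans b * w * ftrans w - ftrans b * c * ftrans c)"
      by (simp add: inner_mult_left E_def algebra_simps)
    also have "\<dots> = - inner (ftrans b) (ftrans b * b * ftrans c)"
      unfolding bw bc by simp
    also have "inner (ftrans b) (ftrans b * b * ftrans c) = inner (ftrans b * b * ftrans c) (ftrans b)"
      by (rule inner_commute)
    also have "\<dots> = inner (ftrans b * b) (ftrans b * c)"
      by (simp add: inner_mult_right)
    finally have "inner (b * ftrans b) E = - (norm (ftrans b * b))\<^sup>2"
      unfolding bc by (simp add: power2_norm_eq_inner)
    then have "(norm (ftrans b * b))\<^sup>2 \<le> norm (ftrans b * b) * norm E"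
      using Cauchy_Schwarz_ineq2[of "b * ftrans b" E] norm_gram[of b] by simp
    then show ?thesis
      by (cases "norm (ftrans b * b) = 0") (auto simp: power2_eq_square)
  qed
  \<comment> \<open>Subtracting and adding \<open>ftrans a * a\<close> exposes a difference of Gram
    matrices, which alignment bounds by \<open>F\<close>. The weights 2 and 1/8 in Young's
    inequality keep the coefficient of |E|^2 small.\<close>
  have G: "(norm (w * ftrans b))\<^sup>2 \<le> 2 * (norm F)\<^sup>2 + 1 / 8 * (norm E)\<^sup>2 + (norm (b * ftrans a))\<^sup>2"
  proof -
    have "(norm (w * ftrans b))\<^sup>2 = inner (ftrans w * w - ftrans a * a) (ftrans b * b) + (norm (a * ftrans b))\<^sup>2"
      unfolding norm_mult_ftrans_sq by (simp add: inner_diff_left)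
    also have "inner (ftrans w * w - ftrans a * a) (ftrans b * b) \<le>
        norm (ftrans w * w - ftrans a * a) * norm (ftrans b * b)"
      by (rule norm_cauchy_schwarz)
    also have "\<dots> \<le> norm F * norm E"
      unfolding F_def by (intro mult_mono gram_diff_le sym' D) auto
    also have "norm F * norm E \<le> 2 * (norm F)\<^sup>2 + 1 / 8 * (norm E)\<^sup>2"
      using zero_le_power2[of "4 * norm F - norm E"] by (simp add: power2_diff power_mult_distrib)
    also have "norm (a * ftrans b) = norm (b * ftrans a)"
      using norm_ftrans[of "a * ftrans b"] by simp
    finally show ?thesis by simp
  qed
  have "0 \<le> (norm (b * ftrans a))\<^sup>2" by simp
  then show ?thesis using A B C G by linarith
qed

section \<open>The polar decomposition\<close>

definition funit :: "nat \<Rightarrow> nat \<Rightarrow> fmat" where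
  "funit i j = fmat_of (Suc i) (Suc j) (\<lambda>a b. if a = i \<and> b = j then 1 else 0)"

lemma entry_funit: "entry (funit i j) a b = (if a = i \<and> b = j then 1 else 0)"
  by (auto simp: funit_def entry_fmat_of)

lemma supp_funit: "i < n \<Longrightarrow> j < m \<Longrightarrow> supp n m (funit i j)"
  by (simp add: supp_iff entry_funit)

lemma ftrans_funit [simp]: "ftrans (funit i j) = funit j i"
  by (rule fmat_eqI) (auto simp: entry_funit)

lemma funit_mult: "funit i j * funit k l = (if j = k then funit i l else 0)"
proof (rule fmat_eqI)
  fix a b
  have "entry (funit i j * funit k l) a b =
      (\<Sum>c<Suc j. if c = j then (if a = i \<and> j = k \<and> b = l then 1 else 0) else 0)"
    unfolding entry_mult_right[OF supp_funit[OF lessI lessI]] by (intro sum.cong) (auto simp: entry_funit)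
  then show "entry (funit i j * funit k l) a b = entry (if j = k then funit i l else 0) a b"
    by (simp add: entry_funit)
qed

lemma inner_funit_left: "inner (funit i j) x = entry x i j"
proof -
  have "inner (funit i j) x = (\<Sum>a<Suc i. \<Sum>b<Suc j. if b = j then (if a = i then entry x i j else 0) else 0)"
    unfolding inner_fmat_supp[OF supp_funit[OF lessI lessI]]
    by (intro sum.cong refl) (auto simp: entry_funit)
  then show ?thesis by simp
qed

lemma inner_funit_right: "inner x (funit i j) = entry x i j"
  using inner_funit_left by (simp add: inner_commute)

lemma entry_sum_funit:
  "entry (\<Sum>i<n. \<Sum>j<m. c i j *\<^sub>R funit i j) a b = (if a < n \<and> b < m then c a b else 0)"
proof -
  have "(\<Sum>j<m. entry (c i j *\<^sub>R funit i j) a b) = (if i = a then if b < m then c a b else 0 else 0)" for i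
  proof -
    have "(\<Sum>j<m. entry (c i j *\<^sub>R funit i j) a b) =
        (\<Sum>j<m. if j = b then (if i = a then c a b else 0) else 0)"
      by (intro sum.cong) (auto simp: entry_funit)
    then show ?thesis by simp
  qed
  then show ?thesis by (simp del: entry_simps)
qed

lemma fmat_sum_funit:
  assumes "supp n m x"
  shows "x = (\<Sum>i<n. \<Sum>j<m. entry x i j *\<^sub>R funit i j)"
proof (rule fmat_eqI)
  fix a b
  show "entry x a b = entry (\<Sum>i<n. \<Sum>j<m. entry x i j *\<^sub>R funit i j) a b"
    unfolding entry_sum_funit using assms by (auto simp: supp_iff not_less)
qed

text \<open>The intermediate index \<open>k\<close> is free. With \<open>k = 0\<close>, right
  multiplication by \<open>funit j 0\<close> extracts column \<open>j\<close> as a single-column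
  element.\<close>

lemma fid_eq_sum: "fid n = (\<Sum>j<n. funit j k * funit k j)"
proof (rule fmat_eqI)
  fix a b
  have "(\<Sum>j<n. entry (funit j j) a b) = (\<Sum>j<n. if j = a then (if a = b then 1 else 0) else 0)"
    by (intro sum.cong) (auto simp: entry_funit)
  then show "entry (fid n) a b = entry (\<Sum>j<n. funit j k * funit k j) a b"
    by (simp add: funit_mult entry_fid)
qed

lemma bounded_linear_ftrans: "bounded_linear ftrans"
  by (rule bounded_linear_intro[where K = 1]) auto

lemma continuous_on_ftrans [continuous_intros]:
  "continuous_on A f \<Longrightarrow> continuous_on A (\<lambda>x. ftrans (f x))"
  by (rule bounded_linear.continuous_on[OF bounded_linear_ftrans])

text \<open>The whole space is infinite-dimensional, so closed and bounded is not enough. The cube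
  of a fixed format is the continuous image of a product of intervals, compact by Tychonoff.\<close>

lemma compact_cube: "compact {x. supp n m x \<and> (\<forall>i j. \<bar>entry x i j\<bar> \<le> 1)}"
proof -
  define F where "F \<phi> = (\<Sum>i<n. \<Sum>j<m. \<phi> (i, j) *\<^sub>R funit i j)" for \<phi> :: "nat \<times> nat \<Rightarrow> real"
  define C where "C = PiE UNIV (\<lambda>_ :: nat \<times> nat. {-1..1 :: real})"
  have "compactin (product_topology (\<lambda>_ :: nat \<times> nat. euclidean :: real topology) UNIV) C"
    unfolding C_def compactin_PiE by simp
  then have "compact C" by (simp add: euclidean_product_topology)
  moreover have "continuous_on UNIV F"
    unfolding F_def by (intro continuous_intros) simp
  ultimately have "compact (F ` C)"
    by (meson compact_continuous_image continuous_on_subset subset_UNIV)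
  also have "F ` C = {x. supp n m x \<and> (\<forall>i j. \<bar>entry x i j\<bar> \<le> 1)}" (is "_ = ?R")
  proof (intro equalityI subsetI)
    fix x assume "x \<in> F ` C"
    then obtain \<phi> where \<phi>: "\<phi> \<in> C" "x = F \<phi>" by auto
    have "entry x a b = (if a < n \<and> b < m then \<phi> (a, b) else 0)" for a b
      unfolding \<phi>(2) F_def by (rule entry_sum_funit)
    moreover have "\<bar>\<phi> p\<bar> \<le> 1" for p
    proof -
      have "\<phi> p \<in> {-1..1}" using \<phi>(1) unfolding C_def by (rule PiE_mem) simp
      then show ?thesis by auto
    qed
    ultimately show "x \<in> ?R" by (auto simp: supp_iff)
  next
    fix x assume x: "x \<in> ?R"
    show "x \<in> F ` C"
    proof
      show "x = F (\<lambda>p. entry x (fst p) (snd p))"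
        unfolding F_def using fmat_sum_funit[of n m x] x by simp
      show "(\<lambda>p. entry x (fst p) (snd p)) \<in> C"
        using x by (auto simp: C_def abs_le_iff minus_le_iff)
    qed
  qed
  finally show ?thesis .
qed

text \<open>Both one-sided identities are imposed: one bounds the entries, the other cancels the
  rotation when a rotated factor is multiplied by its transpose.\<close>

definition forth :: "nat \<Rightarrow> fmat set" where
  "forth r = {x. supp r r x \<and> ftrans x * x = fid r \<and> x * ftrans x = fid r}"

lemma forth_entry_le:
  assumes "x \<in> forth r"
  shows "\<bar>entry x i j\<bar> \<le> 1"
proof (cases "j < r")
  case True
  have s: "supp r r x" and o: "ftrans x * x = fid r" using assms by (auto simp: forth_def)
  have "entry (ftrans x * x) j j = (\<Sum>k<r. (entry x k j)\<^sup>2)"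
    by (simp add: entry_mult_left[OF s] power2_eq_square)
  then have "(\<Sum>k<r. (entry x k j)\<^sup>2) = 1" using True by (simp add: o entry_fid)
  moreover have "(entry x i j)\<^sup>2 \<le> (\<Sum>k<r. (entry x k j)\<^sup>2)" if "i < r"
    by (rule member_le_sum) (use that in auto)
  ultimately have "(entry x i j)\<^sup>2 \<le> 1" if "i < r" using that by simp
  moreover have "entry x i j = 0" if "\<not> i < r" using s that by (simp add: supp_iff)
  ultimately show ?thesis by (cases "i < r") (auto simp: abs_square_le_1)
next
  case False
  then show ?thesis using assms by (auto simp: forth_def supp_iff)
qed

lemma compact_forth: "compact (forth r)"
proof -
  have "forth r = {x. supp r r x \<and> (\<forall>i j. \<bar>entry x i j\<bar> \<le> 1)} \<inter>
      ({x. ftrans x * x = fid r} \<inter> {x. x * ftrans x = fid r})"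
    using forth_entry_le by (auto simp: forth_def)
  moreover have "closed {x. ftrans x * x = fid r}" "closed {x. x * ftrans x = fid r}"
    by (intro closed_Collect_eq continuous_intros)+
  ultimately show ?thesis using compact_cube by (simp add: compact_Int_closed closed_Int)
qed

lemma forth_mult:
  assumes "x \<in> forth r" "y \<in> forth r"
  shows "x * y \<in> forth r"
proof -
  have s: "supp r r x" "supp r r y" and o: "ftrans x * x = fid r" "x * ftrans x = fid r"
    "ftrans y * y = fid r" "y * ftrans y = fid r"
    using assms by (auto simp: forth_def)
  have "ftrans (x * y) * (x * y) = ftrans y * (ftrans x * x) * y"
    "(x * y) * ftrans (x * y) = x * (y * ftrans y) * ftrans x"
    by (simp_all add: mult.assoc)
  moreover have "ftrans y * fid r = ftrans y" "x * fid r = x"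
    using mult_fid s supp_ftrans by blast+
  ultimately show ?thesis
    using o supp_mult[OF s] by (simp add: forth_def)
qed

text \<open>The form at a matrix \<open>z\<close> is the sum of its values at the columns of
  \<open>z\<close> truncated to \<open>r\<close> rows.\<close>

lemma psd_of_rank_one:
  assumes S: "supp r r S" and v: "\<And>v. supp r 1 v \<Longrightarrow> 0 \<le> inner (S * v) v"
  shows "0 \<le> inner z (S * z)"
proof -
  define k where "k = fsize z"
  define y where "y = fid r * z"
  have y: "supp r k y" unfolding y_def k_def by (rule supp_mult[OF supp_fid supp_fsize])
  have Sf: "S * fid r = S" "fid r * S = S" using S by (simp_all add: mult_fid fid_mult)
  have "inner z (S * z) = inner (S * z) z" by (rule inner_commute)
  also have "\<dots> = inner (S * y) y"
    unfolding y_def by (metis Sf inner_mult_left ftrans_fid mult.assoc inner_commute)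
  also have "\<dots> = inner S (y * ftrans y)" by (simp add: inner_mult_right)
  also have "y * ftrans y = y * fid k * ftrans y" using y by (simp add: mult_fid)
  also have "\<dots> = (\<Sum>j<k. (y * funit j 0) * ftrans (y * funit j 0))"
    unfolding fid_eq_sum[of k 0] by (simp add: sum_distrib_left sum_distrib_right mult.assoc)
  also have "inner S \<dots> = (\<Sum>j<k. inner (S * (y * funit j 0)) (y * funit j 0))"
    by (simp add: inner_sum_right inner_mult_right)
  also have "\<dots> \<ge> 0"
  proof (intro sum_nonneg v)
    fix j assume "j \<in> {..<k}"
    then show "supp r 1 (y * funit j 0)" by (intro supp_mult[OF y supp_funit]) auto
  qed
  finally show ?thesis .
qed

text \<open>An elementary first-order condition: for \<open>b\<close> nonzero,
  \<open>t = b / q\<close> with \<open>q > A\<close> would make the expression positive.\<close>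

lemma linear_quadratic_zero:
  fixes A b :: real
  assumes "\<And>t. t * (b - t * A) \<le> 0"
  shows "b = 0"
proof (rule ccontr)
  assume "b \<noteq> 0"
  define q where "q = \<bar>A\<bar> + 1"
  have q: "q > 0" "A < q" by (auto simp: q_def)
  have "b / q * (b - b / q * A) = b\<^sup>2 / q * (1 - A / q)"
    using q(1) by (simp add: power2_eq_square field_simps)
  also have "\<dots> > 0" using q \<open>b \<noteq> 0\<close> by (intro mult_pos_pos divide_pos_pos) auto
  finally show False using assms[of "b / q"] by simp
qed

text \<open>The Householder reflection in the hyperplane orthogonal to \<open>v\<close>;
  \<open>c = 2 / t\<close> is the nonzero root of \<open>c * c * t = 2 * c\<close>.\<close>

lemma reflection_forth:
  assumes v: "supp r 1 v" "v \<noteq> 0"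
  shows "fid r - (2 / inner v v) *\<^sub>R (v * ftrans v) \<in> forth r"
proof -
  define t where "t = inner v v"
  have t: "t > 0" using v by (simp add: t_def)
  define c where "c = 2 / t"
  have c: "c * c * t - c - c = 0" using t by (simp add: c_def)
  define G where "G = fid r - c *\<^sub>R (v * ftrans v)"
  have s: "supp r r (v * ftrans v)" by (rule supp_mult[OF v(1) supp_ftrans[OF v(1)]])
  have f0: "fid 0 = 0" by (rule fmat_eqI) (simp add: entry_fid)
  have "ftrans v * v = t *\<^sub>R fid 1"
    using ftrans_mult_self_single_column[of r 0 v] v(1) by (simp add: f0 t_def)
  then have vv: "v * ftrans v * (v * ftrans v) = t *\<^sub>R (v * ftrans v)"
    by (metis mult.assoc mult_fid[OF v(1)] mult_scaleR_left mult_scaleR_right)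
  have square: "(x - c *\<^sub>R y) * (x - c *\<^sub>R y) = x * x - c *\<^sub>R (x * y) - c *\<^sub>R (y * x) + (c * c) *\<^sub>R (y * y)"
    for x y :: fmat by (simp add: algebra_simps)
  have "G * G = fid r - c *\<^sub>R (v * ftrans v) - c *\<^sub>R (v * ftrans v)
      + (c * c) *\<^sub>R (v * ftrans v * (v * ftrans v))"
    unfolding G_def square fid_fid fid_mult[OF s] mult_fid[OF s] ..
  also have "\<dots> = fid r + (c * c * t - c - c) *\<^sub>R (v * ftrans v)"
    unfolding vv by (simp only: scaleR_diff_left scaleR_scaleR) (simp only: algebra_simps)
  finally have "G * G = fid r" unfolding c by simp
  moreover have "ftrans G = G" by (simp add: G_def)
  moreover have "supp r r G" unfolding G_def by (intro supp_diff supp_scaleR s supp_fid)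
  ultimately show ?thesis unfolding forth_def G_def c_def t_def by simp
qed

text \<open>\<open>Q\<close> projects onto a coordinate plane and \<open>J\<close> generates its
  rotations, \<open>J * J = - Q\<close>; changing the sign of \<open>s\<close> inverts the
  rotation.\<close>

lemma rotation_forth:
  assumes ij: "i < r" "j < r" "i \<noteq> j" and cs: "c\<^sup>2 + s\<^sup>2 = 1"
  shows "fid r + (c - 1) *\<^sub>R (funit i i + funit j j) + s *\<^sub>R (funit i j - funit j i) \<in> forth r"
proof -
  define Q where "Q = funit i i + funit j j"
  define J where "J = funit i j - funit j i"
  have sQ: "supp r r Q" and sJ: "supp r r J"
    unfolding Q_def J_def using ij by (auto intro!: supp_add supp_diff supp_funit)
  have QJ: "Q * Q = Q" "Q * J = J" "J * Q = J" "J * J = - Q" "ftrans Q = Q" "ftrans J = - J"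
    using ij(3) by (auto simp: Q_def J_def algebra_simps funit_mult)
  note f = fid_mult[OF sQ] fid_mult[OF sJ] mult_fid[OF sQ] mult_fid[OF sJ]
  define G where "G s = fid r + (c - 1) *\<^sub>R Q + s *\<^sub>R J" for s
  have G: "G s * G (- s) = fid r" if "c\<^sup>2 + s\<^sup>2 = 1" for s
  proof -
    have "G s * G (- s) = fid r + ((c - 1) + (c - 1) + (c - 1) * (c - 1) + s * s) *\<^sub>R Q"
      unfolding G_def by (simp add: algebra_simps f QJ)
    also have "(c - 1) + (c - 1) + (c - 1) * (c - 1) + s * s = c\<^sup>2 + s\<^sup>2 - 1"
      by (simp add: power2_eq_square algebra_simps)
    finally show ?thesis using that by simp
  qed
  have "ftrans (G s) = G (- s)" by (simp add: G_def QJ)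
  moreover have "supp r r (G s)" unfolding G_def by (intro supp_add supp_scaleR sQ sJ supp_fid)
  ultimately show ?thesis using G[of s] G[of "- s"] cs
    unfolding forth_def by (simp add: G_def Q_def J_def)
qed

text \<open>Maximize the trace of \<open>a * R\<close> over the orthogonal matrices; comparison with reflections
  gives semidefiniteness and comparison with plane rotations gives symmetry.\<close>
lemma polar_decomposition:
  assumes a: "supp r r a"
  shows "\<exists>R \<in> forth r. ftrans (a * R) = a * R \<and> (\<forall>z. 0 \<le> inner z (a * R * z))"
proof -
  have "fid r \<in> forth r" by (simp add: forth_def)
  moreover have "continuous_on (forth r) (\<lambda>R. inner (fid r) (a * R))" by (intro continuous_intros)
  ultimately obtain R where R: "R \<in> forth r"
    and max: "\<And>R'. R' \<in> forth r \<Longrightarrow> inner (fid r) (a * R') \<le> inner (fid r) (a * R)"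
    using continuous_attains_sup[OF compact_forth, of r] by (metis empty_iff)
  define S where "S = a * R"
  have S: "supp r r S" unfolding S_def using R by (intro supp_mult[OF a, of r]) (simp add: forth_def)
  have max': "inner (fid r) (S * G) \<le> inner (fid r) S" if "G \<in> forth r" for G
    using max[OF forth_mult[OF R that]] by (simp add: S_def mult.assoc)
  have fS: "S * fid r = S" using S by (rule mult_fid)
  have "0 \<le> inner (S * v) v" if v: "supp r 1 v" for v
  proof (cases "v = 0")
    case False
    then have t: "inner v v > 0" by simp
    have "inner (fid r) (S * (v * ftrans v)) = inner (S * v) v"
      by (subst inner_commute) (simp add: inner_mult_right fid_mult[OF v] flip: mult.assoc)
    then have "inner (fid r) S - 2 / inner v v * inner (S * v) v \<le> inner (fid r) S"
      using max'[OF reflection_forth[OF v False]] by (simp add: algebra_simps inner_diff_right fS)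
    then show ?thesis using t by (simp add: zero_le_mult_iff zero_le_divide_iff)
  qed simp
  then have psd: "0 \<le> inner z (S * z)" for z by (rule psd_of_rank_one[OF S])
  have trE: "inner (fid r) (S * funit i j) = entry S j i" if "i < r" "j < r" for i j
    using that by (subst inner_commute) (simp add: inner_mult_right fid_mult[OF supp_funit] inner_funit_right)
  have "entry S i j = entry S j i" if ij: "i < r" "j < r" "i \<noteq> j" for i j
  proof -
    define A where "A = entry S i i + entry S j j"
    define b where "b = entry S j i - entry S i j"
    have *: "(c - 1) * A + s * b \<le> 0" if "c\<^sup>2 + s\<^sup>2 = 1" for c s
      using max'[OF rotation_forth[OF ij that]]
      by (simp add: distrib_left right_diff_distrib inner_add_right inner_diff_right fS trE ij A_def b_def)
    \<comment> \<open>The rational parametrization of the circle turns the trace comparison into a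
      polynomial inequality in \<open>t\<close>, without trigonometric functions.\<close>
    have "t * (b - t * A) \<le> 0" for t
    proof -
      have p: "1 + t\<^sup>2 > 0" by (simp add: add_pos_nonneg)
      have "((1 - t\<^sup>2) / (1 + t\<^sup>2))\<^sup>2 + (2 * t / (1 + t\<^sup>2))\<^sup>2 = ((1 - t\<^sup>2)\<^sup>2 + (2 * t)\<^sup>2) / (1 + t\<^sup>2)\<^sup>2"
        by (simp add: power_divide add_divide_distrib)
      also have "(1 - t\<^sup>2)\<^sup>2 + (2 * t)\<^sup>2 = (1 + t\<^sup>2)\<^sup>2" by (simp add: power2_eq_square algebra_simps)
      finally have "((1 - t\<^sup>2) / (1 + t\<^sup>2) - 1) * A + 2 * t / (1 + t\<^sup>2) * b \<le> 0"
        using p by (intro *) simp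
      also have "(1 - t\<^sup>2) / (1 + t\<^sup>2) - 1 = - 2 * t\<^sup>2 / (1 + t\<^sup>2)"
        using p by (simp add: field_simps)
      also have "- 2 * t\<^sup>2 / (1 + t\<^sup>2) * A + 2 * t / (1 + t\<^sup>2) * b = 2 * (t * (b - t * A)) / (1 + t\<^sup>2)"
        by (simp add: power2_eq_square add_divide_distrib diff_divide_distrib algebra_simps)
      finally show ?thesis using p by (simp add: divide_le_0_iff)
    qed
    then have "b = 0" by (rule linear_quadratic_zero)
    then show ?thesis by (simp add: b_def)
  qed
  then have "ftrans S = S"
    using S by (intro fmat_eqI) (metis entry_ftrans not_le supp_iff)
  then show ?thesis using R psd unfolding S_def by blast
qed

section \<open>Stacked factors\<close>

definition fstack :: "nat \<Rightarrow> nat \<Rightarrow> fmat \<Rightarrow> fmat \<Rightarrow> fmat" where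
  "fstack n m a b = a + fshift n m * b"

lemma fshift_supp_simps:
  assumes "supp n l a" "supp m l' b"
  shows "ftrans (fshift n m) * a = 0" "ftrans a * fshift n m = 0"
    "ftrans (fshift n m) * (fshift n m * b) = b"
proof -
  show *: "ftrans (fshift n m) * a = 0"
    using arg_cong[OF fshift_orth(3)[of n m], of "\<lambda>x. x * a"] by (simp add: mult.assoc fid_mult[OF assms(1)])
  show "ftrans a * fshift n m = 0" using arg_cong[OF *, of ftrans] by simp
  show "ftrans (fshift n m) * (fshift n m * b) = b"
    by (simp add: fshift_orth(1) fid_mult[OF assms(2)] flip: mult.assoc)
qed

lemma supp_fstack:
  assumes "supp n l a" "supp m l b"
  shows "supp (n + m) l (fstack n m a b)"
  unfolding fstack_def
  by (intro supp_add supp_mult[OF supp_fshift assms(2)] supp_mono[OF assms(1)]) auto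

lemma ftrans_fstack_mult:
  assumes "supp n l a" "supp m l' b" "supp n k c" "supp m k' d"
  shows "ftrans (fstack n m a b) * fstack n m c d = ftrans a * c + ftrans b * d"
proof -
  have "ftrans a * (fshift n m * d) = 0"
    by (simp add: fshift_supp_simps(2)[OF assms(1,2)] flip: mult.assoc)
  then show ?thesis
    by (simp add: fstack_def algebra_simps fshift_supp_simps[OF assms(3,4)])
qed

lemma inner_fstack:
  assumes "supp n l a" "supp m l' b" "supp n k c" "supp m k' d"
  shows "inner (fstack n m a b) (fstack n m c d) = inner a c + inner b d"
proof -
  have "inner a (fshift n m * d) = 0"
    by (subst inner_commute) (simp add: inner_mult_left fshift_supp_simps[OF assms(1,2)])
  moreover have "inner (fshift n m * b) c = 0"
    by (simp add: inner_mult_left fshift_supp_simps[OF assms(3,4)])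
  moreover have "inner (fshift n m * b) (fshift n m * d) = inner b d"
    by (simp add: inner_mult_left fshift_supp_simps[OF assms(3,4)])
  ultimately show ?thesis
    by (simp add: fstack_def inner_add_left inner_add_right)
qed

text \<open>All norms reduce to the common Gram matrices \<open>G\<close>, \<open>H\<close> and the
  cross terms \<open>A\<close>, \<open>B\<close>, so the two factorizations may differ in their
  number of columns. The squared norm of \<open>E\<close> is 2 |x|^2 plus the squared norms of its
  diagonal blocks, and 4 |x|^2 exceeds it by 2 |A - B|^2.\<close>

lemma balanced_norm_bounds:
  assumes u: "supp n r u" "supp m r v" "ftrans u * u = ftrans v * v"
    and c: "supp n k c" "supp m k d" "ftrans c * c = ftrans d * d"
  defines "E \<equiv> fstack n m u v * ftrans (fstack n m u v) - fstack n m c d * ftrans (fstack n m c d)"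
    and "x \<equiv> u * ftrans v - c * ftrans d"
  shows "2 * (norm x)\<^sup>2 \<le> (norm E)\<^sup>2" "(norm E)\<^sup>2 \<le> 4 * (norm x)\<^sup>2"
proof -
  define A where "A = ftrans c * u"
  define B where "B = ftrans d * v"
  define G where "G = ftrans u * u"
  define H where "H = ftrans c * c"
  define w where "w = fstack n m u v"
  define z where "z = fstack n m c d"
  have ww: "ftrans w * w = G + G" "ftrans z * z = H + H" "ftrans z * w = A + B"
    unfolding w_def z_def G_def H_def A_def B_def
    by (simp_all add: ftrans_fstack_mult[OF u(1,2) u(1,2)] ftrans_fstack_mult[OF c(1,2) c(1,2)]
        ftrans_fstack_mult[OF c(1,2) u(1,2)] u(3) c(3))
  have sq: "(norm (a * ftrans a' - b * ftrans b'))\<^sup>2 =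
      inner (ftrans a * a) (ftrans a' * a') + inner (ftrans b * b) (ftrans b' * b')
        - 2 * inner (ftrans b * a) (ftrans b' * a')" for a a' b b'
  proof -
    have "inner (b * ftrans b') (a * ftrans a') = inner (ftrans b * a) (ftrans b' * a')"
      by (subst inner_commute) (rule inner_gram)
    then show ?thesis unfolding power2_norm_eq_inner
      by (simp add: inner_diff_left inner_diff_right inner_gram)
  qed
  have E: "(norm E)\<^sup>2 = 4 * inner G G + 4 * inner H H - 2 * inner (A + B) (A + B)"
    unfolding E_def w_def[symmetric] z_def[symmetric] sq ww by (simp add: inner_add_left inner_add_right)
  have x: "(norm x)\<^sup>2 = inner G G + inner H H - 2 * inner A B"
    unfolding x_def sq by (simp add: G_def H_def A_def B_def u(3) c(3))
  have y: "(norm (u * ftrans u - c * ftrans c))\<^sup>2 = inner G G + inner H H - 2 * inner A A"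
    "(norm (v * ftrans v - d * ftrans d))\<^sup>2 = inner G G + inner H H - 2 * inner B B"
    unfolding sq by (simp_all add: G_def H_def A_def B_def u(3) c(3))
  have "(norm E)\<^sup>2 = 2 * (norm x)\<^sup>2 + (norm (u * ftrans u - c * ftrans c))\<^sup>2
      + (norm (v * ftrans v - d * ftrans d))\<^sup>2"
    unfolding E x y by (simp add: inner_add_left inner_add_right inner_commute)
  then show "2 * (norm x)\<^sup>2 \<le> (norm E)\<^sup>2" by simp
  have "4 * (norm x)\<^sup>2 = (norm E)\<^sup>2 + 2 * (norm (A - B))\<^sup>2"
    unfolding E x power2_norm_eq_inner[of "A - B"]
    by (simp add: inner_add_left inner_add_right inner_diff_left inner_diff_right inner_commute)
  then show "(norm E)\<^sup>2 \<le> 4 * (norm x)\<^sup>2" by simp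
qed

text \<open>Balance turns the rank of the product into the rank of each factor: \<open>T\<close>
  equals \<open>ftrans u * (u * ftrans v)\<close>, so it has rank at most \<open>k\<close>, and a
  projection fixing \<open>T\<close> on the left must fix \<open>ftrans v\<close>.\<close>

lemma balanced_rk_projection:
  assumes bal: "ftrans u * u = ftrans v * v" and rk: "rk k (u * ftrans v)"
  shows "\<exists>\<pi>. ftrans \<pi> = \<pi> \<and> rk k \<pi> \<and> u * \<pi> = u \<and> v * \<pi> = v"
proof -
  define T where "T = ftrans v * v * ftrans v"
  have "T = ftrans u * (u * ftrans v)" by (simp add: T_def bal flip: mult.assoc)
  then have "rk k T" using rk_mult_left[OF rk] by simp
  from rk_projection[OF this] obtain \<pi> where
    \<pi>: "ftrans \<pi> = \<pi>" "\<pi> * \<pi> = \<pi>" "\<pi> * T = T" "rk k \<pi>" "(norm \<pi>)\<^sup>2 \<le> real k"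
    by (elim exE conjE)
  define y where "y = ftrans v - \<pi> * ftrans v"
  have yT: "y * v * ftrans v = 0"
    using \<pi>(3) by (simp add: y_def T_def algebra_simps)
  have fy: "ftrans y = v - v * \<pi>" using \<pi>(1) by (simp add: y_def)
  have "(y * v) * ftrans (y * v) = y * v * ftrans v * ftrans y" by (simp add: mult.assoc)
  also have "\<dots> = 0" by (simp only: yT mult_zero_left)
  finally have "y * v = 0" by (rule mult_ftrans_eq_0)
  then have "y * ftrans y = 0" unfolding fy by (simp add: right_diff_distrib flip: mult.assoc)
  then have "y = 0" by (rule mult_ftrans_eq_0)
  then have v: "v * \<pi> = v" using fy by simp
  \<comment> \<open>For \<open>u\<close> only its Gram matrix matters: by balance the Gram matrix of
    \<open>z\<close> is that of \<open>v - v * \<pi>\<close>, hence zero.\<close>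
  define z where "z = u - u * \<pi>"
  have "ftrans z * z = ftrans u * u - ftrans u * u * \<pi> - \<pi> * (ftrans u * u) + \<pi> * (ftrans u * u) * \<pi>"
    using \<pi>(1) by (simp add: z_def algebra_simps)
  also have "\<dots> = ftrans v * v - ftrans v * (v * \<pi>) - ftrans (v * \<pi>) * v + ftrans (v * \<pi>) * (v * \<pi>)"
    unfolding bal using \<pi>(1) by (simp add: mult.assoc)
  also have "\<dots> = 0" unfolding v by simp
  finally have "ftrans z * ftrans (ftrans z) = 0" by simp
  then have "ftrans z = 0" by (rule mult_ftrans_eq_0)
  then have "z = 0" by (metis ftrans_simps(1,2))
  then have "u * \<pi> = u" by (simp add: z_def)
  then show ?thesis using \<pi>(1,4) v by (intro exI[of _ \<pi>]) simp
qed

section \<open>Off-diagonal blocks of the lifted error\<close>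

text \<open>Meant for \<open>w'\<close> and \<open>c'\<close> obtained from \<open>w\<close> and
  \<open>c\<close> by negating the lower block, where balance gives the two orthogonality relations.
  They remove every term except minus the squared norm of \<open>ftrans w * c'\<close>.\<close>

lemma offdiag_nonpos:
  assumes p: "ftrans p = p" "p * w = w" "p = w * y"
    and o: "ftrans w' * w = 0" "ftrans c' * c = 0"
  shows "inner (w' * ftrans w' - c' * ftrans c') ((w * ftrans w - c * ftrans c) * p) \<le> 0"
proof -
  have wp: "ftrans w * p = ftrans w" using arg_cong[OF p(2), of ftrans] p(1) by simp
  have w'p: "ftrans w' * p = 0"
    unfolding p(3) by (simp add: o(1) flip: mult.assoc)
  have "inner (w' * ftrans w' - c' * ftrans c') ((w * ftrans w - c * ftrans c) * p)
      = inner ((w' * ftrans w' - c' * ftrans c') * p) (w * ftrans w - c * ftrans c)"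
    by (simp add: inner_mult_right p(1))
  also have "\<dots> = - inner (c' * (ftrans c' * p)) (w * ftrans w - c * ftrans c)"
    by (simp add: left_diff_distrib mult.assoc w'p)
  also have "inner (c' * (ftrans c' * p)) (c * ftrans c) = inner (ftrans c' * p) (ftrans c' * c * ftrans c)"
    by (simp add: inner_mult_left mult.assoc)
  then have "inner (c' * (ftrans c' * p)) (c * ftrans c) = 0" using o(2) by simp
  then have "inner (c' * (ftrans c' * p)) (w * ftrans w - c * ftrans c) =
      inner (c' * ftrans c' * p) (w * ftrans w)"
    by (simp add: inner_diff_right mult.assoc)
  also have "\<dots> = inner (c' * ftrans c') (w * (ftrans w * p))"
    by (subst inner_mult_right) (simp only: p(1) mult.assoc)
  also have "\<dots> = inner (ftrans w * c') (ftrans w * c')"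
    unfolding wp by (rule inner_gram)
  finally show ?thesis by simp
qed

text \<open>The block matrix \<open>(0, d; d\<^sup>T, 0)\<close>, the part of \<open>\<Xi>\<close> that depends on the gradient.\<close>
definition offd :: "nat \<Rightarrow> nat \<Rightarrow> fmat \<Rightarrow> fmat" where
  "offd n m d = d * ftrans (fshift n m) + fshift n m * ftrans d"

text \<open>The adjoint of \<open>offd\<close>: the upper right block of
  \<open>q + ftrans q\<close>.\<close>

definition offd_adj :: "nat \<Rightarrow> nat \<Rightarrow> fmat \<Rightarrow> fmat" where
  "offd_adj n m q = fid n * (q + ftrans q) * fshift n m"

lemma supp_offd_adj: "supp n m (offd_adj n m q)"
  unfolding offd_adj_def by (rule supp_mult[OF supp_mult[OF supp_fid supp_fsize] supp_fshift])

lemma inner_offd: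
  assumes "supp n m d"
  shows "inner (offd n m d) q = inner d (offd_adj n m q)"
proof -
  define J where "J = fshift n m"
  have "inner (J * ftrans d) q = inner d (ftrans q * J)"
    by (subst inner_ftrans[symmetric]) (simp add: inner_mult_right)
  moreover have "inner (d * ftrans J) q = inner d (q * J)"
    by (simp add: inner_mult_right)
  ultimately have "inner (offd n m d) q = inner (fid n * d) ((q + ftrans q) * J)"
    by (simp add: offd_def J_def inner_add_left inner_add_right distrib_right fid_mult[OF assms])
  then show ?thesis
    by (simp only: inner_mult_left ftrans_fid offd_adj_def J_def mult.assoc)
qed

text \<open>The off-diagonal blocks \<open>a\<close> and \<open>b\<close> of \<open>q\<close> occupy
  disjoint positions, so their squared norms add up to at most that of \<open>q\<close>; the factor
  2 is the cost of adding \<open>a\<close> and \<open>ftrans b\<close>.\<close>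

lemma norm_offd_adj: "(norm (offd_adj n m q))\<^sup>2 \<le> 2 * (norm q)\<^sup>2"
proof -
  define J where "J = fshift n m"
  define a where "a = fid n * q * J"
  define b where "b = ftrans J * q * fid n"
  define q' where "q' = a * ftrans J + J * b"
  have sa: "supp n m a" and sb: "supp m n b"
    unfolding a_def b_def J_def
    by (rule supp_mult[OF supp_mult[OF supp_fid supp_fsize] supp_fshift])
      (rule supp_mult[OF supp_mult[OF supp_ftrans[OF supp_fshift] supp_fsize] supp_fid])
  have JJ: "ftrans J * J = fid m" unfolding J_def by (rule fshift_orth)
  have 1: "inner (a * ftrans J) q = inner a a"
  proof -
    have "inner a a = inner (fid n * a) (q * J)"
      by (simp add: inner_mult_left) (simp add: a_def mult.assoc)
    then show ?thesis by (simp add: inner_mult_right fid_mult[OF sa])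
  qed
  have 2: "inner (J * b) q = inner b b"
  proof -
    have "inner b b = inner (b * fid n) (ftrans J * q)"
      by (simp add: inner_mult_right b_def[symmetric])
    then show ?thesis by (simp add: inner_mult_left mult_fid[OF sb])
  qed
  have 3: "inner (a * ftrans J) (J * b) = 0"
    by (subst inner_commute) (simp add: inner_mult_left J_def fshift_supp_simps(1)[OF sa supp_zero] flip: mult.assoc)
  have 4: "inner (a * ftrans J) (a * ftrans J) = inner a a"
    by (simp add: inner_mult_right mult.assoc JJ mult_fid[OF sa])
  have 5: "inner (J * b) (J * b) = inner b b"
    by (simp add: inner_mult_left JJ fid_mult[OF sb] flip: mult.assoc)
  have q'q: "(norm q')\<^sup>2 = inner q' q" "(norm q')\<^sup>2 = inner a a + inner b b"
    unfolding power2_norm_eq_inner q'_def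
    using 3 by (simp_all add: inner_add_left inner_add_right 1 2 4 5 inner_commute[of "J * b" "a * ftrans J"])
  have "norm q' * norm q' \<le> norm q' * norm q"
    using q'q(1) norm_cauchy_schwarz[of q' q] by (simp add: power2_eq_square)
  then have "norm q' \<le> norm q" by (cases "norm q' = 0") auto
  then have ab: "inner a a + inner b b \<le> (norm q)\<^sup>2" using q'q(2) by (simp flip: q'q(2) add: power_mono)
  have "offd_adj n m q = a + ftrans b"
    by (simp add: offd_adj_def a_def b_def J_def algebra_simps)
  moreover have "(norm (a + ftrans b))\<^sup>2 \<le> 2 * inner a a + 2 * inner b b"
  proof -
    have "0 \<le> (norm (a - ftrans b))\<^sup>2" by simp
    then show ?thesis unfolding power2_norm_eq_inner
      by (simp add: inner_add_left inner_add_right inner_diff_left inner_diff_right inner_commute inner_ftrans)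
  qed
  ultimately show ?thesis using ab by simp
qed

text \<open>Negating the lower block keeps the diagonal blocks and flips the others, so the
  off-diagonal part becomes a difference of two outer products.\<close>

lemma fstack_offdiag:
  "fstack n m u v * ftrans (fstack n m u v) - fstack n m u (- v) * ftrans (fstack n m u (- v))
    = 2 *\<^sub>R offd n m (u * ftrans v)"
  by (simp add: fstack_def offd_def algebra_simps scaleR_2)

lemma offd_diff: "offd n m (a - b) = offd n m a - offd n m b"
  by (simp add: offd_def algebra_simps)

text \<open>Polarization with the weights \<open>norm z\<close> and \<open>norm x\<close> balances the two directions.\<close>
lemma restricted_hessian_inner:
  fixes q :: "'a::real_inner \<Rightarrow> 'a"
  assumes lin: "linear q" and sym: "inner (q x) z = inner (q z) x"
    and bounds: "\<And>s t. \<alpha> * (norm (s *\<^sub>R x + t *\<^sub>R z))\<^sup>2 \<le> inner (q (s *\<^sub>R x + t *\<^sub>R z)) (s *\<^sub>R x + t *\<^sub>R z)"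
      "\<And>s t. inner (q (s *\<^sub>R x + t *\<^sub>R z)) (s *\<^sub>R x + t *\<^sub>R z) \<le> \<beta> * (norm (s *\<^sub>R x + t *\<^sub>R z))\<^sup>2"
  shows "(\<alpha> + \<beta>) * inner x z \<le> 2 * inner (q x) z + (\<beta> - \<alpha>) * norm x * norm z"
proof (cases "x = 0 \<or> z = 0")
  case True
  then show ?thesis using linear_0[OF lin] by auto
next
  case False
  define s where "s = norm z"
  define t where "t = norm x"
  have st: "s * t > 0" using False by (simp add: s_def t_def)
  have exp: "inner (q (s *\<^sub>R x + t' *\<^sub>R z)) (s *\<^sub>R x + t' *\<^sub>R z) =
      s * s * inner (q x) x + t' * t' * inner (q z) z + 2 * (s * t') * inner (q x) z" for t'
    by (simp add: linear_add[OF lin] linear_scale[OF lin] inner_add_left inner_add_right sym algebra_simps)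
  have sq: "inner x x = t * t" "inner z z = s * s"
    by (simp_all add: s_def t_def dot_square_norm power2_eq_square)
  have nrm: "(norm (s *\<^sub>R x + t' *\<^sub>R z))\<^sup>2 = s * s * (t * t) + t' * t' * (s * s) + 2 * (s * t') * inner x z" for t'
    unfolding power2_norm_eq_inner
    by (simp add: inner_add_left inner_add_right inner_commute[of z x] sq algebra_simps)
  \<comment> \<open>The lower bound at \<open>s x + t z\<close> minus the upper bound at
    \<open>s x - t z\<close>; with these weights both summands have norm
    \<open>s * t\<close>.\<close>
  have "\<alpha> * (s * s * (t * t) + t * t * (s * s) + 2 * (s * t) * inner x z)
      - \<beta> * (s * s * (t * t) + t * t * (s * s) - 2 * (s * t) * inner x z)
      \<le> 4 * (s * t) * inner (q x) z"
    using bounds(1)[of s t] bounds(2)[of s "- t"] unfolding exp nrm by (simp add: algebra_simps)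
  then have "(2 * (s * t)) * ((\<alpha> + \<beta>) * inner x z)
      \<le> (2 * (s * t)) * (2 * inner (q x) z + (\<beta> - \<alpha>) * t * s)"
    by (simp add: algebra_simps)
  then have "(\<alpha> + \<beta>) * inner x z \<le> 2 * inner (q x) z + (\<beta> - \<alpha>) * t * s"
    using st by (simp only: mult_le_cancel_left_pos)
  then show ?thesis by (simp add: s_def t_def)
qed

text \<open>
  The hypothesis on \<open>\<beta> / \<alpha>\<close> enters as \<open>(\<beta> - \<alpha>) / (\<alpha> + \<beta>) \<le> 0.38 / 2.38 < 4 / 25\<close>; the constant
  \<open>2263 / 5000\<close> below exceeds \<open>2 \<surd>2 \<cdot> 4 / 25\<close>.
\<close>
lemma error_bound_from_inequalities:
  fixes \<alpha> \<beta> x e w F :: real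
  assumes ab: "0 < \<alpha>" "\<alpha> \<le> \<beta>" "\<beta> / \<alpha> \<le> 1.38"
    and nn: "0 \<le> x" "0 \<le> e" "0 \<le> w" "0 \<le> F" and F: "F\<^sup>2 \<le> 4 * x\<^sup>2"
    and first: "(\<alpha> + \<beta>) * (e\<^sup>2 / 2) \<le> 2 * (w * e) + (\<beta> - \<alpha>) * x * (sqrt 2 * e)"
    and second: "2 * \<alpha> * x\<^sup>2 \<le> \<beta> * (F\<^sup>2 / 8 + 7 / 2 * e\<^sup>2) + sqrt 2 * w * F"
  shows "F\<^sup>2 \<le> 10000 / \<alpha>\<^sup>2 * w\<^sup>2"
proof -
  \<comment> \<open>In the application \<open>x\<close>, \<open>e\<close>, \<open>F\<close> are the
    norms of X - M, E p and E, and \<open>w\<close> is the square root of the rank times the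
    operator bound on \<Xi>(M). Dividing by \<alpha> makes the estimates scale-free.\<close>
  define y where "y = w / \<alpha>"
  have w: "w = \<alpha> * y" using ab by (simp add: y_def)
  have y0: "0 \<le> y" using ab nn by (simp add: y_def)
  have b: "\<beta> \<le> (69 / 50) * \<alpha>" using ab by (simp add: field_simps)
  have r2: "sqrt 2 \<le> (14143 / 10000)" by (rule real_le_lsqrt) (auto simp: power2_eq_square)
  have F2: "F \<le> 2 * x" using F nn by (intro power2_le_imp_le[of F "2 * x"]) (auto simp: power_mult_distrib)
  have e1: "e \<le> 2 * y + (2263 / 5000) * x"
  proof (cases "e = 0")
    case False
    then have e0: "e > 0" using nn by simp
    have "e * ((\<alpha> + \<beta>) * (e / 2)) \<le> e * (2 * w + (\<beta> - \<alpha>) * x * sqrt 2)"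
      using first by (simp add: power2_eq_square algebra_simps)
    then have "(\<alpha> + \<beta>) * (e / 2) \<le> 2 * w + (\<beta> - \<alpha>) * x * sqrt 2" using e0 by simp
    also have "\<dots> \<le> 2 * w + (\<beta> - \<alpha>) * x * (14143 / 10000)"
      using ab nn r2 by (intro add_left_mono mult_left_mono) auto
    also have "\<dots> \<le> (\<alpha> + \<beta>) * y + (\<alpha> + \<beta>) * (4 / 25) * x * (14143 / 10000)"
    proof (intro add_mono mult_right_mono nn)
      show "2 * w \<le> (\<alpha> + \<beta>) * y"
      proof -
        have "\<alpha> * y \<le> \<beta> * y" using ab(2) y0 by (rule mult_right_mono)
        then show ?thesis unfolding w by (simp add: algebra_simps)
      qed
      show "\<beta> - \<alpha> \<le> (\<alpha> + \<beta>) * (4 / 25)" using b ab by simp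
    qed auto
    also have "\<dots> \<le> (\<alpha> + \<beta>) * (y + (2263 / 10000) * x)"
    proof -
      have "0 \<le> (\<alpha> + \<beta>) * x" using ab nn by simp
      moreover have "(\<alpha> + \<beta>) * (y + (2263 / 10000) * x) = (\<alpha> + \<beta>) * y + (2263 / 10000) * ((\<alpha> + \<beta>) * x)"
        by (simp only: algebra_simps)
      moreover have "(\<alpha> + \<beta>) * (4 / 25) * x * (14143 / 10000) = (226288 / 1000000) * ((\<alpha> + \<beta>) * x)"
        by simp
      ultimately show ?thesis by linarith
    qed
    finally have "(\<alpha> + \<beta>) * (e / 2) \<le> (\<alpha> + \<beta>) * (y + (2263 / 10000) * x)" .
    then have "e / 2 \<le> y + (2263 / 10000) * x" using ab by (simp only: mult_le_cancel_left_pos add_pos_pos)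
    then show ?thesis by simp
  qed (use nn y0 in simp)
  have e2: "e\<^sup>2 \<le> (2 * y + (2263 / 5000) * x)\<^sup>2" using e1 nn by (intro power_mono) auto
  have "2 * \<alpha> * x\<^sup>2 \<le> ((69 / 50) * \<alpha>) * (x\<^sup>2 / 2 + 7 / 2 * (2 * y + (2263 / 5000) * x)\<^sup>2) + (14143 / 10000) * w * (2 * x)"
  proof -
    have "\<beta> * (F\<^sup>2 / 8 + 7 / 2 * e\<^sup>2) \<le> ((69 / 50) * \<alpha>) * (x\<^sup>2 / 2 + 7 / 2 * (2 * y + (2263 / 5000) * x)\<^sup>2)"
      using ab b F e2 by (intro mult_mono) auto
    moreover have "sqrt 2 * w * F \<le> (14143 / 10000) * w * (2 * x)"
      using r2 F2 nn by (intro mult_mono) auto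
    ultimately show ?thesis using second by linarith
  qed
  then have "\<alpha> * (2 * x\<^sup>2) \<le> \<alpha> * ((69 / 50) * (x\<^sup>2 / 2 + 7 / 2 * (2 * y + (2263 / 5000) * x)\<^sup>2) + (14143 / 10000) * y * (2 * x))"
    unfolding w by (simp add: algebra_simps)
  then have main: "2 * x\<^sup>2 \<le> (69 / 50) * (x\<^sup>2 / 2 + 7 / 2 * (2 * y + (2263 / 5000) * x)\<^sup>2) + (14143 / 10000) * y * (2 * x)"
    using ab by simp
  \<comment> \<open>If \<open>y < x / 50\<close>, the coefficients of x^2 on the right of
    \<open>main\<close> add up to about 0.69 + 1.17 + 0.06, less than 39/20 and hence less than the
    2 on the left. Then \<open>F \<le> 2 * x\<close> gives the final constant 10000 = (2 *
    50)^2.\<close>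
  have "x \<le> 50 * y"
  proof (rule ccontr)
    assume "\<not> x \<le> 50 * y"
    then have yx: "y < x / 50" by simp
    then have x0: "x > 0" using y0 by simp
    have "(2 * y + (2263 / 5000) * x)\<^sup>2 \<le> (2 * (x / 50) + (2263 / 5000) * x)\<^sup>2"
      using yx y0 nn by (intro power_mono) auto
    moreover have "y * (2 * x) \<le> x / 50 * (2 * x)"
      using yx nn by (intro mult_right_mono) auto
    moreover have "A \<le> (69 / 50) * (B + 7 / 2 * Q) + (14143 / 10000) * S"
      if "P \<le> Q" "R \<le> S" "A \<le> (69 / 50) * (B + 7 / 2 * P) + (14143 / 10000) * R"
      for A B P Q R S :: real using that by (simp add: field_simps)
    ultimately have "2 * x\<^sup>2 \<le> (69 / 50) * (x\<^sup>2 / 2 + 7 / 2 * (2 * (x / 50) + (2263 / 5000) * x)\<^sup>2) + (14143 / 10000) * (x / 50 * (2 * x))"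
      using main unfolding mult.assoc[of _ y] by blast
    also have "\<dots> \<le> (39 / 20) * x\<^sup>2"
      by (simp add: power2_eq_square algebra_simps)
    finally show False using x0 by simp
  qed
  then have "F \<le> 100 * y" using F2 by simp
  then have "F\<^sup>2 \<le> (100 * y)\<^sup>2" using nn by (intro power_mono) auto
  also have "\<dots> = 10000 / \<alpha>\<^sup>2 * w\<^sup>2" by (simp add: y_def power_mult_distrib power_divide)
  finally show ?thesis .
qed

section \<open>The bound at second-order critical points\<close>

text \<open>The mean value theorem is scalar, so the gradient difference is first paired with
  \<open>z\<close>, and \<open>t\<close> depends on \<open>z\<close>. This suffices, because the
  restricted bounds hold uniformly along the line.\<close>

lemma gradient_mean_value:
  fixes g :: "fmat \<Rightarrow> fmat"
  assumes "\<And>x. (g has_derivative h x) (at x)"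
  shows "\<exists>t. inner (g y - g x) z = inner (h (x + t *\<^sub>R (y - x)) (y - x)) z"
proof -
  define \<phi> where "\<phi> t = inner (g (x + t *\<^sub>R (y - x))) z" for t
  have d: "(\<phi> has_derivative (\<lambda>s. inner (h (x + t *\<^sub>R (y - x)) (s *\<^sub>R (y - x))) z)) (at t)" for t
    unfolding \<phi>_def
    by (intro has_derivative_inner_left has_derivative_compose[OF _ assms] derivative_eq_intros) auto
  have "\<exists>t\<in>{0<..<1}. \<phi> 1 - \<phi> 0 = inner (h (x + t *\<^sub>R (y - x)) ((1 - 0) *\<^sub>R (y - x))) z"
  proof (rule mvt[of 0 1 \<phi>])
    show "continuous_on {0..1} \<phi>"
      using d by (meson continuous_at_imp_continuous_on has_derivative_continuous)
  qed (use d in auto)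
  then show ?thesis by (auto simp: \<phi>_def inner_diff_left)
qed

text \<open>The two stationarity equations are the block rows of the product.\<close>

lemma lifted_critical_point:
  assumes uv: "supp n r u" "supp m r v" and G: "supp n m G"
    and crit: "G * v + lam *\<^sub>R u = 0" "ftrans G * u + lam *\<^sub>R v = 0"
  shows "(lam *\<^sub>R fid (n + m) + offd n m G) * fstack n m u v = 0"
proof -
  define J where "J = fshift n m"
  have "ftrans J * u = 0" unfolding J_def by (rule fshift_supp_simps(1)[OF uv])
  moreover have "ftrans G * (J * v) = 0"
    using fshift_supp_simps(2)[OF G uv(2)] by (simp add: J_def flip: mult.assoc)
  moreover have "ftrans J * (J * v) = v" unfolding J_def by (rule fshift_supp_simps(3)[OF uv])
  ultimately have "offd n m G * fstack n m u v = G * v + J * (ftrans G * u)"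
    by (simp add: offd_def fstack_def J_def[symmetric] distrib_left distrib_right)
      (simp add: mult.assoc)
  moreover have "fid (n + m) * fstack n m u v = fstack n m u v"
    by (rule fid_mult[OF supp_fstack[OF uv]])
  ultimately have "(lam *\<^sub>R fid (n + m) + offd n m G) * fstack n m u v
      = (G * v + lam *\<^sub>R u) + J * (ftrans G * u + lam *\<^sub>R v)"
    by (simp add: distrib_left distrib_right) (simp add: fstack_def J_def scaleR_add_right)
  then show ?thesis by (simp add: crit)
qed

text \<open>The theorem after transport to \<open>fmat\<close>: \<open>g\<close> and
  \<open>h\<close> stand for gradient and Hessian operator of f, and \<open>s\<close> for the
  spectral norm of \<Xi>(M), entering as an operator bound.\<close>

lemma factored_error_bound:
  fixes g :: "fmat \<Rightarrow> fmat" and h :: "fmat \<Rightarrow> fmat \<Rightarrow> fmat"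
  assumes ab: "0 < \<alpha>" "\<alpha> \<le> \<beta>" "\<beta> / \<alpha> \<le> 1.38" and lam: "0 < lam"
    and uv: "supp n r u" "supp m r v" and cd: "supp n k c" "supp m k d" "ftrans c * c = ftrans d * d"
    and kr: "k \<le> r"
    and g: "\<And>x. supp n m (g x)" "\<And>x. (g has_derivative h x) (at x)"
    and sym: "\<And>x a b. inner (h x a) b = inner (h x b) a"
    and rsc: "\<And>x a. supp n m x \<Longrightarrow> supp n m a \<Longrightarrow> rk (2 * k) x \<Longrightarrow> rk (4 * k) a \<Longrightarrow>
      \<alpha> * (norm a)\<^sup>2 \<le> inner (h x a) a \<and> inner (h x a) a \<le> \<beta> * (norm a)\<^sup>2"
    and crit: "g (u * ftrans v) * v + lam *\<^sub>R u = 0" "ftrans (g (u * ftrans v)) * u + lam *\<^sub>R v = 0"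
    and rk: "rk k (u * ftrans v)"
    and hess: "\<And>a b. supp n r a \<Longrightarrow> supp m r b \<Longrightarrow>
      0 \<le> inner (h (u * ftrans v) (a * ftrans v + u * ftrans b)) (a * ftrans v + u * ftrans b)
        + 2 * inner (g (u * ftrans v)) (a * ftrans b) + lam * ((norm a)\<^sup>2 + (norm b)\<^sup>2)"
    and s: "\<And>y. norm ((lam *\<^sub>R fid (n + m) + offd n m (g (c * ftrans d))) * y) \<le> s * norm y"
  defines "E \<equiv> fstack n m u v * ftrans (fstack n m u v) - fstack n m c d * ftrans (fstack n m c d)"
  shows "2 * (norm (u * ftrans v - c * ftrans d))\<^sup>2 \<le> (norm E)\<^sup>2"
    "(norm E)\<^sup>2 \<le> 10000 / \<alpha>\<^sup>2 * real k * s\<^sup>2"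
proof -
  define X where "X = u * ftrans v"
  define M where "M = c * ftrans d"
  define x where "x = X - M"
  define w where "w = fstack n m u v"
  define \<Xi> where "\<Xi> Y = lam *\<^sub>R fid (n + m) + offd n m (g Y)" for Y
  have sX: "supp n m X" unfolding X_def by (rule supp_mult[OF uv(1) supp_ftrans[OF uv(2)]])
  have sM: "supp n m M" unfolding M_def by (rule supp_mult[OF cd(1) supp_ftrans[OF cd(2)]])
  have sx: "supp n m x" unfolding x_def by (rule supp_diff[OF sX sM])
  \<comment> \<open>Multiplying the stationarity equations by \<open>ftrans u\<close> and
    \<open>ftrans v\<close> gives right sides that are transposes of each other, while the Gram
    matrices are symmetric.\<close>
  have bal: "ftrans u * u = ftrans v * v"
  proof -
    have "lam *\<^sub>R (ftrans u * u) = - (ftrans u * g X * v)" "lam *\<^sub>R (ftrans v * v) = - (ftrans v * ftrans (g X) * u)"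
      using arg_cong[OF crit(1), of "\<lambda>y. ftrans u * y"] arg_cong[OF crit(2), of "\<lambda>y. ftrans v * y"]
      by (simp_all add: X_def distrib_left eq_neg_iff_add_eq_0 add.commute mult.assoc)
    then have "ftrans (lam *\<^sub>R (ftrans u * u)) = lam *\<^sub>R (ftrans v * v)"
      by (simp only: ftrans_simps ftrans_mult mult.assoc)
    then have "lam *\<^sub>R (ftrans u * u) = lam *\<^sub>R (ftrans v * v)" by simp
    then show ?thesis using lam by simp
  qed
  note nb = balanced_norm_bounds[OF uv bal cd, folded E_def]
  show "2 * (norm (u * ftrans v - c * ftrans d))\<^sup>2 \<le> (norm E)\<^sup>2" by (rule nb(1))
  have wE: "supp (n + m) r w" unfolding w_def by (rule supp_fstack[OF uv])

  from balanced_rk_projection[OF bal rk] obtain \<pi> where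
    \<pi>: "ftrans \<pi> = \<pi>" "rk k \<pi>" "u * \<pi> = u" "v * \<pi> = v" by (elim exE conjE)
  have "w * \<pi> = w" unfolding w_def fstack_def using \<pi>(3,4) by (simp add: distrib_right mult.assoc)
  then have rkw: "rk k w" using rk_mult_left[OF \<pi>(2), of w] by simp
  have rku: "rk k u" and rkv: "rk k v" using rk_mult_left[OF \<pi>(2)] \<pi>(3,4) by metis+
  have rkc: "rk k c" by (rule rk_supp[OF cd(1)])
  \<comment> \<open>That \<open>p = w * y\<close> passes to \<open>p\<close> both the rank bound of
    \<open>w\<close> and the equation \<Xi>(X) w = 0.\<close>
  from projection_exists[OF wE] obtain p y where
    p: "ftrans p = p" "p * p = p" "p * w = w" "p = w * y" "(norm p)\<^sup>2 \<le> real r"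
    by (elim exE conjE)
  have rkp: "rk k p" unfolding p(4) by (rule rk_mult_right[OF rkw])

  \<comment> \<open>The true factors have \<open>k\<close> columns and W has \<open>r\<close>.
    Appending zero columns changes nothing in \<open>fmat\<close> and allows a rotation of order
    \<open>r\<close>.\<close>
  have cd_r: "supp n r c" "supp m r d" using cd(1,2) supp_mono[OF _ order_refl kr] by blast+
  from polar_decomposition[of r "ftrans w * fstack n m c d"]
  obtain R where R: "R \<in> forth r" "ftrans (ftrans w * fstack n m c d * R) = ftrans w * fstack n m c d * R"
    "\<And>z. 0 \<le> inner z (ftrans w * fstack n m c d * R * z)"
    using supp_mult[OF supp_ftrans[OF wE] supp_fstack[OF cd_r]] by blast
  have R': "supp r r R" "R * ftrans R = fid r" using R(1) by (auto simp: forth_def)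
  define c' where "c' = c * R"
  define d' where "d' = d * R"
  define z where "z = fstack n m c' d'"
  have cd': "supp n r c'" "supp m r d'" unfolding c'_def d'_def
    using supp_mult[OF cd_r(1) R'(1)] supp_mult[OF cd_r(2) R'(1)] by blast+
  have cr: "c * fid r = c" "d * fid r = d" using cd_r mult_fid by blast+
  have zR: "z = fstack n m c d * R" by (simp add: z_def fstack_def c'_def d'_def distrib_right mult.assoc)
  have M': "M = c' * ftrans d'"
    by (simp add: M_def c'_def d'_def mult.assoc) (simp add: R'(2) cr flip: mult.assoc)
  have zz: "z * ftrans z = fstack n m c d * ftrans (fstack n m c d)"
  proof -
    have "z * ftrans z = fstack n m c d * (R * ftrans R) * ftrans (fstack n m c d)"
      by (simp add: zR mult.assoc)
    also have "fstack n m c d * (R * ftrans R) = fstack n m c d"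
      unfolding R'(2) by (rule mult_fid[OF supp_fstack[OF cd_r]])
    finally show ?thesis .
  qed
  have bal': "ftrans c' * c' = ftrans d' * d'"
  proof -
    have "ftrans c' * c' = ftrans R * (ftrans c * c) * R" by (simp add: c'_def mult.assoc)
    also have "\<dots> = ftrans d' * d'" unfolding cd(3) by (simp add: d'_def mult.assoc)
    finally show ?thesis .
  qed
  have E: "E = w * ftrans w - z * ftrans z" by (simp add: E_def w_def zz)
  have Esym: "ftrans E = E" by (simp add: E)
  have apb: "(norm (w * ftrans (w - z)))\<^sup>2 \<le> 1 / 8 * (norm E)\<^sup>2 + 7 / 2 * (norm (E * p))\<^sup>2"
    unfolding E
  proof (rule aligned_product_bound[OF _ _ p(1-3)])
    show "ftrans w * z = ftrans z * w"
      using R(2) unfolding zR by (simp add: mult.assoc)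
    show "0 \<le> inner y (ftrans w * z * y)" for y
      using R(3) unfolding zR by (simp add: mult.assoc)
  qed

  have rkX: "rk k X" using rk unfolding X_def .
  have rkM: "rk k M" unfolding M_def by (rule rk_mult_right[OF rkc])
  have rkx: "rk (2 * k) x" unfolding x_def mult_2 by (rule rk_diff[OF rkX rkM])
  \<comment> \<open>Every point of the line is a combination of X and M, so the parameter need not
    lie in the unit interval.\<close>
  have seg: "supp n m (M + t *\<^sub>R x)" "rk (2 * k) (M + t *\<^sub>R x)" for t
  proof -
    show "supp n m (M + t *\<^sub>R x)" by (rule supp_add[OF sM supp_scaleR[OF sx]])
    have "M + t *\<^sub>R x = t *\<^sub>R X + (1 - t) *\<^sub>R M" by (simp add: x_def algebra_simps)
    then show "rk (2 * k) (M + t *\<^sub>R x)"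
      using rk_add[OF rk_scaleR[OF rkX, of t] rk_scaleR[OF rkM, of "1 - t"]] by (simp only: mult_2)
  qed
  have mv: "\<exists>t. inner (g X - g M) b = inner (h (M + t *\<^sub>R x) x) b" for b
    unfolding x_def by (rule gradient_mean_value[OF g(2)])

  have \<Xi>w: "\<Xi> X * w = 0"
    unfolding \<Xi>_def w_def by (rule lifted_critical_point[OF uv g(1)]) (use crit in \<open>auto simp: X_def\<close>)
  have \<Xi>sym: "ftrans (\<Xi> Y) = \<Xi> Y" for Y by (simp add: \<Xi>_def offd_def add.commute)
  have \<Xi>diff: "\<Xi> X = \<Xi> M + offd n m (g X - g M)" by (simp add: \<Xi>_def offd_diff)
  have s\<Xi>: "norm (\<Xi> M * b) \<le> s * norm b" for b using s unfolding \<Xi>_def M_def by blast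
  have sg: "supp n m (g X - g M)" using g(1) supp_diff by blast

  \<comment> \<open>The test direction for the gradient difference: pairing with \<open>Z\<close> is
    pairing the lifted difference with \<open>E * p\<close>, where the contribution of \<Xi>(X)
    vanishes.\<close>
  define Z where "Z = offd_adj n m (E * p)"
  have sZ: "supp n m Z" unfolding Z_def by (rule supp_offd_adj)
  have rkEp: "rk k (E * p)" by (rule rk_mult_left[OF rkp])
  have "rk k (fid n * (E * p) * fshift n m)"
    by (intro rk_mult_right rk_mult_left rkEp)
  moreover have "rk k (fid n * ftrans (E * p) * fshift n m)"
    by (intro rk_mult_right[OF rk_mult_left[OF rk_ftrans[OF rkEp]]])
  moreover have "Z = fid n * (E * p) * fshift n m + fid n * ftrans (E * p) * fshift n m"
    by (simp only: Z_def offd_adj_def distrib_left distrib_right)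
  ultimately have rkZ: "rk (2 * k) Z" unfolding mult_2 by (simp only: rk_add)
  have nZ: "norm Z \<le> sqrt 2 * norm (E * p)"
  proof (rule power2_le_imp_le)
    show "(norm Z)\<^sup>2 \<le> (sqrt 2 * norm (E * p))\<^sup>2"
      using norm_offd_adj[of n m "E * p"] by (simp add: Z_def power_mult_distrib)
  qed simp

  have "inner (g X - g M) Z = inner (offd n m (g X - g M)) (E * p)"
    unfolding Z_def by (rule inner_offd[OF sg, symmetric])
  also have "\<dots> = inner (\<Xi> X * p) E - inner (\<Xi> M) (E * p)"
    using \<Xi>diff by (simp add: inner_mult_right p(1) inner_add_left distrib_right)
  also have "\<Xi> X * p = 0" unfolding p(4) using \<Xi>w by (simp flip: mult.assoc)
  finally have gZ: "inner (g X - g M) Z = - inner (\<Xi> M) (E * p)" by simp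

  have "inner (\<Xi> M) E \<le> s * sqrt (real (2 * k)) * norm E" "- inner (\<Xi> M) E \<le> s * sqrt (real (2 * k)) * norm E"
  proof -
    have "rk (2 * k) E" unfolding E_def mult_2
      by (intro rk_diff rk_mult_right)
        (use rkw in \<open>simp_all add: w_def rk_supp[OF supp_fstack[OF cd(1,2)]]\<close>)
    then have "\<bar>inner (\<Xi> M) E\<bar> \<le> s * sqrt (real (2 * k)) * norm E"
      by (rule inner_rk_bound[OF _ \<Xi>sym s\<Xi>])
    then show "inner (\<Xi> M) E \<le> s * sqrt (real (2 * k)) * norm E"
      "- inner (\<Xi> M) E \<le> s * sqrt (real (2 * k)) * norm E" by linarith+
  qed
  note \<Xi>E = this
  have \<Xi>Ep: "- inner (\<Xi> M) (E * p) \<le> s * sqrt (real k) * norm (E * p)"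
    using inner_rk_bound[OF rkEp \<Xi>sym s\<Xi>] by (simp add: abs_le_iff)

  \<comment> \<open>\<open>E\<close> is twice the off-diagonal part of the error plus its copy with
    negated lower blocks. The copy pairs nonpositively with \<open>E * p\<close>, so at most a
    factor 2 is lost.\<close>
  have xZ: "(norm (E * p))\<^sup>2 / 2 \<le> inner x Z"
  proof -
    define w' where "w' = fstack n m u (- v)"
    define z' where "z' = fstack n m c' (- d')"
    have "2 *\<^sub>R offd n m x = E - (w' * ftrans w' - z' * ftrans z')"
      unfolding x_def offd_diff scaleR_diff_right X_def M' fstack_offdiag[symmetric] E
      by (simp add: w_def z_def w'_def z'_def)
    then have "2 * inner (offd n m x) (E * p) = inner E (E * p) - inner (w' * ftrans w' - z' * ftrans z') (E * p)"
      by (metis inner_diff_left inner_scaleR_left)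
    moreover have "inner (w' * ftrans w' - z' * ftrans z') (E * p) \<le> 0"
      unfolding E
    proof (rule offdiag_nonpos[OF p(1,3,4)])
      show "ftrans w' * w = 0" "ftrans z' * z = 0"
        unfolding w_def w'_def z_def z'_def
        by (simp_all add: ftrans_fstack_mult[OF uv(1) supp_uminus[OF uv(2)] uv] bal
            ftrans_fstack_mult[OF cd'(1) supp_uminus[OF cd'(2)] cd'] bal')
    qed
    moreover have "inner E (E * p) = (norm (E * p))\<^sup>2"
    proof -
      have "inner (E * p) (E * p) = inner E (E * (p * p))"
        by (simp add: inner_mult_right p(1) mult.assoc)
      then show ?thesis by (simp add: p(2) power2_norm_eq_inner)
    qed
    ultimately show ?thesis
      unfolding Z_def inner_offd[OF sx, symmetric] by linarith
  qed
  have first: "(\<alpha> + \<beta>) * ((norm (E * p))\<^sup>2 / 2) \<le>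
      2 * (s * sqrt (real k) * norm (E * p)) + (\<beta> - \<alpha>) * norm x * (sqrt 2 * norm (E * p))"
  proof -
    from mv[of Z] obtain t where t: "inner (g X - g M) Z = inner (h (M + t *\<^sub>R x) x) Z" by blast
    have lin: "linear (h (M + t *\<^sub>R x))" using g(2) has_derivative_linear by blast
    have comb: "supp n m (a *\<^sub>R x + b *\<^sub>R Z)" "rk (4 * k) (a *\<^sub>R x + b *\<^sub>R Z)" for a b
      using supp_add[OF supp_scaleR[OF sx] supp_scaleR[OF sZ]]
        rk_add[OF rk_scaleR[OF rkx] rk_scaleR[OF rkZ]] by simp_all
    have "(\<alpha> + \<beta>) * inner x Z \<le> 2 * inner (h (M + t *\<^sub>R x) x) Z + (\<beta> - \<alpha>) * norm x * norm Z"
      using rsc[OF seg(1) comb(1) seg(2) comb(2)]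
      by (intro restricted_hessian_inner[OF lin sym]) blast+
    also have "inner (h (M + t *\<^sub>R x) x) Z \<le> s * sqrt (real k) * norm (E * p)"
      using \<Xi>Ep gZ t by simp
    also have "(\<beta> - \<alpha>) * norm x * norm Z \<le> (\<beta> - \<alpha>) * norm x * (sqrt 2 * norm (E * p))"
      using ab nZ by (intro mult_left_mono) auto
    finally have "(\<alpha> + \<beta>) * inner x Z \<le> 2 * (s * sqrt (real k) * norm (E * p))
      + (\<beta> - \<alpha>) * norm x * (sqrt 2 * norm (E * p))" by simp
    moreover have "(\<alpha> + \<beta>) * ((norm (E * p))\<^sup>2 / 2) \<le> (\<alpha> + \<beta>) * inner x Z"
      using ab xZ by (intro mult_left_mono) auto
    ultimately show ?thesis by linarith
  qed

  define a where "a = u - c'"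
  define b where "b = v - d'"
  \<comment> \<open>The derivative of the product \<open>u * ftrans v\<close> in the direction of
    the aligned difference \<open>(a, b)\<close>.\<close>
  define K where "K = a * ftrans v + u * ftrans b"
  have sab: "supp n r a" "supp m r b" unfolding a_def b_def using uv cd' supp_diff by blast+
  have wz: "w - z = fstack n m a b" by (simp add: w_def z_def a_def b_def fstack_def algebra_simps)
  have K: "supp n m K" "rk (4 * k) K"
  proof -
    show "supp n m K" unfolding K_def using sab uv by (intro supp_add supp_mult supp_ftrans)
    have "rk (k + k) K" unfolding K_def
      by (intro rk_add rk_mult_right[OF rku] rk_mult_left[OF rk_ftrans[OF rkv]])
    then show "rk (4 * k) K" by (rule rk_mono) simp
  qed
  \<comment> \<open>The factor 2 from splitting the sum is matched exactly: by balance the Gram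
    matrix of \<open>w\<close> is twice that of \<open>v\<close>.\<close>
  have nK: "(norm K)\<^sup>2 \<le> (norm (w * ftrans (w - z)))\<^sup>2"
  proof -
    have "(norm K)\<^sup>2 \<le> 2 * (norm (a * ftrans v))\<^sup>2 + 2 * (norm (u * ftrans b))\<^sup>2"
    proof -
      have "0 \<le> (norm (a * ftrans v - u * ftrans b))\<^sup>2" by simp
      then show ?thesis unfolding K_def power2_norm_eq_inner
        by (simp add: inner_add_left inner_add_right inner_diff_left inner_diff_right inner_commute)
    qed
    also have "\<dots> = (norm (w * ftrans (w - z)))\<^sup>2"
      unfolding norm_mult_ftrans_sq wz unfolding w_def ftrans_fstack_mult[OF uv uv]
        ftrans_fstack_mult[OF sab sab] bal
      by (simp add: inner_add_left inner_add_right inner_commute)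
    finally show ?thesis .
  qed
  \<comment> \<open>The left side is \<Xi>(X) paired with the outer square of \<open>w - z\<close>.
    As \<Xi>(X) w = 0, only the outer square of \<open>z\<close> survives, and it may be replaced by
    \<open>- E\<close>.\<close>
  have "2 * inner (g X) (a * ftrans b) + lam * ((norm a)\<^sup>2 + (norm b)\<^sup>2) = - inner (\<Xi> X) E"
  proof -
    have "inner (\<Xi> X) ((w - z) * ftrans (w - z)) = inner (\<Xi> X * (w - z)) (w - z)"
      by (simp add: inner_mult_right)
    also have "\<dots> = - inner (\<Xi> X * z) (w - z)" by (simp add: right_diff_distrib \<Xi>w)
    also have "\<dots> = - inner z (\<Xi> X * (w - z))" by (simp add: inner_mult_left \<Xi>sym)
    also have "\<dots> = inner z (\<Xi> X * z)" by (simp add: right_diff_distrib \<Xi>w)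
    also have "\<dots> = inner (\<Xi> X) (z * ftrans z)"
      by (subst inner_commute) (simp add: inner_mult_right)
    also have "\<dots> = inner (\<Xi> X) (z * ftrans z) - inner (\<Xi> X) (w * ftrans w)"
    proof -
      have "inner (\<Xi> X) (w * ftrans w) = inner (\<Xi> X * w) w" by (simp add: inner_mult_right)
      then show ?thesis by (simp add: \<Xi>w)
    qed
    also have "\<dots> = - inner (\<Xi> X) E" by (simp add: E inner_diff_right)
    finally have 1: "inner (\<Xi> X) ((w - z) * ftrans (w - z)) = - inner (\<Xi> X) E" .
    define q where "q = fstack n m a b"
    have sq: "supp (n + m) r q" unfolding q_def by (rule supp_fstack[OF sab])
    have "inner (fid (n + m)) (q * ftrans q) = inner (fid (n + m) * q) q"
      by (simp add: inner_mult_right)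
    also have "\<dots> = (norm a)\<^sup>2 + (norm b)\<^sup>2"
      unfolding fid_mult[OF sq] unfolding q_def inner_fstack[OF sab sab] by (simp add: power2_norm_eq_inner)
    finally have 2: "inner (fid (n + m)) (q * ftrans q) = (norm a)\<^sup>2 + (norm b)\<^sup>2" .
    have "offd_adj n m (q * ftrans q) = 2 *\<^sub>R (a * ftrans b)"
    proof -
      have "fid n * fshift n m = 0" by (rule fshift_orth)
      then have fq: "fid n * q = a" "ftrans q * fshift n m = ftrans b"
        unfolding q_def fstack_def
        using fid_mult[OF sab(1)] fshift_supp_simps(2)[OF sab] arg_cong[OF fshift_supp_simps(3)[OF sab], of ftrans]
        by (simp_all add: distrib_left distrib_right flip: mult.assoc)
      have "offd_adj n m (q * ftrans q) = 2 *\<^sub>R ((fid n * q) * (ftrans q * fshift n m))"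
        by (simp add: offd_adj_def scaleR_2 distrib_left distrib_right mult.assoc)
      then show ?thesis unfolding fq .
    qed
    then have 3: "inner (offd n m (g X)) (q * ftrans q) = 2 * inner (g X) (a * ftrans b)"
      by (simp add: inner_offd[OF g(1)])
    show ?thesis using 1 2 3 unfolding wz q_def[symmetric] by (simp add: \<Xi>_def inner_add_left)
  qed
  \<comment> \<open>Passing from \<Xi>(X) to \<Xi>(M) produces the strong convexity term: the
    gradient difference sits in the off-diagonal blocks, where \<open>E\<close> has \<open>x\<close>
    and its transpose.\<close>
  moreover have "inner (\<Xi> X) E = inner (\<Xi> M) E + 2 * inner (g X - g M) x"
  proof -
    have "inner (offd n m (g X - g M)) E = inner (g X - g M) (offd_adj n m E)" by (rule inner_offd[OF sg])
    also have "offd_adj n m E = 2 *\<^sub>R x"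
    proof -
      have "fid n * w = u" "ftrans w * fshift n m = ftrans v" "fid n * z = c'" "ftrans z * fshift n m = ftrans d'"
        unfolding w_def z_def fstack_def
        using fid_mult[OF uv(1)] fshift_supp_simps(2)[OF uv] arg_cong[OF fshift_supp_simps(3)[OF uv], of ftrans]
          fid_mult[OF cd'(1)] fshift_supp_simps(2)[OF cd'] arg_cong[OF fshift_supp_simps(3)[OF cd'], of ftrans]
          fshift_orth(2)[of n m]
        by (simp_all add: distrib_left distrib_right flip: mult.assoc)
      then have fq: "fid n * (w * (ftrans w * fshift n m)) = X" "fid n * (z * (ftrans z * fshift n m)) = M"
        unfolding X_def M' by (simp_all flip: mult.assoc)
      have "offd_adj n m E = 2 *\<^sub>R (fid n * (w * (ftrans w * fshift n m)) - fid n * (z * (ftrans z * fshift n m)))"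
        unfolding offd_adj_def Esym unfolding E by (simp add: scaleR_2 algebra_simps)
      then show ?thesis unfolding fq x_def .
    qed
    finally show ?thesis unfolding \<Xi>diff by (simp add: inner_add_left)
  qed
  moreover have "\<alpha> * (norm x)\<^sup>2 \<le> inner (g X - g M) x"
  proof -
    from mv[of x] obtain t where "inner (g X - g M) x = inner (h (M + t *\<^sub>R x) x) x" by blast
    then show ?thesis using rsc[OF seg(1) sx seg(2) rk_mono[OF rkx], of t] by simp
  qed
  moreover have "0 \<le> inner (h X K) K + (2 * inner (g X) (a * ftrans b) + lam * ((norm a)\<^sup>2 + (norm b)\<^sup>2))"
    using hess[OF sab] unfolding X_def K_def by linarith
  moreover have "inner (h X K) K \<le> \<beta> * (1 / 8 * (norm E)\<^sup>2 + 7 / 2 * (norm (E * p))\<^sup>2)"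
  proof -
    have "inner (h X K) K \<le> \<beta> * (norm K)\<^sup>2"
      using rsc[OF sX K(1) rk_mono[OF rkX] K(2)] by simp
    also have "\<dots> \<le> \<beta> * (1 / 8 * (norm E)\<^sup>2 + 7 / 2 * (norm (E * p))\<^sup>2)"
      by (rule mult_left_mono[OF order_trans[OF nK apb]]) (use ab in simp)
    finally show ?thesis .
  qed
  ultimately have "2 * \<alpha> * (norm x)\<^sup>2 \<le> \<beta> * (1 / 8 * (norm E)\<^sup>2 + 7 / 2 * (norm (E * p))\<^sup>2)
      + s * sqrt (real (2 * k)) * norm E"
    using \<Xi>E(2) by linarith
  then have second: "2 * \<alpha> * (norm x)\<^sup>2 \<le> \<beta> * ((norm E)\<^sup>2 / 8 + 7 / 2 * (norm (E * p))\<^sup>2)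
      + sqrt 2 * (s * sqrt (real k)) * norm E"
    by (simp add: real_sqrt_mult algebra_simps)
  have s0: "0 \<le> s"
    using order_trans[OF norm_ge_zero s, of "funit 0 0"]
    by (simp add: norm_eq_sqrt_inner inner_funit_left entry_funit)
  have "(norm E)\<^sup>2 \<le> 10000 / \<alpha>\<^sup>2 * (s * sqrt (real k))\<^sup>2"
    using nb(2) first second s0 ab
    by (intro error_bound_from_inequalities[where x = "norm x" and e = "norm (E * p)" and \<beta> = \<beta>])
      (auto simp: x_def X_def M_def)
  then show "(norm E)\<^sup>2 \<le> 10000 / \<alpha>\<^sup>2 * real k * s\<^sup>2"
    by (simp add: power_mult_distrib algebra_simps)
qed

section \<open>Embedding of matrices with explicit dimensions\<close>

definition emb :: "real mat \<Rightarrow> fmat" where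
  "emb A = fmat_of (dim_row A) (dim_col A) (\<lambda>i j. A $$ (i, j))"

definition tomat :: "nat \<Rightarrow> nat \<Rightarrow> fmat \<Rightarrow> real mat" where
  "tomat n m x = mat n m (\<lambda>(i, j). entry x i j)"

lemma entry_emb: "entry (emb A) i j = (if i < dim_row A \<and> j < dim_col A then A $$ (i, j) else 0)"
  by (simp add: emb_def entry_fmat_of)

lemma supp_emb: "A \<in> carrier_mat n m \<Longrightarrow> supp n m (emb A)"
  by (auto simp: emb_def supp_fmat_of)

lemma tomat_carrier [simp]: "tomat n m x \<in> carrier_mat n m"
  by (simp add: tomat_def)

lemma dim_tomat [simp]: "dim_row (tomat n m x) = n" "dim_col (tomat n m x) = m"
  by (simp_all add: tomat_def)

lemma tomat_index: "i < n \<Longrightarrow> j < m \<Longrightarrow> tomat n m x $$ (i, j) = entry x i j"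
  by (simp add: tomat_def)

lemma tomat_emb: "A \<in> carrier_mat n m \<Longrightarrow> tomat n m (emb A) = A"
  by (rule eq_matI) (auto simp: tomat_def entry_emb)

lemma emb_tomat_proj: "emb (tomat n m x) = fid n * x * fid m"
  by (rule fmat_eqI) (simp add: entry_emb tomat_index entry_mult_fid entry_fid_mult)

lemma emb_tomat: "supp n m x \<Longrightarrow> emb (tomat n m x) = x"
  unfolding emb_tomat_proj fid_eq_supp .

lemma tomat_proj: "tomat n m (fid n * x * fid m) = tomat n m x"
  by (rule eq_matI) (auto simp: tomat_index entry_mult_fid entry_fid_mult)

lemma emb_inject: "A \<in> carrier_mat n m \<Longrightarrow> B \<in> carrier_mat n m \<Longrightarrow> emb A = emb B \<Longrightarrow> A = B"
  by (metis tomat_emb)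

lemma emb_diff: "A \<in> carrier_mat n m \<Longrightarrow> B \<in> carrier_mat n m \<Longrightarrow> emb (A - B) = emb A - emb B"
  by (rule fmat_eqI) (auto simp: entry_emb)

lemma emb_transpose: "emb (A\<^sup>T) = ftrans (emb A)"
  by (rule fmat_eqI) (auto simp: entry_emb)

lemma emb_one: "emb (1\<^sub>m n) = fid n"
  by (rule fmat_eqI) (auto simp: entry_emb entry_fid)

lemma emb_mult:
  assumes "A \<in> carrier_mat n k" "B \<in> carrier_mat k m"
  shows "emb (A * B) = emb A * emb B"
proof (rule fmat_eqI)
  fix i j
  show "entry (emb (A * B)) i j = entry (emb A * emb B) i j"
    unfolding entry_mult_right[OF supp_emb[OF assms(1)]]
    using assms by (auto simp: entry_emb scalar_prod_def atLeast0LessThan intro!: sum.cong)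
qed

lemma mat_inner_emb:
  assumes "A \<in> carrier_mat n m" "B \<in> carrier_mat n m"
  shows "mat_inner A B = inner (emb A) (emb B)"
proof -
  have d: "dim_row A = n" "dim_col A = m" "dim_row B = n" "dim_col B = m" using assms by blast+
  show ?thesis
    unfolding inner_fmat_supp[OF supp_emb[OF assms(1)]] mat_inner_def entry_emb d
    by (intro sum.cong refl) simp
qed

lemma frob_norm_emb: "frob_norm A = norm (emb A)"
  unfolding frob_norm_def norm_eq_sqrt_inner
  by (subst mat_inner_emb[OF carrier_mat_triv carrier_mat_triv]) (rule refl)

lemma emb_append_rows:
  assumes "A \<in> carrier_mat n l" "B \<in> carrier_mat m l"
  shows "emb (A @\<^sub>r B) = fstack n m (emb A) (emb B)"
proof (rule fmat_eqI)
  fix i j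
  show "entry (emb (A @\<^sub>r B)) i j = entry (fstack n m (emb A) (emb B)) i j"
    using assms by (auto simp: append_rows_def entry_emb fstack_def entry_fshift_mult)
qed

lemma emb_upper_rows:
  "emb (upper_rows n (tomat (n + m) l x)) = fid n * x * fid l"
  by (rule fmat_eqI) (simp add: upper_rows_def entry_emb tomat_index entry_mult_fid entry_fid_mult)

lemma emb_lower_rows:
  "emb (lower_rows n (tomat (n + m) l x)) = ftrans (fshift n m) * x * fid l"
  by (rule fmat_eqI) (simp add: lower_rows_def entry_emb tomat_index entry_mult_fid
      entry_ftrans_fshift_mult)

section \<open>Gradients and second derivatives\<close>

lemma inner_proj_right:
  assumes "supp n m y"
  shows "inner y (fid n * x * fid m) = inner y x"
proof -
  have "inner (fid n * x * fid m) y = inner x (fid n * y * fid m)"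
    by (subst inner_mult_right, subst inner_mult_left) (simp add: mult.assoc)
  then show ?thesis using assms unfolding fid_eq_supp[symmetric] by (simp add: inner_commute)
qed

lemma norm_proj_le: "norm (fid n * x * fid m) \<le> norm x"
proof -
  define y where "y = fid n * x * fid m"
  have "supp n m y"
    unfolding y_def by (rule supp_mult[OF supp_mult[OF supp_fid supp_fsize] supp_fid])
  then have "inner y y = inner y x"
    using inner_proj_right[of n m y x] by (simp add: y_def)
  then have "norm y * norm y \<le> norm y * norm x"
    using norm_cauchy_schwarz[of y x] by (simp add: dot_square_norm power2_eq_square)
  then show ?thesis unfolding y_def[symmetric] by (cases "norm y = 0") auto
qed

lemma eventually_mat_nhds:
  assumes "X \<in> carrier_mat n m"
  shows "eventually P (mat_nhds X) \<longleftrightarrow>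
    (\<exists>d>0. \<forall>Y\<in>carrier_mat n m. norm (emb Y - emb X) < d \<longrightarrow> P Y)"
proof -
  have *: "frob_norm (Y - X) = norm (emb Y - emb X)" if "Y \<in> carrier_mat n m" for Y
    by (simp add: frob_norm_emb emb_diff[OF that assms])
  have "eventually P (mat_nhds X) \<longleftrightarrow>
      (\<exists>d>0. \<forall>Y. dist (frob_norm (Y - X)) 0 < d \<longrightarrow> Y \<in> carrier_mat n m \<longrightarrow> P Y)"
    using assms unfolding mat_nhds_def eventually_inf_principal
    by (auto simp: eventually_filtercomap eventually_nhds_metric)
  also have "\<dots> \<longleftrightarrow> (\<exists>d>0. \<forall>Y\<in>carrier_mat n m. norm (emb Y - emb X) < d \<longrightarrow> P Y)"
    using * by (intro ex_cong1) auto
  finally show ?thesis .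
qed

text \<open>Composition with \<open>tomat\<close> extends a function from the carrier to all of
  \<open>fmat\<close>, ignoring entries outside the format. Truncation does not increase the norm
  and \<open>emb G\<close> does not see those entries, so remainder estimates transfer both
  ways.\<close>

lemma has_gradient_iff:
  assumes X: "X \<in> carrier_mat n m"
  shows "has_gradient q X G \<longleftrightarrow> G \<in> carrier_mat n m \<and>
    ((\<lambda>y. q (tomat n m y)) has_derivative inner (emb G)) (at (emb X))"
proof (cases "G \<in> carrier_mat n m")
  case G: True
  define x where "x = emb X"
  have x: "supp n m x" "tomat n m x = X" using X by (simp_all add: x_def supp_emb tomat_emb)
  define r where "r Y = q Y - q X - inner (emb G) (emb Y - x)" for Y
  have "has_gradient q X G \<longleftrightarrow> ((\<lambda>Y. r Y / norm (emb Y - x)) \<longlongrightarrow> 0) (mat_nhds X)"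
  proof -
    have "eventually (\<lambda>Y. (q Y - q X - mat_inner G (Y - X)) / frob_norm (Y - X) = r Y / norm (emb Y - x)) (mat_nhds X)"
      unfolding eventually_mat_nhds[OF X] r_def x_def
      using X G by (intro exI[of _ 1]) (auto simp: frob_norm_emb emb_diff[OF _ X] mat_inner_emb[OF G minus_carrier_mat[OF X]])
    from tendsto_cong[OF this] show ?thesis unfolding has_gradient_def using X G by simp
  qed
  also have "\<dots> \<longleftrightarrow> (\<forall>e>0. \<exists>d>0. \<forall>Y\<in>carrier_mat n m. norm (emb Y - x) < d \<longrightarrow> \<bar>r Y / norm (emb Y - x)\<bar> < e)"
    unfolding tendsto_iff eventually_mat_nhds[OF X] x_def by simp
  also have "\<dots> \<longleftrightarrow> (\<forall>e>0. \<exists>d>0. \<forall>y. norm (y - x) < d \<longrightarrow> \<bar>q (tomat n m y) - q X - inner (emb G) (y - x)\<bar> \<le> e * norm (y - x))"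
    (is "?L \<longleftrightarrow> ?R")
  proof
    assume L: ?L
    show ?R
    proof (intro allI impI)
      fix e :: real assume "e > 0"
      with L obtain d where d: "d > 0"
        "\<And>Y. Y \<in> carrier_mat n m \<Longrightarrow> norm (emb Y - x) < d \<Longrightarrow> \<bar>r Y / norm (emb Y - x)\<bar> < e"
        by blast
      have "\<bar>q (tomat n m y) - q X - inner (emb G) (y - x)\<bar> \<le> e * norm (y - x)" if y: "norm (y - x) < d" for y
      proof -
        have eq: "emb (tomat n m y) - x = fid n * (y - x) * fid m"
          using x(1) unfolding fid_eq_supp[symmetric] by (simp add: emb_tomat_proj algebra_simps)
        have le: "norm (emb (tomat n m y) - x) \<le> norm (y - x)" unfolding eq by (rule norm_proj_le)
        have rY: "q (tomat n m y) - q X - inner (emb G) (y - x) = r (tomat n m y)"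
          unfolding r_def eq inner_proj_right[OF supp_emb[OF G]] ..
        have "\<bar>r (tomat n m y)\<bar> \<le> e * norm (emb (tomat n m y) - x)"
        proof (cases "emb (tomat n m y) - x = 0")
          case True
          then have "tomat n m y = X" using x by (metis eq_iff_diff_eq_0 tomat_emb tomat_carrier)
          then show ?thesis by (simp add: r_def x_def)
        next
          case False
          then show ?thesis
            using d(2)[OF tomat_carrier, of y] le y by (simp add: abs_divide divide_less_eq)
        qed
        also have "\<dots> \<le> e * norm (y - x)" using le \<open>e > 0\<close> by simp
        finally show ?thesis unfolding rY .
      qed
      then show "\<exists>d>0. \<forall>y. norm (y - x) < d \<longrightarrow> \<bar>q (tomat n m y) - q X - inner (emb G) (y - x)\<bar> \<le> e * norm (y - x)"
        using d(1) by blast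
    qed
  next
    assume R: ?R
    show ?L
    proof (intro allI impI)
      fix e :: real assume "e > 0"
      \<comment> \<open>The limit asks for a strict bound, the derivative for a weak one.\<close>
      then have "e / 2 > 0" by simp
      with R obtain d where d: "d > 0"
        "\<And>y. norm (y - x) < d \<Longrightarrow> \<bar>q (tomat n m y) - q X - inner (emb G) (y - x)\<bar> \<le> e / 2 * norm (y - x)"
        by blast
      have "\<bar>r Y / norm (emb Y - x)\<bar> < e" if Y: "Y \<in> carrier_mat n m" "norm (emb Y - x) < d" for Y
      proof (cases "emb Y - x = 0")
        case False
        have "\<bar>r Y\<bar> \<le> e / 2 * norm (emb Y - x)"
          using d(2)[OF Y(2)] unfolding r_def tomat_emb[OF Y(1)] .
        also have "\<dots> < e * norm (emb Y - x)" using False \<open>e > 0\<close> by simp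
        finally show ?thesis using False by (simp add: abs_divide divide_less_eq)
      qed (use \<open>e > 0\<close> in simp)
      then show "\<exists>d>0. \<forall>Y\<in>carrier_mat n m. norm (emb Y - x) < d \<longrightarrow> \<bar>r Y / norm (emb Y - x)\<bar> < e"
        using d(1) by blast
    qed
  qed
  also have "\<dots> \<longleftrightarrow> ((\<lambda>y. q (tomat n m y)) has_derivative inner (emb G)) (at x)"
    unfolding has_derivative_within_alt x(2) by (simp add: bounded_linear_inner_right)
  finally show ?thesis using G by (simp add: x_def)
next
  case False
  then show ?thesis using X by (auto simp: has_gradient_def)
qed

lemma has_gradient_unique:
  assumes "X \<in> carrier_mat n m" "has_gradient q X G" "has_gradient q X H"
  shows "G = H"
proof -
  have "inner (emb G) = inner (emb H)"
    using assms has_gradient_iff[OF assms(1)] has_derivative_unique by blast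
  then have "inner (emb G) (emb G - emb H) - inner (emb H) (emb G - emb H) = 0" by simp
  then have "emb G = emb H" by (simp flip: inner_diff_left)
  then show ?thesis using assms has_gradient_iff[OF assms(1)] emb_inject by blast
qed

lemma grad_eqI:
  assumes "X \<in> carrier_mat n m" "has_gradient q X G"
  shows "grad q X = G"
  unfolding grad_def using assms has_gradient_unique by (intro the_equality) blast+

lemma grad_eq_tomat:
  assumes "X \<in> carrier_mat n m" "supp n m G"
    "((\<lambda>y. q (tomat n m y)) has_derivative inner G) (at (emb X))"
  shows "grad q X = tomat n m G"
  using assms by (intro grad_eqI[OF assms(1)]) (simp add: has_gradient_iff[OF assms(1)] emb_tomat)

lemma bounded_linear_proj: "bounded_linear (\<lambda>x. a * x * b :: fmat)"
  by (intro bounded_linear_compose[OF bounded_linear_mult_left bounded_linear_mult_right])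

text \<open>Reduces the entrywise \<open>hess\<close> to the Frechet derivative of any extension
  \<open>\<Gamma>\<close> of the gradient. It serves both f and the stacked objective.\<close>

lemma hess_eq:
  assumes \<Gamma>: "\<And>x. supp n m x \<Longrightarrow> ((\<lambda>y. q (tomat n m y)) has_derivative inner (\<Gamma> x)) (at x)"
      "\<And>x. supp n m (\<Gamma> x)"
    and \<Gamma>': "(\<Gamma> has_derivative \<Gamma>') (at (emb X))"
    and X: "X \<in> carrier_mat n m" and H: "H \<in> carrier_mat n m" and K: "K \<in> carrier_mat n m"
  shows "hess q X H K = inner (\<Gamma>' (emb H)) (emb K)"
proof -
  have grad: "grad q Y = tomat n m (\<Gamma> (emb Y))" if "Y \<in> carrier_mat n m" for Y
    by (rule grad_eq_tomat[OF that \<Gamma>(2) \<Gamma>(1)[OF supp_emb[OF that]]])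
  have lin: "linear \<Gamma>'" using \<Gamma>' by (rule has_derivative_linear)
  have "mat_inner (grad (grad_entry q i j) X) H = entry (\<Gamma>' (emb H)) i j" if ij: "i < n" "j < m" for i j
  proof -
    \<comment> \<open>The Riesz representative of the functional sending \<open>y\<close> to entry
      \<open>(i, j)\<close> of the derivative at the truncation of \<open>y\<close>.\<close>
    define G where "G = (\<Sum>k<n. \<Sum>l<m. entry (\<Gamma>' (funit k l)) i j *\<^sub>R funit k l)"
    have sG: "supp n m G"
      unfolding G_def supp_iff entry_sum_funit by auto
    have G: "inner G y = entry (\<Gamma>' (fid n * y * fid m)) i j" for y
    proof -
      have "fid n * y * fid m = (\<Sum>k<n. \<Sum>l<m. entry y k l *\<^sub>R funit k l)"
        by (rule fmat_eqI) (simp only: entry_sum_funit entry_mult_fid entry_fid_mult, simp)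
      then have "entry (\<Gamma>' (fid n * y * fid m)) i j = (\<Sum>k<n. \<Sum>l<m. entry y k l * entry (\<Gamma>' (funit k l)) i j)"
        by (simp add: linear_sum[OF lin] linear_scale[OF lin])
      also have "\<dots> = inner G y"
        unfolding G_def by (simp add: inner_sum_left inner_funit_left mult.commute)
      finally show ?thesis ..
    qed
    have "((\<lambda>y. entry (\<Gamma> (fid n * y * fid m)) i j) has_derivative inner G) (at (emb X))"
    proof -
      have eX: "fid n * emb X * fid m = emb X"
        using supp_emb[OF X] unfolding fid_eq_supp[symmetric] .
      have "((\<lambda>y. \<Gamma> (fid n * y * fid m)) has_derivative (\<lambda>y. \<Gamma>' (fid n * y * fid m))) (at (emb X))"
        by (rule has_derivative_compose[where g = \<Gamma>, OF bounded_linear.has_derivative[OF bounded_linear_proj has_derivative_ident]])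
          (simp add: eX \<Gamma>')
      from has_derivative_inner_right[OF this, of "funit i j"]
      show ?thesis unfolding inner_funit_left G[symmetric] .
    qed
    moreover have "grad_entry q i j (tomat n m y) = entry (\<Gamma> (fid n * y * fid m)) i j" for y
      unfolding grad_entry_def grad[OF tomat_carrier] emb_tomat_proj using ij by (simp add: tomat_index)
    ultimately have "grad (grad_entry q i j) X = tomat n m G"
      by (intro grad_eq_tomat[OF X sG]) simp
    then have "mat_inner (grad (grad_entry q i j) X) H = inner G (emb H)"
      by (simp add: mat_inner_emb[OF tomat_carrier H] emb_tomat[OF sG])
    then show ?thesis
      using supp_emb[OF H] unfolding G fid_eq_supp[symmetric] by simp
  qed
  then have "hess q X H K = (\<Sum>i<n. \<Sum>j<m. entry (\<Gamma>' (emb H)) i j * K $$ (i, j))"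
    using X by (simp add: hess_def mat_inner_def)
  also have "\<dots> = inner (emb K) (\<Gamma>' (emb H))"
    using K by (simp add: inner_fmat_supp[OF supp_emb[OF K]] entry_emb mult.commute)
  finally show ?thesis by (simp add: inner_commute)
qed

section \<open>Symmetric second derivatives and the extended derivatives of f\<close>

text \<open>The second difference of \<open>F\<close> over a small parallelogram does not depend on
  the order of its sides. Applying the mean value theorem twice in each order gives the two mixed
  values at nearby points; continuity of these scalar evaluations finishes.\<close>

lemma second_derivative_symmetric:
  fixes F :: "'a::real_inner \<Rightarrow> real"
  assumes F: "\<And>x. (F has_derivative inner (g x)) (at x)"
    and g: "\<And>x. (g has_derivative h x) (at x)"
    and cont: "\<And>a b. isCont (\<lambda>x. inner (h x a) b) x"
  shows "inner (h x a) b = inner (h x b) a"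
proof -
  define c where "c = norm a + norm b"
  have square: "\<exists>y z. y \<in> {0<..<s} \<and> z \<in> {0<..<s} \<and>
      F (x + s *\<^sub>R a + s *\<^sub>R b) - F (x + s *\<^sub>R a) - F (x + s *\<^sub>R b) + F x
        = s * s * inner (h (x + y *\<^sub>R a + z *\<^sub>R b) b) a" if s: "s > 0" for s a b
  proof -
    define \<psi> where "\<psi> t = F (x + t *\<^sub>R a + s *\<^sub>R b) - F (x + t *\<^sub>R a)" for t
    have d: "(\<psi> has_derivative (\<lambda>u. inner (g (x + t *\<^sub>R a + s *\<^sub>R b)) (u *\<^sub>R a) - inner (g (x + t *\<^sub>R a)) (u *\<^sub>R a))) (at t)" for t
      unfolding \<psi>_def
      by (intro has_derivative_diff has_derivative_compose[OF _ F] derivative_eq_intros) auto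
    have "\<exists>y\<in>{0<..<s}. \<psi> s - \<psi> 0 = inner (g (x + y *\<^sub>R a + s *\<^sub>R b)) ((s - 0) *\<^sub>R a) - inner (g (x + y *\<^sub>R a)) ((s - 0) *\<^sub>R a)"
    proof (rule mvt[OF s])
      show "continuous_on {0..s} \<psi>"
        using d by (meson continuous_at_imp_continuous_on has_derivative_continuous)
    qed (use d in auto)
    then obtain y where y: "y \<in> {0<..<s}"
      "\<psi> s - \<psi> 0 = s * (inner (g (x + y *\<^sub>R a + s *\<^sub>R b)) a - inner (g (x + y *\<^sub>R a)) a)"
      by (auto simp: algebra_simps)
    define \<theta> where "\<theta> t = inner (g (x + y *\<^sub>R a + t *\<^sub>R b)) a" for t
    have d': "(\<theta> has_derivative (\<lambda>u. inner (h (x + y *\<^sub>R a + t *\<^sub>R b) (u *\<^sub>R b)) a)) (at t)" for t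
      unfolding \<theta>_def
      by (intro has_derivative_inner_left has_derivative_compose[OF _ g] derivative_eq_intros) auto
    have "\<exists>z\<in>{0<..<s}. \<theta> s - \<theta> 0 = inner (h (x + y *\<^sub>R a + z *\<^sub>R b) ((s - 0) *\<^sub>R b)) a"
    proof (rule mvt[OF s])
      show "continuous_on {0..s} \<theta>"
        using d' by (meson continuous_at_imp_continuous_on has_derivative_continuous)
    qed (use d' in auto)
    then obtain z where z: "z \<in> {0<..<s}" "\<theta> s - \<theta> 0 = inner (h (x + y *\<^sub>R a + z *\<^sub>R b) (s *\<^sub>R b)) a"
      by auto
    have "\<psi> s - \<psi> 0 = s * (s * inner (h (x + y *\<^sub>R a + z *\<^sub>R b) b) a)"
      using y(2) z(2) linear_scale[OF has_derivative_linear[OF g]] by (simp add: \<theta>_def)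
    then show ?thesis using y(1) z(1)
      by (intro exI[of _ y] exI[of _ z]) (simp add: \<psi>_def mult.assoc)
  qed
  show ?thesis
  proof (rule ccontr)
    assume ne: "inner (h x a) b \<noteq> inner (h x b) a"
    define e where "e = \<bar>inner (h x a) b - inner (h x b) a\<bar> / 2"
    have "e > 0" using ne by (simp add: e_def)
    obtain d1 where d1: "d1 > 0" "\<And>y. dist y x < d1 \<Longrightarrow> dist (inner (h y a) b) (inner (h x a) b) < e"
      using cont[of a b] \<open>e > 0\<close> unfolding continuous_at_eps_delta by blast
    obtain d2 where d2: "d2 > 0" "\<And>y. dist y x < d2 \<Longrightarrow> dist (inner (h y b) a) (inner (h x b) a) < e"
      using cont[of b a] \<open>e > 0\<close> unfolding continuous_at_eps_delta by blast
    \<comment> \<open>Points of the parallelogram are within \<open>s * c\<close> of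
      \<open>x\<close>; the summand 1 avoids division by zero and makes the inequality
      strict.\<close>
    define s where "s = min d1 d2 / (c + 1)"
    have c: "c \<ge> 0" by (simp add: c_def)
    have s: "s > 0" using d1 d2 c by (simp add: s_def)
    have sc: "s * c < d1" "s * c < d2"
    proof -
      have "s * c < s * (c + 1)" using s by simp
      also have "\<dots> = min d1 d2" using c by (simp add: s_def)
      finally show "s * c < d1" "s * c < d2" by simp_all
    qed
    have dist: "dist (x + y *\<^sub>R a + z *\<^sub>R b) x \<le> s * c" if "y \<in> {0<..<s}" "z \<in> {0<..<s}" for y z
    proof -
      have "dist (x + y *\<^sub>R a + z *\<^sub>R b) x \<le> norm (y *\<^sub>R a) + norm (z *\<^sub>R b)"
        by (simp add: dist_norm add.assoc) (metis norm_scaleR norm_triangle_ineq)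
      also have "\<dots> \<le> s * norm a + s * norm b"
        using that by (auto intro!: add_mono mult_right_mono)
      finally show ?thesis by (simp add: c_def distrib_left)
    qed
    obtain y z where yz: "y \<in> {0<..<s}" "z \<in> {0<..<s}"
      "F (x + s *\<^sub>R a + s *\<^sub>R b) - F (x + s *\<^sub>R a) - F (x + s *\<^sub>R b) + F x
        = s * s * inner (h (x + y *\<^sub>R a + z *\<^sub>R b) b) a"
      using square[OF s, of a b] by blast
    obtain y' z' where yz': "y' \<in> {0<..<s}" "z' \<in> {0<..<s}"
      "F (x + s *\<^sub>R b + s *\<^sub>R a) - F (x + s *\<^sub>R b) - F (x + s *\<^sub>R a) + F x
        = s * s * inner (h (x + y' *\<^sub>R b + z' *\<^sub>R a) a) b"
      using square[OF s, of b a] by blast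
    have swap: "x + p *\<^sub>R b + q *\<^sub>R a = x + q *\<^sub>R a + p *\<^sub>R b" for p q
      by (simp add: add.assoc add.commute[of "p *\<^sub>R b"])
    have "s * s * inner (h (x + y *\<^sub>R a + z *\<^sub>R b) b) a = s * s * inner (h (x + z' *\<^sub>R a + y' *\<^sub>R b) a) b"
      using yz(3) yz'(3) unfolding swap by linarith
    then have "inner (h (x + y *\<^sub>R a + z *\<^sub>R b) b) a = inner (h (x + z' *\<^sub>R a + y' *\<^sub>R b) a) b"
      using s by simp
    moreover have "dist (inner (h (x + y *\<^sub>R a + z *\<^sub>R b) b) a) (inner (h x b) a) < e"
      using dist[OF yz(1,2)] sc by (intro d2) simp
    moreover have "dist (inner (h (x + z' *\<^sub>R a + y' *\<^sub>R b) a) b) (inner (h x a) b) < e"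
      using dist[OF yz'(2,1)] sc by (intro d1) simp
    ultimately show False unfolding e_def dist_real_def by argo
  qed
qed

lemma has_derivative_extend:
  assumes "\<And>X. X \<in> carrier_mat n m \<Longrightarrow> \<exists>G. has_gradient q X G"
  shows "((\<lambda>y. q (tomat n m y)) has_derivative inner (emb (grad q (tomat n m x)))) (at x)"
    "grad q (tomat n m x) \<in> carrier_mat n m"
proof -
  define X where "X = tomat n m x"
  have X: "X \<in> carrier_mat n m" by (simp add: X_def)
  have hg: "has_gradient q X (grad q X)" using assms[OF X] grad_eqI[OF X] by blast
  then have G: "grad q X \<in> carrier_mat n m" and
    d: "((\<lambda>y. q (tomat n m y)) has_derivative inner (emb (grad q X))) (at (emb X))"
    unfolding has_gradient_iff[OF X] by blast+
  have "((\<lambda>y. q (tomat n m (fid n * y * fid m))) has_derivative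
      (\<lambda>y. inner (emb (grad q X)) (fid n * y * fid m))) (at x)"
    by (rule has_derivative_compose[where g = "\<lambda>y. q (tomat n m y)", OF
        bounded_linear.has_derivative[OF bounded_linear_proj has_derivative_ident]])
      (use d in \<open>simp add: X_def emb_tomat_proj\<close>)
  then show "((\<lambda>y. q (tomat n m y)) has_derivative inner (emb (grad q (tomat n m x)))) (at x)"
    unfolding tomat_proj inner_proj_right[OF supp_emb[OF G]] unfolding X_def .
  show "grad q (tomat n m x) \<in> carrier_mat n m" using G unfolding X_def .
qed

lemma isCont_tomat:
  assumes "(q \<longlongrightarrow> q (tomat n m x)) (mat_nhds (tomat n m x))"
  shows "isCont (\<lambda>y. q (tomat n m y) :: real) x"
  unfolding continuous_at_eps_delta
proof (intro allI impI)
  fix e :: real assume "e > 0"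
  with assms have "eventually (\<lambda>Y. dist (q Y) (q (tomat n m x)) < e) (mat_nhds (tomat n m x))"
    by (rule tendstoD)
  then obtain d where d: "d > 0" "\<And>Y. Y \<in> carrier_mat n m \<Longrightarrow>
      norm (emb Y - emb (tomat n m x)) < d \<Longrightarrow> dist (q Y) (q (tomat n m x)) < e"
    unfolding eventually_mat_nhds[OF tomat_carrier] by blast
  have "norm (emb (tomat n m y) - emb (tomat n m x)) \<le> dist y x" for y
    using norm_proj_le[of n "y - x" m] by (simp add: emb_tomat_proj dist_norm algebra_simps)
  then show "\<exists>d>0. \<forall>y. dist y x < d \<longrightarrow> dist (q (tomat n m y)) (q (tomat n m x)) < e"
    using d by (meson le_less_trans tomat_carrier)
qed

text \<open>The gradient is a finite sum of the scalar functions \<open>grad_entry f i j\<close>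
  times matrix units, so their gradients \<open>D i j\<close> assemble into \<open>h\<close>;
  continuity of the second partials yields its symmetry.\<close>

lemma twice_cont_diff_derivatives:
  assumes "twice_cont_diff n m f"
  obtains g h where
    "\<And>x. supp n m (g x)"
    "\<And>x. ((\<lambda>y. f (tomat n m y)) has_derivative inner (g x)) (at x)"
    "\<And>x. (g has_derivative h x) (at x)"
    "\<And>x a b. inner (h x a) b = inner (h x b) a"
    "\<And>X. X \<in> carrier_mat n m \<Longrightarrow> emb (grad f X) = g (emb X)"
proof -
  have gr: "\<exists>G. has_gradient f X G" if "X \<in> carrier_mat n m" for X
    using assms that by (simp add: twice_cont_diff_def)
  have gre: "\<exists>G. has_gradient (grad_entry f i j) X G" if "i < n" "j < m" "X \<in> carrier_mat n m" for i j X
    using assms that by (simp add: twice_cont_diff_def)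
  define g where "g x = emb (grad f (tomat n m x))" for x
  define D where "D i j x = emb (grad (grad_entry f i j) (tomat n m x))" for i j x
  define h where "h x a = (\<Sum>i<n. \<Sum>j<m. inner (D i j x) a *\<^sub>R funit i j)" for x a
  have sg: "supp n m (g x)" for x
    unfolding g_def by (rule supp_emb[OF has_derivative_extend(2)]) (rule gr)
  have dF: "((\<lambda>y. f (tomat n m y)) has_derivative inner (g x)) (at x)" for x
    unfolding g_def by (rule has_derivative_extend(1)) (rule gr)
  have sD: "supp n m (D i j x)" if "i < n" "j < m" for i j x
    unfolding D_def by (rule supp_emb[OF has_derivative_extend(2)]) (rule gre[OF that])
  have dD: "((\<lambda>y. grad_entry f i j (tomat n m y)) has_derivative inner (D i j x)) (at x)"
    if "i < n" "j < m" for i j x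
    unfolding D_def by (rule has_derivative_extend(1)) (rule gre[OF that])
  have ge: "entry (g y) i j = grad_entry f i j (tomat n m y)" if "i < n" "j < m" for y i j
  proof -
    have "grad f (tomat n m y) \<in> carrier_mat n m" by (rule has_derivative_extend(2)) (rule gr)
    then show ?thesis using that by (simp add: g_def entry_emb grad_entry_def)
  qed
  have gsum: "g = (\<lambda>y. \<Sum>i<n. \<Sum>j<m. grad_entry f i j (tomat n m y) *\<^sub>R funit i j)"
  proof
    fix y
    show "g y = (\<Sum>i<n. \<Sum>j<m. grad_entry f i j (tomat n m y) *\<^sub>R funit i j)"
      by (subst fmat_sum_funit[OF sg]) (simp add: ge)
  qed
  have dg: "(g has_derivative h x) (at x)" for x
    unfolding gsum h_def
    by (intro has_derivative_sum has_derivative_scaleR_left dD) auto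
  have cont: "isCont (\<lambda>x. inner (h x a) b) x" for x a b
  proof -
    have e: "entry (D i j y) k l = grad_entry (grad_entry f i j) k l (tomat n m y)"
      if "i < n" "j < m" "k < n" "l < m" for i j k l y
    proof -
      have "grad (grad_entry f i j) (tomat n m y) \<in> carrier_mat n m"
        by (rule has_derivative_extend(2)) (rule gre[OF that(1,2)])
      then show ?thesis using that(3,4) by (simp add: D_def entry_emb grad_entry_def[of "grad_entry f i j"])
    qed
    have "inner (h y a) b = (\<Sum>i<n. \<Sum>j<m. (\<Sum>k<n. \<Sum>l<m.
        grad_entry (grad_entry f i j) k l (tomat n m y) * entry a k l) * entry b i j)" for y
      unfolding h_def inner_sum_left
      by (intro sum.cong refl) (simp add: inner_funit_left inner_fmat_supp[OF sD] e)
    moreover have "isCont (\<lambda>y. grad_entry (grad_entry f i j) k l (tomat n m y)) x"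
      if "i < n" "j < m" "k < n" "l < m" for i j k l
      by (rule isCont_tomat) (use assms that in \<open>simp add: twice_cont_diff_def\<close>)
    ultimately show ?thesis by (simp add: continuous_intros)
  qed
  show ?thesis
  proof (rule that[OF sg dF dg])
    show "inner (h x a) b = inner (h x b) a" for x a b
      by (rule second_derivative_symmetric[OF dF dg cont])
    show "emb (grad f X) = g (emb X)" if "X \<in> carrier_mat n m" for X
      by (simp add: g_def tomat_emb[OF that])
  qed
qed

lemma hess_eq_derivative:
  assumes "\<And>x. supp n m (g x)"
    "\<And>x. ((\<lambda>y. f (tomat n m y)) has_derivative inner (g x)) (at x)"
    "\<And>x. (g has_derivative h x) (at x)"
    "X \<in> carrier_mat n m" "H \<in> carrier_mat n m" "K \<in> carrier_mat n m"
  shows "hess f X H K = inner (h (emb X) (emb H)) (emb K)"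
  by (rule hess_eq[where \<Gamma> = g]) (use assms in auto)

lemma inner_proj_left: "inner (fid n * x * fid m) y = inner x (fid n * y * fid m)"
  by (subst inner_mult_right, subst inner_mult_left) (simp add: mult.assoc)

text \<open>\<open>P\<close> and \<open>L\<close> extract the two blocks of a stack and are linear
  on the whole type, so the chain rule for \<open>P W * ftrans (L W)\<close> applies without side
  conditions on formats.\<close>

lemma Phi_stacked_second_order:
  assumes g: "\<And>x. supp n m (g x)"
    "\<And>x. ((\<lambda>y. f (tomat n m y)) has_derivative inner (g x)) (at x)"
    "\<And>x. (g has_derivative h x) (at x)"
    and UV: "U \<in> carrier_mat n r" "V \<in> carrier_mat m r"
  defines "u \<equiv> emb U" and "v \<equiv> emb V"
  shows "critical_point f lam U V \<Longrightarrow>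
      g (u * ftrans v) * v + lam *\<^sub>R u = 0 \<and> ftrans (g (u * ftrans v)) * u + lam *\<^sub>R v = 0"
    "hess_Phi_psd f lam U V \<Longrightarrow> supp n r a \<Longrightarrow> supp m r b \<Longrightarrow>
      0 \<le> inner (h (u * ftrans v) (a * ftrans v + u * ftrans b)) (a * ftrans v + u * ftrans b)
        + 2 * inner (g (u * ftrans v)) (a * ftrans b) + lam * ((norm a)\<^sup>2 + (norm b)\<^sup>2)"
proof -
  define J where "J = fshift n m"
  define P where "P W = fid n * W * fid r" for W
  define L where "L W = ftrans J * W * fid r" for W
  define X where "X W = P W * ftrans (L W)" for W
  define q where "q = Phi_stacked n f lam"
  \<comment> \<open>The partial gradients in the two blocks, put back into the stack by the adjoints
    of \<open>P\<close> and \<open>L\<close>.\<close>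
  define \<Gamma> where "\<Gamma> W = fid n * (g (X W) * L W + lam *\<^sub>R P W) * fid r
    + J * (ftrans (g (X W)) * P W + lam *\<^sub>R L W) * fid r" for W
  define \<Gamma>' where "\<Gamma>' W H = (let d = P W * ftrans (L H) + P H * ftrans (L W) in
    fid n * (g (X W) * L H + h (X W) d * L W + lam *\<^sub>R P H) * fid r
    + J * (ftrans (g (X W)) * P H + ftrans (h (X W) d) * P W + lam *\<^sub>R L H) * fid r)" for W H
  have dP: "(P has_derivative P) (at W)" for W
    unfolding P_def by (rule bounded_linear.has_derivative[OF bounded_linear_proj has_derivative_ident])
  have dL: "(L has_derivative L) (at W)" for W
    unfolding L_def by (rule bounded_linear.has_derivative[OF bounded_linear_proj has_derivative_ident])
  have dT: "((\<lambda>W. ftrans (k W)) has_derivative (\<lambda>H. ftrans (k' H))) F" if "(k has_derivative k') F" for k k' F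
    by (rule bounded_linear.has_derivative[OF bounded_linear_ftrans that])
  have dX: "(X has_derivative (\<lambda>H. P W * ftrans (L H) + P H * ftrans (L W))) (at W)" for W
    unfolding X_def by (intro has_derivative_mult dP dT dL)
  have dgX: "((\<lambda>W. g (X W)) has_derivative (\<lambda>H. h (X W) (P W * ftrans (L H) + P H * ftrans (L W)))) (at W)" for W
    by (rule has_derivative_compose[OF dX g(3)])
  have iP: "inner (fid n * y * fid r) H = inner y (P H)" for y H
    unfolding P_def by (rule inner_proj_left)
  have iL: "inner (J * y * fid r) H = inner y (L H)" for y H
    unfolding L_def by (subst inner_mult_right, subst inner_mult_left) (simp add: mult.assoc)
  have q: "q (tomat (n + m) r W) = f (tomat n m (X W)) + lam / 2 * (inner (P W) (P W) + inner (L W) (L W))" for W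
  proof -
    define A where "A = upper_rows n (tomat (n + m) r W)"
    define B where "B = lower_rows n (tomat (n + m) r W)"
    have AB: "A \<in> carrier_mat n r" "B \<in> carrier_mat m r"
      unfolding A_def B_def upper_rows_def lower_rows_def carrier_mat_def by simp_all
    have e: "emb A = P W" "emb B = L W"
      unfolding A_def B_def P_def L_def J_def by (rule emb_upper_rows, rule emb_lower_rows)
    have "A * B\<^sup>T \<in> carrier_mat n m" using AB by simp
    then have "A * B\<^sup>T = tomat n m (X W)"
      using tomat_emb[of "A * B\<^sup>T" n m] emb_mult[OF AB(1), of "B\<^sup>T" m] AB
      by (simp add: X_def e emb_transpose)
    then show ?thesis
      unfolding q_def Phi_stacked_def Phi_def A_def[symmetric] B_def[symmetric]
      by (simp add: frob_norm_emb e power2_norm_eq_inner)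
  qed
  have dq: "((\<lambda>W. q (tomat (n + m) r W)) has_derivative inner (\<Gamma> W)) (at W)" for W
  proof -
    have "((\<lambda>W. q (tomat (n + m) r W)) has_derivative (\<lambda>H.
        inner (g (X W)) (P W * ftrans (L H) + P H * ftrans (L W))
        + lam / 2 * ((inner (P W) (P H) + inner (P H) (P W)) + (inner (L W) (L H) + inner (L H) (L W))))) (at W)"
      unfolding q
      by (intro has_derivative_add has_derivative_mult_right has_derivative_inner dP dL
          has_derivative_compose[OF dX g(2)])
    also have "(\<lambda>H. inner (g (X W)) (P W * ftrans (L H) + P H * ftrans (L W))
        + lam / 2 * ((inner (P W) (P H) + inner (P H) (P W)) + (inner (L W) (L H) + inner (L H) (L W)))) = inner (\<Gamma> W)"
    proof
      fix H
      have "inner (g (X W) * L W) (P H) = inner (g (X W)) (P H * ftrans (L W))"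
        by (rule inner_mult_right)
      moreover have "inner (ftrans (g (X W)) * P W) (L H) = inner (g (X W)) (P W * ftrans (L H))"
        by (subst inner_mult_left, subst inner_commute) (simp add: inner_mult_right)
      ultimately show "inner (g (X W)) (P W * ftrans (L H) + P H * ftrans (L W))
        + lam / 2 * ((inner (P W) (P H) + inner (P H) (P W)) + (inner (L W) (L H) + inner (L H) (L W))) = inner (\<Gamma> W) H"
        unfolding \<Gamma>_def inner_add_left iP iL
        by (simp add: inner_add_left inner_add_right inner_commute[of "P H" "P W"]
            inner_commute[of "L H" "L W"] algebra_simps)
    qed
    finally show ?thesis .
  qed
  have d\<Gamma>: "(\<Gamma> has_derivative \<Gamma>' W) (at W)" for W
  proof -
    have "((\<lambda>W. fid n * (g (X W) * L W + lam *\<^sub>R P W) * fid r) has_derivative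
        (\<lambda>H. fid n * (g (X W) * L H + h (X W) (P W * ftrans (L H) + P H * ftrans (L W)) * L W + lam *\<^sub>R P H) * fid r)) (at W)"
      by (intro bounded_linear.has_derivative[OF bounded_linear_proj] has_derivative_add
          has_derivative_mult dgX dL has_derivative_scaleR_right dP)
    moreover have "((\<lambda>W. J * (ftrans (g (X W)) * P W + lam *\<^sub>R L W) * fid r) has_derivative
        (\<lambda>H. J * (ftrans (g (X W)) * P H + ftrans (h (X W) (P W * ftrans (L H) + P H * ftrans (L W))) * P W + lam *\<^sub>R L H) * fid r)) (at W)"
      by (intro bounded_linear.has_derivative[OF bounded_linear_proj] has_derivative_add
          has_derivative_mult dT dgX dL has_derivative_scaleR_right dP)
    ultimately show ?thesis
      unfolding \<Gamma>_def \<Gamma>'_def Let_def by (rule has_derivative_add)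
  qed
  have s\<Gamma>: "supp (n + m) r (\<Gamma> W)" for W
    unfolding \<Gamma>_def J_def
    by (intro supp_add supp_mult[OF supp_mult[OF supp_fshift supp_fsize] supp_fid]
        supp_mono[OF supp_mult[OF supp_mult[OF supp_fid supp_fsize] supp_fid]]) auto
  define w where "w = fstack n m u v"
  have uv: "supp n r u" "supp m r v" unfolding u_def v_def using UV supp_emb by blast+
  have PL: "P (fstack n m a b) = a" "L (fstack n m a b) = b" if ab: "supp n r a" "supp m r b" for a b
  proof -
    have "fid n * (J * b) = 0" using fshift_orth(2)[of n m] by (simp add: J_def flip: mult.assoc)
    then show "P (fstack n m a b) = a"
      by (simp add: P_def fstack_def distrib_left J_def[symmetric] fid_mult[OF ab(1)] mult_fid[OF ab(1)])
    show "L (fstack n m a b) = b"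
      by (simp add: L_def fstack_def distrib_left J_def fshift_supp_simps[OF ab] mult_fid[OF ab(2)])
  qed
  have Xw: "X w = u * ftrans v" by (simp add: X_def w_def PL[OF uv])
  have UVc: "U @\<^sub>r V \<in> carrier_mat (n + m) r" using UV by (rule carrier_append_rows)
  have embUV: "emb (U @\<^sub>r V) = w" unfolding w_def u_def v_def by (rule emb_append_rows[OF UV])
  have dims: "dim_row U = n" "dim_row V = m" "dim_col U = r" using UV by auto
  {
    assume "critical_point f lam U V"
    then have "grad q (U @\<^sub>r V) = 0\<^sub>m (n + m) r" unfolding critical_point_def dims q_def .
    moreover have "grad q (U @\<^sub>r V) = tomat (n + m) r (\<Gamma> w)"
      unfolding embUV[symmetric] by (rule grad_eq_tomat[OF UVc s\<Gamma> dq])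
    ultimately have "emb (tomat (n + m) r (\<Gamma> w)) = emb (0\<^sub>m (n + m) r)" by simp
    also have "\<dots> = 0" by (rule fmat_eqI) (simp add: entry_emb)
    finally have "\<Gamma> w = 0" unfolding emb_tomat[OF s\<Gamma>] .
    moreover have "\<Gamma> w = fstack n m (g (u * ftrans v) * v + lam *\<^sub>R u) (ftrans (g (u * ftrans v)) * u + lam *\<^sub>R v)"
    proof -
      have 1: "supp n r (g (u * ftrans v) * v + lam *\<^sub>R u)"
        by (rule supp_add[OF supp_mult[OF g(1) uv(2)] supp_scaleR[OF uv(1)]])
      have 2: "supp m r (ftrans (g (u * ftrans v)) * u + lam *\<^sub>R v)"
        by (rule supp_add[OF supp_mult[OF supp_ftrans[OF g(1)] uv(1)] supp_scaleR[OF uv(2)]])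
      show ?thesis
        unfolding \<Gamma>_def Xw unfolding w_def PL[OF uv] fid_mult[OF 1] mult_fid[OF 1] mult.assoc[of J] mult_fid[OF 2]
        by (simp add: fstack_def J_def)
    qed
    ultimately have z: "fstack n m (g (u * ftrans v) * v + lam *\<^sub>R u) (ftrans (g (u * ftrans v)) * u + lam *\<^sub>R v) = 0"
      by simp
    have 1: "supp n r (g (u * ftrans v) * v + lam *\<^sub>R u)"
      by (rule supp_add[OF supp_mult[OF g(1) uv(2)] supp_scaleR[OF uv(1)]])
    have 2: "supp m r (ftrans (g (u * ftrans v)) * u + lam *\<^sub>R v)"
      by (rule supp_add[OF supp_mult[OF supp_ftrans[OF g(1)] uv(1)] supp_scaleR[OF uv(2)]])
    show "g (u * ftrans v) * v + lam *\<^sub>R u = 0 \<and> ftrans (g (u * ftrans v)) * u + lam *\<^sub>R v = 0"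
      using PL[OF 1 2] unfolding z by (simp add: P_def L_def)
  }
  {
    assume psd: "hess_Phi_psd f lam U V" and ab: "supp n r a" "supp m r b"
    define H where "H = tomat (n + m) r (fstack n m a b)"
    have H: "H \<in> carrier_mat (n + m) r" "emb H = fstack n m a b"
      unfolding H_def by (simp_all add: emb_tomat[OF supp_fstack[OF ab]])
    define d where "d = a * ftrans v + u * ftrans b"
    have d: "u * ftrans b + a * ftrans v = d" by (simp add: d_def)
    define G where "G = g (u * ftrans v)"
    define D where "D = h (u * ftrans v) d"
    have "0 \<le> hess q (U @\<^sub>r V) H H"
      using psd H(1) unfolding hess_Phi_psd_def dims q_def by blast
    also have "hess q (U @\<^sub>r V) H H = inner (\<Gamma>' w (fstack n m a b)) (fstack n m a b)"
      unfolding H(2)[symmetric] embUV[symmetric]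
      by (rule hess_eq[OF dq s\<Gamma> d\<Gamma> UVc H(1) H(1)])
    also have "\<dots> = inner (G * b + D * v + lam *\<^sub>R a) a + inner (ftrans G * a + ftrans D * u + lam *\<^sub>R b) b"
      unfolding \<Gamma>'_def Let_def inner_add_left[of _ "J * _ * _"] iP iL Xw
      unfolding w_def PL[OF uv] PL[OF ab] d G_def[symmetric] D_def[symmetric] ..
    also have "\<dots> = inner D d + 2 * inner G (a * ftrans b) + lam * ((norm a)\<^sup>2 + (norm b)\<^sup>2)"
    proof -
      have "inner (G * b) a = inner G (a * ftrans b)" by (rule inner_mult_right)
      moreover have "inner (D * v) a = inner D (a * ftrans v)" by (rule inner_mult_right)
      moreover have "inner (ftrans G * a) b = inner G (a * ftrans b)"
        by (subst inner_mult_left, subst inner_commute) (simp add: inner_mult_right)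
      moreover have "inner (ftrans D * u) b = inner D (u * ftrans b)"
        by (subst inner_mult_left, subst inner_commute) (simp add: inner_mult_right)
      ultimately show ?thesis
        by (simp add: inner_add_left inner_add_right d_def power2_norm_eq_inner algebra_simps)
    qed
    finally show "0 \<le> inner (h (u * ftrans v) (a * ftrans v + u * ftrans b)) (a * ftrans v + u * ftrans b)
        + 2 * inner (g (u * ftrans v)) (a * ftrans b) + lam * ((norm a)\<^sup>2 + (norm b)\<^sup>2)"
      unfolding D_def d_def G_def .
  }
qed

section \<open>Spectral norm\<close>

definition fcol :: "real vec \<Rightarrow> fmat" where
  "fcol v = fmat_of (dim_vec v) 1 (\<lambda>i j. v $ i)"

lemma entry_fcol: "entry (fcol v) i j = (if i < dim_vec v \<and> j = 0 then v $ i else 0)"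
  by (simp add: fcol_def entry_fmat_of)

lemma supp_fcol: "supp (dim_vec v) 1 (fcol v)"
  by (simp add: fcol_def supp_fmat_of)

lemma euclid_norm_fcol: "euclid_norm v = norm (fcol v)"
  by (simp add: euclid_norm_def norm_eq_sqrt_inner inner_fmat_supp[OF supp_fcol] entry_fcol
      scalar_prod_def atLeast0LessThan)

lemma fcol_mult_mat_vec:
  assumes "v \<in> carrier_vec (dim_col A)"
  shows "fcol (A *\<^sub>v v) = emb A * fcol v"
proof (rule fmat_eqI)
  fix i j
  show "entry (fcol (A *\<^sub>v v)) i j = entry (emb A * fcol v) i j"
    unfolding entry_mult_left[OF supp_fcol] using assms
    by (auto simp: entry_fcol entry_emb scalar_prod_def atLeast0LessThan intro!: sum.cong)
qed

lemma fcol_exhaust: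
  assumes "supp k 1 x"
  obtains v where "v \<in> carrier_vec k" "x = fcol v"
proof (rule that)
  show "Matrix.vec k (\<lambda>i. entry x i 0) \<in> carrier_vec k" by simp
  show "x = fcol (Matrix.vec k (\<lambda>i. entry x i 0))"
    using assms by (intro fmat_eqI) (auto simp: entry_fcol supp_iff not_less)
qed

text \<open>The supremum is meaningful only over a bounded set; the Frobenius norm supplies the
  bound.\<close>

lemma spectral_norm_upper:
  assumes "x \<in> carrier_vec (dim_col A)" "euclid_norm x \<le> 1"
  shows "euclid_norm (A *\<^sub>v x) \<le> spectral_norm A"
  unfolding spectral_norm_def
proof (rule cSUP_upper)
  show "x \<in> {x \<in> carrier_vec (dim_col A). euclid_norm x \<le> 1}" using assms by simp
  show "bdd_above ((\<lambda>x. euclid_norm (A *\<^sub>v x)) ` {x \<in> carrier_vec (dim_col A). euclid_norm x \<le> 1})"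
  proof (rule bdd_aboveI2)
    fix x assume x: "x \<in> {x \<in> carrier_vec (dim_col A). euclid_norm x \<le> 1}"
    then have "euclid_norm (A *\<^sub>v x) \<le> norm (emb A) * norm (fcol x)"
      using norm_mult_ineq[of "emb A" "fcol x"] by (simp add: euclid_norm_fcol fcol_mult_mat_vec)
    also have "\<dots> \<le> norm (emb A) * 1"
      using x by (intro mult_left_mono) (auto simp: euclid_norm_fcol)
    finally show "euclid_norm (A *\<^sub>v x) \<le> norm (emb A) * 1" .
  qed
qed

lemma spectral_norm_nonneg: "0 \<le> spectral_norm A"
proof -
  have "0 \<le> euclid_norm (A *\<^sub>v 0\<^sub>v (dim_col A))" by (simp add: euclid_norm_fcol)
  also have "\<dots> \<le> spectral_norm A"
    by (rule spectral_norm_upper) (simp_all add: euclid_norm_def)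
  finally show ?thesis .
qed

lemma spectral_norm_column:
  assumes "supp (dim_col A) 1 x"
  shows "norm (emb A * x) \<le> spectral_norm A * norm x"
proof (cases "x = 0")
  case False
  from fcol_exhaust[OF supp_scaleR[OF assms, of "1 / norm x"]]
  obtain v where v: "v \<in> carrier_vec (dim_col A)" "(1 / norm x) *\<^sub>R x = fcol v" .
  have "norm (fcol v) = 1" unfolding v(2)[symmetric] using False by simp
  then have "norm (emb A * fcol v) \<le> spectral_norm A"
    using spectral_norm_upper[OF v(1)] by (simp add: euclid_norm_fcol fcol_mult_mat_vec[OF v(1)])
  then have "norm (emb A * x) / norm x \<le> spectral_norm A"
    unfolding v(2)[symmetric] by simp
  then show ?thesis using False by (simp add: divide_le_eq)
qed simp

lemma norm_sq_columns:
  assumes "supp n k x"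
  shows "(norm x)\<^sup>2 = (\<Sum>j<k. (norm (x * funit j 0))\<^sup>2)"
proof -
  have "inner x x = inner x (x * (\<Sum>j<k. funit j 0 * funit 0 j))"
    unfolding fid_eq_sum[symmetric] by (simp add: mult_fid[OF assms])
  also have "\<dots> = (\<Sum>j<k. inner x (x * funit j 0 * funit 0 j))"
    by (simp add: sum_distrib_left inner_sum_right mult.assoc)
  also have "\<dots> = (\<Sum>j<k. inner (x * funit j 0) (x * funit j 0))"
    by (simp only: inner_mult_right ftrans_funit)
  finally show ?thesis by (simp add: power2_norm_eq_inner)
qed

text \<open>The bound holds for each column of \<open>y\<close>, and squared norms add over
  columns.\<close>

lemma spectral_norm_mult_le: "norm (emb A * y) \<le> spectral_norm A * norm y"
proof -
  define k where "k = fsize y"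
  define z where "z = fid (dim_col A) * y * fid k"
  have sz: "supp (dim_col A) k z"
    unfolding z_def by (rule supp_mult[OF supp_mult[OF supp_fid supp_fsize] supp_fid])
  have A: "supp (dim_row A) (dim_col A) (emb A)" by (rule supp_emb) simp
  have "emb A * y = emb A * z"
    using mult_fid[OF A] mult_fid[OF supp_fsize[of y]] by (simp add: z_def k_def flip: mult.assoc)
      (simp add: mult.assoc)
  moreover have "(norm (emb A * z))\<^sup>2 \<le> (spectral_norm A * norm z)\<^sup>2"
  proof -
    have "(norm (emb A * z))\<^sup>2 = (\<Sum>j<k. (norm (emb A * (z * funit j 0)))\<^sup>2)"
      unfolding norm_sq_columns[OF supp_mult[OF A sz]] by (simp add: mult.assoc)
    also have "\<dots> \<le> (\<Sum>j<k. (spectral_norm A * norm (z * funit j 0))\<^sup>2)"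
      by (intro sum_mono power_mono spectral_norm_column supp_mult[OF sz supp_funit[OF lessI]]) auto
    also have "\<dots> = (spectral_norm A * norm z)\<^sup>2"
      unfolding power_mult_distrib norm_sq_columns[OF sz] by (simp add: sum_distrib_left)
    finally show ?thesis .
  qed
  then have "norm (emb A * z) \<le> spectral_norm A * norm z"
    by (rule power2_le_imp_le) (simp add: spectral_norm_nonneg)
  moreover have "norm z \<le> norm y" unfolding z_def by (rule norm_proj_le)
  ultimately show ?thesis
    using mult_left_mono[OF _ spectral_norm_nonneg[of A]] order_trans by metis
qed

lemma spectral_norm_le:
  assumes "\<And>y. norm (emb A * y) \<le> c * norm y" "0 \<le> c"
  shows "spectral_norm A \<le> c"
  unfolding spectral_norm_def
proof (rule cSUP_least)
  have "0\<^sub>v (dim_col A) \<in> {x \<in> carrier_vec (dim_col A). euclid_norm x \<le> 1}"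
    by (simp add: euclid_norm_def)
  then show "{x \<in> carrier_vec (dim_col A). euclid_norm x \<le> 1} \<noteq> {}" by blast
  fix x assume x: "x \<in> {x \<in> carrier_vec (dim_col A). euclid_norm x \<le> 1}"
  then have "euclid_norm (A *\<^sub>v x) \<le> c * norm (fcol x)"
    using assms(1)[of "fcol x"] by (simp add: euclid_norm_fcol fcol_mult_mat_vec)
  also have "\<dots> \<le> c * 1"
    using x assms(2) by (intro mult_left_mono) (auto simp: euclid_norm_fcol)
  finally show "euclid_norm (A *\<^sub>v x) \<le> c" by simp
qed

text \<open>Moving the transpose across the inner product bounds the squared norm of
  \<open>z\<close> by the norm of \<open>y\<close> times that of \<open>emb A * z\<close>.\<close>

lemma spectral_norm_transpose_mult_le: "norm (ftrans (emb A) * y) \<le> spectral_norm A * norm y"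
proof -
  define z where "z = ftrans (emb A) * y"
  have "norm z * norm z = inner y (emb A * z)"
    unfolding z_def by (simp add: inner_mult_left flip: power2_eq_square power2_norm_eq_inner)
      (simp add: power2_norm_eq_inner inner_mult_left)
  also have "\<dots> \<le> norm y * norm (emb A * z)" by (rule norm_cauchy_schwarz)
  also have "\<dots> \<le> norm y * (spectral_norm A * norm z)"
    by (intro mult_left_mono spectral_norm_mult_le) simp
  finally have "norm z * norm z \<le> (spectral_norm A * norm y) * norm z" by (simp add: ac_simps)
  then show ?thesis
    unfolding z_def[symmetric] by (cases "z = 0") (auto simp: spectral_norm_nonneg)
qed

lemma emb_Xi:
  assumes "X \<in> carrier_mat n m" "grad f X \<in> carrier_mat n m"
  shows "emb (Xi f lam X) = lam *\<^sub>R fid (n + m) + offd n m (emb (grad f X))"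
proof (rule fmat_eqI)
  fix i j
  have 1: "entry (emb (grad f X) * ftrans (fshift n m)) i j =
      (if n \<le> j \<and> j < n + m then entry (emb (grad f X)) i (j - n) else 0)"
    by (subst entry_ftrans[symmetric]) (simp only: ftrans_mult ftrans_simps(1) entry_fshift_mult entry_ftrans)
  show "entry (emb (Xi f lam X)) i j = entry (lam *\<^sub>R fid (n + m) + offd n m (emb (grad f X))) i j"
    using assms by (auto simp: Xi_def offd_def entry_emb 1 entry_fshift_mult entry_fid)
qed

text \<open>The off-diagonal part sends a stack (a; b) to (G b; G^T a), so its operator norm is at
  most that of G.\<close>

lemma spectral_norm_Xi_le:
  assumes "X \<in> carrier_mat n m" "grad f X \<in> carrier_mat n m" "0 \<le> lam"
  shows "spectral_norm (Xi f lam X) \<le> lam + spectral_norm (grad f X)"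
proof (rule spectral_norm_le)
  define G where "G = emb (grad f X)"
  define J where "J = fshift n m"
  define s where "s = spectral_norm (grad f X)"
  have G: "supp n m G" unfolding G_def by (rule supp_emb[OF assms(2)])
  fix y
  define a where "a = fid n * y"
  define b where "b = ftrans J * y"
  have sab: "supp n (fsize y) a" "supp m (fsize y) b"
    unfolding a_def b_def J_def
    by (rule supp_mult[OF supp_fid supp_fsize], rule supp_mult[OF supp_ftrans[OF supp_fshift] supp_fsize])
  have ab: "fstack n m a b = fid (n + m) * y"
    unfolding fstack_def a_def b_def J_def fshift_orth(4)[symmetric]
    by (simp only: distrib_right mult.assoc)
  have fy: "norm (fid (n + m) * y) \<le> norm y"
    using norm_proj_le[of "n + m" y "fsize y"] by (simp add: mult.assoc mult_fid[OF supp_fsize])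
  have "offd n m G * y = fstack n m (G * b) (ftrans G * a)"
  proof -
    have "ftrans G * y = ftrans G * a"
      using mult_fid[OF supp_ftrans[OF G]] by (simp add: a_def flip: mult.assoc)
    then show ?thesis by (simp add: offd_def fstack_def b_def J_def distrib_right mult.assoc)
  qed
  moreover have "(norm (fstack n m (G * b) (ftrans G * a)))\<^sup>2 \<le> (s * norm y)\<^sup>2"
  proof -
    have "(norm (fstack n m (G * b) (ftrans G * a)))\<^sup>2 = (norm (G * b))\<^sup>2 + (norm (ftrans G * a))\<^sup>2"
      unfolding power2_norm_eq_inner
      by (rule inner_fstack) (rule supp_mult[OF G sab(2)] supp_mult[OF supp_ftrans[OF G] sab(1)])+
    also have "\<dots> \<le> (s * norm b)\<^sup>2 + (s * norm a)\<^sup>2"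
      unfolding G_def s_def
      by (intro add_mono power_mono spectral_norm_mult_le spectral_norm_transpose_mult_le) auto
    also have "\<dots> = s\<^sup>2 * (norm (fid (n + m) * y))\<^sup>2"
      unfolding ab[symmetric] power2_norm_eq_inner[of "fstack n m a b"] inner_fstack[OF sab sab]
      by (simp add: power_mult_distrib power2_norm_eq_inner algebra_simps)
    also have "\<dots> \<le> (s * norm y)\<^sup>2"
      using fy by (simp add: power_mult_distrib mult_left_mono power_mono)
    finally show ?thesis .
  qed
  then have "norm (fstack n m (G * b) (ftrans G * a)) \<le> s * norm y"
    by (rule power2_le_imp_le) (simp add: s_def spectral_norm_nonneg)
  ultimately have "norm (offd n m G * y) \<le> s * norm y" by simp
  moreover have "norm (lam *\<^sub>R (fid (n + m) * y)) \<le> lam * norm y"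
    using fy assms(3) by (simp add: mult_left_mono)
  ultimately show "norm (emb (Xi f lam X) * y) \<le> (lam + spectral_norm (grad f X)) * norm y"
    unfolding emb_Xi[OF assms(1,2)] G_def[symmetric] s_def[symmetric]
    using norm_triangle_ineq[of "lam *\<^sub>R (fid (n + m) * y)" "offd n m G * y"]
    by (simp add: distrib_right)
qed (simp add: assms(3) spectral_norm_nonneg)

section \<open>Rank\<close>

text \<open>The column space of \<open>B * C\<close> lies in that of \<open>B\<close>, which is
  spanned by \<open>k\<close> columns.\<close>

lemma mat_rank_mult_le:
  assumes B: "B \<in> carrier_mat n k" and C: "C \<in> carrier_mat k m"
  shows "mat_rank (B * C) \<le> k"
proof -
  interpret vec_space "TYPE(real)" n .
  have BC: "B * C \<in> carrier_mat n m" using B C by simp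
  have cB: "set (cols B) \<subseteq> carrier_vec n" and cBC: "set (cols (B * C)) \<subseteq> carrier_vec n"
    using cols_dim[of B] cols_dim[of "B * C"] B by auto
  have "set (cols (B * C)) \<subseteq> span (set (cols B))"
  proof
    fix x assume "x \<in> set (cols (B * C))"
    then obtain j where j: "j < m" "x = col (B * C) j"
      using BC by (auto simp: cols_def)
    have "x = B *\<^sub>v col C j" unfolding j(2) by (rule col_mult2[OF B C j(1)])
    moreover have "col C j \<in> carrier_vec (dim_col B)" using j B C by auto
    moreover from calculation have "x \<in> carrier_vec (dim_row B)"
      by (metis carrier_mat_triv mult_mat_vec_carrier)
    ultimately have "x \<in> col_space B" unfolding col_space_eq[OF B] by blast
    then show "x \<in> span (set (cols B))" by (simp add: col_space_def)
  qed
  then have le: "span (set (cols (B * C))) \<subseteq> span (set (cols B))"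
    using cB span_is_subset span_is_submodule by simp
  have sB: "subspace class_ring (span (set (cols B))) V"
    using cB span_is_subspace by simp
  have sBC: "subspace class_ring (span (set (cols (B * C)))) V"
    using cBC span_is_subspace by simp
  have "rank (B * C) \<le> rank B"
    unfolding rank_def
    using vectorspace.subspace_dim[OF subspace_is_vs[OF sB] nested_subspaces[OF sB sBC le]
        fin_dim_span_cols[OF B]] fin_dim_span_cols[OF BC] by auto
  also have "\<dots> \<le> k" by (rule rank_le_nc[OF B])
  finally show ?thesis using B by (simp add: mat_rank_def)
qed

text \<open>\<open>B\<close> collects a maximal independent set of columns of \<open>A\<close>, and
  \<open>C\<close> the coefficients of all columns over it.\<close>

lemma mat_rank_factorization:
  assumes A: "A \<in> carrier_mat n m"
  obtains B C where "B \<in> carrier_mat n (mat_rank A)" "C \<in> carrier_mat (mat_rank A) m" "A = B * C"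
proof -
  interpret vec_space "TYPE(real)" n .
  have cA: "set (cols A) \<subseteq> carrier_vec n" using cols_dim[of A] A by auto
  obtain S where S: "finite S" "maximal S (\<lambda>T. T \<subseteq> set (cols A) \<and> lin_indpt T)"
  proof -
    have "lin_indpt {}" using finite_lin_indpt2[of "{}"] by simp
    then show thesis
      using maximal_exists_superset[of "set (cols A)" "\<lambda>T. T \<subseteq> set (cols A) \<and> lin_indpt T" "{}"] that by auto
  qed
  have SA: "S \<subseteq> set (cols A)" "lin_indpt S" using S(2) by (auto simp: maximal_def)
  have Sn: "S \<subseteq> carrier_vec n" using SA(1) cA by blast
  obtain xs where xs: "set xs = S" "distinct xs" using finite_distinct_list[OF S(1)] by blast
  have len: "length xs = mat_rank A"
    using rank_card_indpt[OF A S(2)] distinct_card[OF xs(2)] xs(1) A by (simp add: mat_rank_def)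
  define B where "B = mat_of_cols n xs"
  have B: "B \<in> carrier_mat n (mat_rank A)" by (simp add: B_def len[symmetric])
  have colsB: "cols B = xs" unfolding B_def using Sn xs(1) by (intro cols_mat_of_cols) auto
  have ex: "\<exists>x. x \<in> carrier_vec (mat_rank A) \<and> B *\<^sub>v x = col A j" if j: "j < m" for j
  proof -
    have jA: "col A j \<in> set (cols A)" using j A by (auto simp: cols_def)
    have jn: "col A j \<in> carrier_vec n" using A j by auto
    have "col A j \<in> span S"
    proof (rule ccontr)
      assume nin: "col A j \<notin> span S"
      then have "col A j \<notin> S" using span_mem Sn by auto
      then have "lin_indpt (S \<union> {col A j})"
        using lin_dep_iff_in_span[of S "col A j"] Sn SA(2) jn nin by auto
      then have "S \<union> {col A j} = S" using S(2) jA SA(1) unfolding maximal_def by auto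
      then show False using \<open>col A j \<notin> S\<close> by blast
    qed
    then have "col A j \<in> col_space B" by (simp add: col_space_def colsB xs(1))
    then show ?thesis unfolding col_space_eq[OF B] using B by auto
  qed
  define C where "C = Matrix.mat (mat_rank A) m (\<lambda>(i, j). (SOME x. x \<in> carrier_vec (mat_rank A) \<and> B *\<^sub>v x = col A j) $ i)"
  have C: "C \<in> carrier_mat (mat_rank A) m" by (simp add: C_def)
  have "A = B * C"
  proof (rule mat_col_eqI)
    fix j assume "j < dim_col (B * C)"
    then have j: "j < m" using C by simp
    define x where "x = (SOME x. x \<in> carrier_vec (mat_rank A) \<and> B *\<^sub>v x = col A j)"
    have x: "x \<in> carrier_vec (mat_rank A)" "B *\<^sub>v x = col A j"
      unfolding x_def using someI_ex[OF ex[OF j]] by blast+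
    have "col C j = x" using j x(1) by (intro eq_vecI) (auto simp: C_def x_def)
    then show "col A j = col (B * C) j" unfolding col_mult2[OF B C j] by (simp only: x(2))
  qed (use A B C in auto)
  then show ?thesis using that B C by blast
qed

lemma mat_rank_le_of_rk:
  assumes x: "supp n m x" and rk: "rk k x"
  shows "mat_rank (tomat n m x) \<le> k"
proof -
  from rk obtain a b N where a: "supp N k a" "x = a * b" by (auto simp: rk_def)
  have "x = (fid n * a) * (fid k * b * fid m)"
  proof -
    have "fid n * x * fid m = fid n * (a * fid k) * b * fid m"
      unfolding a(2) mult_fid[OF a(1)] by (simp add: mult.assoc)
    then show ?thesis using x unfolding fid_eq_supp[symmetric] by (simp add: mult.assoc)
  qed
  then have "emb (tomat n m x) = emb (tomat n k (fid n * a) * tomat k m (fid k * b * fid m))"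
    unfolding emb_mult[OF tomat_carrier tomat_carrier] emb_tomat[OF x]
      emb_tomat[OF supp_mult[OF supp_fid a(1)]]
      emb_tomat[OF supp_mult[OF supp_mult[OF supp_fid supp_fsize] supp_fid]] .
  then have "tomat n m x = tomat n k (fid n * a) * tomat k m (fid k * b * fid m)"
    by (rule emb_inject[rotated 2]) (auto intro: mult_carrier_mat)
  then show ?thesis using mat_rank_mult_le[OF tomat_carrier tomat_carrier] by simp
qed

lemma rk_emb:
  assumes "A \<in> carrier_mat n m"
  shows "rk (mat_rank A) (emb A)"
proof -
  from mat_rank_factorization[OF assms] obtain B C where
    BC: "B \<in> carrier_mat n (mat_rank A)" "C \<in> carrier_mat (mat_rank A) m" "A = B * C" .
  have "emb A = emb B * emb C" using emb_mult[OF BC(1,2)] BC(3) by simp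
  then show ?thesis using rkI[OF supp_emb[OF BC(1)]] by simp
qed

section \<open>The factors of the ground truth\<close>

definition fdiag :: "nat \<Rightarrow> (nat \<Rightarrow> real) \<Rightarrow> fmat" where
  "fdiag k s = fmat_of k k (\<lambda>i j. if i = j then s i else 0)"

lemma entry_fdiag: "entry (fdiag k s) i j = (if i = j \<and> i < k then s i else 0)"
  by (auto simp: fdiag_def entry_fmat_of)

lemma supp_fdiag: "supp k k (fdiag k s)"
  by (simp add: fdiag_def supp_fmat_of)

lemma ftrans_fdiag [simp]: "ftrans (fdiag k s) = fdiag k s"
  by (rule fmat_eqI) (auto simp: entry_fdiag)

lemma fdiag_mult: "fdiag k s * fdiag k t = fdiag k (\<lambda>i. s i * t i)"
proof (rule fmat_eqI)
  fix i j
  have "entry (fdiag k s * fdiag k t) i j = (\<Sum>l<k. if l = i then (if i = j then s i * t i else 0) else 0)"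
    unfolding entry_mult_right[OF supp_fdiag] by (intro sum.cong) (auto simp: entry_fdiag)
  then show "entry (fdiag k s * fdiag k t) i j = entry (fdiag k (\<lambda>i. s i * t i)) i j"
    by (simp add: entry_fdiag)
qed

lemma emb_mat_diag: "emb (mat_diag k s) = fdiag k s"
  by (rule fmat_eqI) (auto simp: entry_emb entry_fdiag mat_diag_def)

lemma emb_rect_diag: "n \<le> m \<Longrightarrow> emb (rect_diag n m s) = fdiag n (\<lambda>i. s ! i)"
  by (rule fmat_eqI) (auto simp: entry_emb entry_fdiag rect_diag_def)

lemma emb_first_cols: "P \<in> carrier_mat n m \<Longrightarrow> k \<le> m \<Longrightarrow> emb (first_cols k P) = emb P * fid k"
  by (rule fmat_eqI) (auto simp: entry_emb entry_mult_fid first_cols_def)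

text \<open>A projection fixing \<open>fid l\<close> pairs with it to \<open>l\<close>, the squared
  norm of \<open>fid l\<close>; Cauchy-Schwarz then compares with the norm bound
  \<open>k\<close>.\<close>

lemma rk_fid_le:
  assumes "rk k (fid l)"
  shows "l \<le> k"
proof -
  from rk_projection[OF assms] obtain p where
    p: "ftrans p = p" "p * p = p" "p * fid l = fid l" "rk k p" "(norm p)\<^sup>2 \<le> real k"
    by (elim exE conjE)
  have "inner (fid l) (fid l) = (\<Sum>i<l. \<Sum>j<l. if j = i then 1 else 0)"
    unfolding inner_fmat_supp[OF supp_fid] by (intro sum.cong refl) (auto simp: entry_fid)
  then have l: "(norm (fid l))\<^sup>2 = real l" by (simp add: power2_norm_eq_inner)
  have "norm (fid l) * norm (fid l) = inner p (fid l)"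
    using inner_mult_right[of p "fid l" "fid l"] p(3) by (simp add: dot_square_norm power2_eq_square)
  also have "\<dots> \<le> norm p * norm (fid l)" by (rule norm_cauchy_schwarz)
  finally have "norm (fid l) \<le> norm p" by (cases "norm (fid l) = 0") auto
  then have "(norm (fid l))\<^sup>2 \<le> (norm p)\<^sup>2" by (intro power_mono) auto
  then show ?thesis using l p(5) by simp
qed

text \<open>A nonzero entry at \<open>i\<close> makes all entries up to \<open>i\<close> positive;
  dividing by them yields \<open>fid (Suc i)\<close>, whose rank exceeds \<open>k\<close>.\<close>

lemma rk_fdiag_zero:
  assumes rk: "rk k (fdiag n s)" and i: "k \<le> i" "i < n"
    and mono: "\<And>i j. i \<le> j \<Longrightarrow> j < n \<Longrightarrow> s j \<le> s i" and nn: "\<And>i. i < n \<Longrightarrow> 0 \<le> s i"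
  shows "s i = 0"
proof (rule ccontr)
  assume "s i \<noteq> 0"
  then have "0 < s i" using nn i by (simp add: less_le)
  then have pos: "0 < s j" if "j \<le> i" for j using mono[OF that i(2)] by simp
  have "fdiag n s * fdiag n (\<lambda>j. if j \<le> i then 1 / s j else 0) = fid (Suc i)"
    unfolding fdiag_mult using i pos by (intro fmat_eqI) (auto simp: entry_fdiag entry_fid less_Suc_eq_le less_imp_neq[symmetric] split: if_splits)
  then have "rk k (fid (Suc i))" using rk_mult_right[OF rk] by metis
  then have "Suc i \<le> k" by (rule rk_fid_le)
  then show False using i by simp
qed

lemma orthogonal_matricesD:
  assumes "R \<in> orthogonal_matrices k"
  shows "R \<in> carrier_mat k k" "R\<^sup>T * R = 1\<^sub>m k" "R * R\<^sup>T = 1\<^sub>m k"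
    "ftrans (emb R) * emb R = fid k" "emb R * ftrans (emb R) = fid k"
proof -
  show R: "R \<in> carrier_mat k k" and o: "R\<^sup>T * R = 1\<^sub>m k"
    using assms by (auto simp: orthogonal_matrices_def)
  have Rt: "R\<^sup>T \<in> carrier_mat k k" using R by simp
  show o': "R * R\<^sup>T = 1\<^sub>m k" by (rule mat_mult_left_right_inverse[OF Rt R o])
  show "ftrans (emb R) * emb R = fid k"
    using emb_mult[OF Rt R] o by (simp add: emb_transpose emb_one)
  show "emb R * ftrans (emb R) = fid k"
    using emb_mult[OF R Rt] o' by (simp add: emb_transpose emb_one)
qed

text \<open>The entries of \<open>singular_values M\<close> are only known to be the singular values because an
  SVD exists: it makes the characteristic polynomial split, so the list has full length.\<close>
lemma singular_values_properties:
  assumes M: "M \<in> carrier_mat n m" and nm: "n \<le> m" and PQ: "(P, Q) \<in> svd_pairs M"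
  shows "length (singular_values M) = n"
    "i \<le> j \<Longrightarrow> j < n \<Longrightarrow> singular_values M ! j \<le> singular_values M ! i"
    "i < n \<Longrightarrow> 0 \<le> singular_values M ! i"
proof -
  define s where "s = singular_values M"
  define D where "D = rect_diag n m s"
  define B where "B = mat_diag n (\<lambda>i. (s ! i)\<^sup>2)"
  have P: "P \<in> orthogonal_matrices n" and Q: "Q \<in> orthogonal_matrices m" and MD: "M = P * D * Q\<^sup>T"
    using PQ M by (auto simp: svd_pairs_def D_def s_def)
  note P' = orthogonal_matricesD[OF P] and Q' = orthogonal_matricesD[OF Q]
  have D: "D \<in> carrier_mat n m" by (simp add: D_def rect_diag_def)
  have B: "B \<in> carrier_mat n n" by (simp add: B_def)
  have MMc: "M * M\<^sup>T \<in> carrier_mat n n" using M by simp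
  have "emb (M * M\<^sup>T) = emb (P * B * P\<^sup>T)"
  proof -
    have eM: "emb M = emb P * fdiag n (\<lambda>i. s ! i) * ftrans (emb Q)"
      unfolding MD using P'(1) Q'(1) D
      by (simp add: emb_mult[of _ n m _ m] emb_mult[of _ n n _ m] emb_transpose) (simp add: D_def emb_rect_diag[OF nm] mult.assoc)
    have "emb (M * M\<^sup>T) = emb M * ftrans (emb M)"
      using emb_mult[OF M, of "M\<^sup>T" n] M by (simp add: emb_transpose)
    also have "\<dots> = emb P * fdiag n (\<lambda>i. s ! i) * (ftrans (emb Q) * emb Q) * fdiag n (\<lambda>i. s ! i) * ftrans (emb P)"
      unfolding eM by (simp add: mult.assoc)
    also have "fdiag n (\<lambda>i. s ! i) * (ftrans (emb Q) * emb Q) = fdiag n (\<lambda>i. s ! i)"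
      unfolding Q'(4) by (rule mult_fid[OF supp_mono[OF supp_fdiag order_refl nm]])
    then have "emb P * fdiag n (\<lambda>i. s ! i) * (ftrans (emb Q) * emb Q) * fdiag n (\<lambda>i. s ! i) * ftrans (emb P)
        = emb P * (fdiag n (\<lambda>i. s ! i) * fdiag n (\<lambda>i. s ! i)) * ftrans (emb P)"
      by (simp add: mult.assoc)
    also have "\<dots> = emb P * emb B * ftrans (emb P)"
      unfolding fdiag_mult B_def emb_mat_diag by (simp add: power2_eq_square)
    also have "\<dots> = emb (P * B * P\<^sup>T)"
      using P'(1) B by (simp add: emb_mult[of _ n n _ n] emb_transpose mult.assoc)
    finally show ?thesis .
  qed
  then have eq: "M * M\<^sup>T = P * B * P\<^sup>T"
    by (rule emb_inject[rotated 2]) (use P'(1) B MMc in auto)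
  have "similar_mat (M * M\<^sup>T) B"
    by (rule similar_matI[of _ _ P "P\<^sup>T" n]) (use MMc B P' eq in auto)
  then have "char_poly (M * M\<^sup>T) = char_poly B" by (rule char_poly_similar)
  also have "\<dots> = (\<Prod>a\<leftarrow>diag_mat B. [:- a, 1:])"
    by (rule char_poly_upper_triangular[OF B]) (auto simp: upper_triangular_def B_def mat_diag_def)
  also have "diag_mat B = map (\<lambda>i. (s ! i)\<^sup>2) [0..<n]"
    by (auto simp: diag_mat_def B_def mat_diag_def)
  finally have cp: "char_poly (M * M\<^sup>T) = (\<Prod>p\<leftarrow>map (\<lambda>i. [:- ((s ! i)\<^sup>2), 1:]) [0..<n]. p)"
    by (simp add: comp_def)
  have "proots (char_poly (M * M\<^sup>T)) = mset (map (\<lambda>i. (s ! i)\<^sup>2) [0..<n])"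
  proof -
    have "(\<Sum>i\<leftarrow>xs. proots [:- ((s ! i)\<^sup>2), 1:]) = mset (map (\<lambda>i. (s ! i)\<^sup>2) xs)" for xs
      by (induction xs) auto
    then show ?thesis unfolding cp by (subst proots_prod_list) (auto simp: comp_def)
  qed
  then have roots: "image_mset sqrt (proots (char_poly (M * M\<^sup>T))) = mset (map (\<lambda>i. \<bar>s ! i\<bar>) [0..<n])"
    by (simp add: comp_def multiset.map_comp)
  \<comment> \<open>Square roots of the squares return absolute values. Whatever \<open>s\<close>
    is, the right side has \<open>n\<close> nonnegative entries in nonincreasing order, so length,
    sign and order can be read off.\<close>
  have s: "s = rev (sort (map (\<lambda>i. \<bar>s ! i\<bar>) [0..<n]))"
  proof -
    have "s = rev (sorted_list_of_multiset (image_mset sqrt (proots (char_poly (M * M\<^sup>T)))))"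
      using M nm by (simp add: s_def singular_values_def)
    then show ?thesis by (simp only: roots sorted_list_of_multiset_mset)
  qed
  show len: "length (singular_values M) = n"
    using arg_cong[OF s, of length] by (simp add: s_def)
  have "set s \<subseteq> {0..}" by (subst s) auto
  moreover have "singular_values M ! i \<in> set s" if "i < n"
    unfolding s_def using that len by simp
  ultimately show "i < n \<Longrightarrow> 0 \<le> singular_values M ! i" by auto
  have "sorted (rev s)" by (subst s) simp
  then show "i \<le> j \<Longrightarrow> j < n \<Longrightarrow> singular_values M ! j \<le> singular_values M ! i"
    using len sorted_rev_nth_mono[of "singular_values M" i j] by (simp add: s_def)
qed

lemma opt_factors_properties:
  assumes M: "M \<in> carrier_mat n m" and nm: "n \<le> m" and k: "mat_rank M \<le> n"
    and UV: "(Us, Vs) \<in> opt_factors M"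
  shows "Us \<in> carrier_mat n (mat_rank M)" "Vs \<in> carrier_mat m (mat_rank M)"
    "emb M = emb Us * ftrans (emb Vs)" "ftrans (emb Us) * emb Us = ftrans (emb Vs) * emb Vs"
proof -
  define k where "k = mat_rank M"
  define s where "s = singular_values M"
  define S where "S = mat_diag k (\<lambda>i. sqrt (s ! i))"
  from UV obtain P Q R where PQ: "(P, Q) \<in> svd_pairs M" and R: "R \<in> orthogonal_matrices k"
    and Us: "Us = first_cols k P * S * R" and Vs: "Vs = first_cols k Q * S * R"
    unfolding opt_factors_def Let_def k_def S_def s_def by blast
  have P: "P \<in> orthogonal_matrices n" and Q: "Q \<in> orthogonal_matrices m"
    and MD: "M = P * rect_diag n m s * Q\<^sup>T"
    using PQ M by (auto simp: svd_pairs_def s_def)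
  note P' = orthogonal_matricesD[OF P] and Q' = orthogonal_matricesD[OF Q] and R' = orthogonal_matricesD[OF R]
  have kn: "k \<le> n" "k \<le> m" using k nm by (simp_all add: k_def)
  have S: "S \<in> carrier_mat k k" by (simp add: S_def)
  have fP: "first_cols k P \<in> carrier_mat n k" and fQ: "first_cols k Q \<in> carrier_mat m k"
    using P'(1) Q'(1) by (auto simp: first_cols_def)
  show "Us \<in> carrier_mat n (mat_rank M)" "Vs \<in> carrier_mat m (mat_rank M)"
    unfolding Us Vs k_def[symmetric] using fP fQ S R'(1) by auto
  define p where "p = emb P"
  define q where "q = emb Q"
  define \<sigma> where "\<sigma> = fdiag k (\<lambda>i. sqrt (s ! i))"
  define \<rho> where "\<rho> = emb R"
  have s\<sigma>: "supp k k \<sigma>" unfolding \<sigma>_def by (rule supp_fdiag)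
  have eU: "emb Us = p * \<sigma> * \<rho>"
  proof -
    have "emb Us = p * fid k * \<sigma> * \<rho>"
      unfolding Us using fP S R'(1)
      by (simp add: emb_mult[of _ n k _ k] emb_first_cols[OF P'(1) kn(1)] S_def emb_mat_diag p_def \<sigma>_def \<rho>_def)
    then show ?thesis by (simp add: mult.assoc) (simp add: fid_mult[OF s\<sigma>] flip: mult.assoc)
  qed
  have eV: "emb Vs = q * \<sigma> * \<rho>"
  proof -
    have "emb Vs = q * fid k * \<sigma> * \<rho>"
      unfolding Vs using fQ S R'(1)
      by (simp add: emb_mult[of _ m k _ k] emb_first_cols[OF Q'(1) kn(2)] S_def emb_mat_diag q_def \<sigma>_def \<rho>_def)
    then show ?thesis by (simp add: mult.assoc) (simp add: fid_mult[OF s\<sigma>] flip: mult.assoc)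
  qed
  have "ftrans (emb Us) * emb Us = ftrans \<rho> * ftrans \<sigma> * (ftrans p * p * \<sigma>) * \<rho>"
    "ftrans (emb Vs) * emb Vs = ftrans \<rho> * ftrans \<sigma> * (ftrans q * q * \<sigma>) * \<rho>"
    unfolding eU eV by (simp_all add: mult.assoc)
  moreover have "ftrans p * p * \<sigma> = \<sigma>" "ftrans q * q * \<sigma> = \<sigma>"
    unfolding p_def q_def P'(4) Q'(4)
    by (rule fid_mult[OF supp_mono[OF s\<sigma>]]; use kn in simp)+
  ultimately show "ftrans (emb Us) * emb Us = ftrans (emb Vs) * emb Vs" by simp
  have eM: "emb M = p * fdiag n (\<lambda>i. s ! i) * ftrans q"
  proof -
    have "rect_diag n m s \<in> carrier_mat n m" by (simp add: rect_diag_def)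
    then show ?thesis unfolding MD p_def q_def using P'(1) Q'(1)
      by (simp add: emb_mult[of _ n m _ m] emb_mult[of _ n n _ m] emb_transpose emb_rect_diag[OF nm] mult.assoc)
  qed
  note sv = singular_values_properties[OF M nm PQ, folded s_def]
  have rkd: "rk k (fdiag n (\<lambda>i. s ! i))"
  proof -
    have "rk k (ftrans p * emb M * q)"
      unfolding k_def by (intro rk_mult_right[OF rk_mult_left[OF rk_emb[OF M]]])
    also have "ftrans p * emb M * q = (ftrans p * p) * fdiag n (\<lambda>i. s ! i) * (ftrans q * q)"
      unfolding eM by (simp add: mult.assoc)
    also have "\<dots> = fdiag n (\<lambda>i. s ! i)"
      unfolding p_def q_def P'(4) Q'(4) fid_mult[OF supp_fdiag]
      by (rule mult_fid[OF supp_mono[OF supp_fdiag order_refl nm]])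
    finally show ?thesis .
  qed
  \<comment> \<open>Cutting to \<open>k\<close> entries loses nothing: the full diagonal inherits
    the rank bound of M and is nonincreasing, so its later entries vanish.\<close>
  have "\<sigma> * \<sigma> = fdiag n (\<lambda>i. s ! i)"
    unfolding \<sigma>_def fdiag_mult
  proof (rule fmat_eqI)
    fix i j
    have "s ! i = 0" if "k \<le> i" "i < n"
      using rk_fdiag_zero[OF rkd that] sv(2,3) by blast
    then show "entry (fdiag k (\<lambda>i. sqrt (s ! i) * sqrt (s ! i))) i j = entry (fdiag n (\<lambda>i. s ! i)) i j"
      using sv(3)[of i] kn by (auto simp: entry_fdiag not_less)
  qed
  moreover have "emb Us * ftrans (emb Vs) = p * \<sigma> * (\<rho> * ftrans \<rho>) * ftrans \<sigma> * ftrans q"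
    unfolding eU eV by (simp add: mult.assoc)
  then have "emb Us * ftrans (emb Vs) = p * (\<sigma> * fid k) * \<sigma> * ftrans q"
    unfolding \<rho>_def R'(5) by (simp add: mult.assoc \<sigma>_def)
  ultimately show "emb M = emb Us * ftrans (emb Vs)"
    unfolding eM mult_fid[OF s\<sigma>] by (simp add: mult.assoc flip: mult.assoc[of \<sigma> \<sigma>])
qed

lemma RSC_RSS_transfer:
  assumes "RSC_RSS n m k \<alpha> \<beta> f" and H: "\<And>X H K. X \<in> carrier_mat n m \<Longrightarrow> H \<in> carrier_mat n m \<Longrightarrow>
      K \<in> carrier_mat n m \<Longrightarrow> hess f X H K = inner (h (emb X) (emb H)) (emb K)"
    and x: "supp n m x" "supp n m a" "rk (2 * k) x" "rk (4 * k) a"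
  shows "\<alpha> * (norm a)\<^sup>2 \<le> inner (h x a) a \<and> inner (h x a) a \<le> \<beta> * (norm a)\<^sup>2"
proof -
  have "\<alpha> * (frob_norm (tomat n m a))\<^sup>2 \<le> hess f (tomat n m x) (tomat n m a) (tomat n m a) \<and>
      hess f (tomat n m x) (tomat n m a) (tomat n m a) \<le> \<beta> * (frob_norm (tomat n m a))\<^sup>2"
    using assms(1) mat_rank_le_of_rk[OF x(1,3)] mat_rank_le_of_rk[OF x(2,4)]
    unfolding RSC_RSS_def by (meson tomat_carrier)
  then show ?thesis
    unfolding H[OF tomat_carrier tomat_carrier tomat_carrier] frob_norm_emb emb_tomat[OF x(1)] emb_tomat[OF x(2)] .
qed

text \<open>Binding the constant before dimensions, matrices, f and lam expresses that it depends on
  \<alpha> and \<beta> alone.\<close>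

theorem theorem3p1:
  fixes \<alpha> \<beta> :: real
  assumes "\<beta> / \<alpha> \<le> 1.38"
  shows "\<exists>\<gamma>>0. \<forall>(n::nat) (m::nat) (r::nat) (rs::nat) (M::real mat) (f::real mat \<Rightarrow> real)
      (lam::real) (Us::real mat) (Vs::real mat) (U::real mat) (V::real mat).
    n \<le> m \<longrightarrow>
    M \<in> carrier_mat n m \<longrightarrow> rs = mat_rank M \<longrightarrow> 1 \<le> rs \<longrightarrow> 4 * rs \<le> min m n \<longrightarrow>
    rs \<le> r \<longrightarrow> r < min n m \<longrightarrow>
    (\<forall>X \<in> carrier_mat n m. 0 \<le> f X) \<longrightarrow> twice_cont_diff n m f \<longrightarrow>
    RSC_RSS n m rs \<alpha> \<beta> f \<longrightarrow>
    0 < lam \<longrightarrow>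
    (Us, Vs) \<in> opt_factors M \<longrightarrow>
    U \<in> carrier_mat n r \<longrightarrow> V \<in> carrier_mat m r \<longrightarrow>
    critical_point f lam U V \<longrightarrow> mat_rank (U * V\<^sup>T) \<le> rs \<longrightarrow> hess_Phi_psd f lam U V \<longrightarrow>
    (let W = U @\<^sub>r V; Ws = Us @\<^sub>r Vs in
      2 * (frob_norm (U * V\<^sup>T - M))\<^sup>2 \<le> (frob_norm (W * W\<^sup>T - Ws * Ws\<^sup>T))\<^sup>2 \<and>
      (frob_norm (W * W\<^sup>T - Ws * Ws\<^sup>T))\<^sup>2 \<le> \<gamma> * real rs * (spectral_norm (Xi f lam M))\<^sup>2 \<and>
      \<gamma> * real rs * (spectral_norm (Xi f lam M))\<^sup>2 \<le>
        2 * \<gamma> * real rs * (lam\<^sup>2 + (spectral_norm (grad f M))\<^sup>2))"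
proof (cases "0 < \<alpha> \<and> \<alpha> \<le> \<beta>")
  \<comment> \<open>\<open>RSC_RSS\<close> includes these inequalities, so the claim is vacuous and
    any positive constant serves.\<close>
  case False
  then have "\<not> RSC_RSS n m k \<alpha> \<beta> f" for n m k f by (auto simp: RSC_RSS_def)
  then show ?thesis by (intro exI[of _ 1]) simp
next
  case True
  then have ab: "0 < \<alpha>" "\<alpha> \<le> \<beta>" by simp_all
  show ?thesis
  proof (intro exI[of _ "10000 / \<alpha>\<^sup>2"] conjI allI impI)
    show "0 < 10000 / \<alpha>\<^sup>2" using ab by simp
    fix n m r rs :: nat and M :: "real mat" and f :: "real mat \<Rightarrow> real" and lam :: real
      and Us Vs U V :: "real mat"
    assume nm: "n \<le> m" and M: "M \<in> carrier_mat n m" and rs: "rs = mat_rank M"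
      and rs4: "4 * rs \<le> min m n" and rsr: "rs \<le> r"
      and f: "twice_cont_diff n m f" and R: "RSC_RSS n m rs \<alpha> \<beta> f" and lam: "0 < lam"
      and UVs: "(Us, Vs) \<in> opt_factors M" and U: "U \<in> carrier_mat n r" and V: "V \<in> carrier_mat m r"
      and crit: "critical_point f lam U V" and rk: "mat_rank (U * V\<^sup>T) \<le> rs"
      and psd: "hess_Phi_psd f lam U V"
    have "mat_rank M \<le> n" using rs rs4 by simp
    note opt = opt_factors_properties[OF M nm this UVs, folded rs]
    from twice_cont_diff_derivatives[OF f] obtain g h where gh:
      "\<And>x. supp n m (g x)" "\<And>x. ((\<lambda>y. f (tomat n m y)) has_derivative inner (g x)) (at x)"
      "\<And>x. (g has_derivative h x) (at x)" "\<And>x a b. inner (h x a) b = inner (h x b) a"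
      and grad: "\<And>X. X \<in> carrier_mat n m \<Longrightarrow> emb (grad f X) = g (emb X)" by blast
    have gM: "grad f M \<in> carrier_mat n m"
      using f M unfolding twice_cont_diff_def by (metis grad_eqI has_gradient_iff)
    have eX: "emb (U * V\<^sup>T) = emb U * ftrans (emb V)"
      using emb_mult[OF U, of "V\<^sup>T" m] V by (simp add: emb_transpose)
    have UVc: "U * V\<^sup>T \<in> carrier_mat n m" using U V by simp
    have rkX: "rk rs (emb U * ftrans (emb V))"
      using rk_mono[OF rk_emb[OF UVc] rk] by (simp add: eX)
    have \<Xi>: "emb (Xi f lam M) = lam *\<^sub>R fid (n + m) + offd n m (g (emb Us * ftrans (emb Vs)))"
      unfolding emb_Xi[OF M gM] grad[OF M] opt(3) ..
    note so = Phi_stacked_second_order[OF gh(1-3) U V]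
    have rsc: "\<alpha> * (norm a)\<^sup>2 \<le> inner (h x a) a \<and> inner (h x a) a \<le> \<beta> * (norm a)\<^sup>2"
      if "supp n m x" "supp n m a" "rk (2 * rs) x" "rk (4 * rs) a" for x a
      by (rule RSC_RSS_transfer[OF R hess_eq_derivative[OF gh(1-3)] that])
    have s: "norm ((lam *\<^sub>R fid (n + m) + offd n m (g (emb Us * ftrans (emb Vs)))) * y)
        \<le> spectral_norm (Xi f lam M) * norm y" for y
      unfolding \<Xi>[symmetric] by (rule spectral_norm_mult_le)
    note bound = factored_error_bound[OF ab assms lam supp_emb[OF U] supp_emb[OF V]
        supp_emb[OF opt(1)] supp_emb[OF opt(2)] opt(4) rsr gh(1,3,4) rsc
        conjunct1[OF so(1)[OF crit]] conjunct2[OF so(1)[OF crit]] rkX so(2)[OF psd] s]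
    define W where "W = U @\<^sub>r V"
    define Ws where "Ws = Us @\<^sub>r Vs"
    have W: "W \<in> carrier_mat (n + m) r" "emb W = fstack n m (emb U) (emb V)"
      unfolding W_def using carrier_append_rows[OF U V] emb_append_rows[OF U V] by auto
    have Ws: "Ws \<in> carrier_mat (n + m) rs" "emb Ws = fstack n m (emb Us) (emb Vs)"
      unfolding Ws_def using carrier_append_rows[OF opt(1,2)] emb_append_rows[OF opt(1,2)] by auto
    have E: "frob_norm (W * W\<^sup>T - Ws * Ws\<^sup>T) = norm (fstack n m (emb U) (emb V) * ftrans (fstack n m (emb U) (emb V))
        - fstack n m (emb Us) (emb Vs) * ftrans (fstack n m (emb Us) (emb Vs)))"
    proof -
      have "emb (W * W\<^sup>T) = emb W * ftrans (emb W)"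
        using emb_mult[OF W(1), of "W\<^sup>T" "n + m"] W(1) by (simp add: emb_transpose)
      moreover have "emb (Ws * Ws\<^sup>T) = emb Ws * ftrans (emb Ws)"
        using emb_mult[OF Ws(1), of "Ws\<^sup>T" "n + m"] Ws(1) by (simp add: emb_transpose)
      moreover have "emb (W * W\<^sup>T - Ws * Ws\<^sup>T) = emb (W * W\<^sup>T) - emb (Ws * Ws\<^sup>T)"
        by (rule emb_diff[of _ "n + m" "n + m"]) (use W(1) Ws(1) in auto)
      ultimately show ?thesis by (simp add: frob_norm_emb W(2) Ws(2))
    qed
    have X: "frob_norm (U * V\<^sup>T - M) = norm (emb U * ftrans (emb V) - emb Us * ftrans (emb Vs))"
      by (simp add: frob_norm_emb emb_diff[OF UVc M] eX opt(3))
    have "(spectral_norm (Xi f lam M))\<^sup>2 \<le> (lam + spectral_norm (grad f M))\<^sup>2"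
      using spectral_norm_Xi_le[of M n m f lam] M gM lam by (intro power_mono spectral_norm_nonneg) auto
    also have "\<dots> \<le> 2 * (lam\<^sup>2 + (spectral_norm (grad f M))\<^sup>2)"
      using zero_le_power2[of "lam - spectral_norm (grad f M)"] by (simp add: power2_sum power2_diff)
    finally have last: "10000 / \<alpha>\<^sup>2 * real rs * (spectral_norm (Xi f lam M))\<^sup>2 \<le>
        10000 / \<alpha>\<^sup>2 * real rs * (2 * (lam\<^sup>2 + (spectral_norm (grad f M))\<^sup>2))"
      by (intro mult_left_mono) auto
    show "let W = U @\<^sub>r V; Ws = Us @\<^sub>r Vs in
      2 * (frob_norm (U * V\<^sup>T - M))\<^sup>2 \<le> (frob_norm (W * W\<^sup>T - Ws * Ws\<^sup>T))\<^sup>2 \<and>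
      (frob_norm (W * W\<^sup>T - Ws * Ws\<^sup>T))\<^sup>2 \<le> 10000 / \<alpha>\<^sup>2 * real rs * (spectral_norm (Xi f lam M))\<^sup>2 \<and>
      10000 / \<alpha>\<^sup>2 * real rs * (spectral_norm (Xi f lam M))\<^sup>2 \<le>
        2 * (10000 / \<alpha>\<^sup>2) * real rs * (lam\<^sup>2 + (spectral_norm (grad f M))\<^sup>2)"
      unfolding Let_def W_def[symmetric] Ws_def[symmetric] E X
      using bound last by (simp add: mult.assoc mult.left_commute)
  qed
qed

end
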